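(* Let $R$ be a one-dimensional complete reduced hypersurface ring. Then $R$ is a domain if and only if each rigid $R$-module is free.
   Context: $R$ is a commutative Noetherian local ring and all $R$-modules are assumed to be finitely generated. An $R$-module $M$ is called rigid if $\operatorname{Ext}^1_R(M,M)=0$. A one-dimensional complete hypersurface ring is a one-dimensional ring of the form $R=S/(f)$, where $(S,\mathfrak{n})$ is a complete two-dimensional regular local ring and $0\neq f\in\mathfrak{n}$. *)

theory Defs
  imports
    "HOL-Algebra.Ring_Divisibility"
    "HOL-Algebra.Ideal_Product"
    "HOL-Algebra.Elementary_Groups"
    "HOL-Algebra.Module"
    "HOL-Library.Extended_Nat"
    "HOL-Library.Equipollence"
begin

section \<open>Commutative rings\<close>

definition local_ring :: "('a, 'b) ring_scheme \<Rightarrow> bool" where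
  "local_ring R \<longleftrightarrow> cring R \<and> (\<exists>!m. maximalideal m R)"

definition max_ideal :: "('a, 'b) ring_scheme \<Rightarrow> 'a set" where
  "max_ideal R = (THE m. maximalideal m R)"

text \<open>The supremum of the lengths \<open>n\<close> of chains \<open>P 0 \<subset> \<dots> \<subset> P n\<close> of prime ideals.\<close>

definition krull_dim :: "('a, 'b) ring_scheme \<Rightarrow> enat" where
  "krull_dim R = Sup {enat n | n. \<exists>P :: nat \<Rightarrow> 'a set.
     (\<forall>i\<le>n. primeideal (P i) R) \<and> (\<forall>i<n. P i \<subset> P (Suc i))}"

text \<open>The minimal number of generators of the maximal ideal (of a Noetherian local ring).\<close>

definition embedding_dim :: "('a, 'b) ring_scheme \<Rightarrow> nat" where
  "embedding_dim R =
     (LEAST n. \<exists>A \<subseteq> carrier R. finite A \<and> card A = n \<and> Idl\<^bsub>R\<^esub> A = max_ideal R)"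

definition regular_local_ring :: "('a, 'b) ring_scheme \<Rightarrow> bool" where
  "regular_local_ring R \<longleftrightarrow>
     noetherian_ring R \<and> local_ring R \<and> enat (embedding_dim R) = krull_dim R"

primrec ideal_power :: "('a, 'b) ring_scheme \<Rightarrow> 'a set \<Rightarrow> nat \<Rightarrow> 'a set" where
  "ideal_power R I 0 = carrier R"
| "ideal_power R I (Suc n) = ideal_prod R (ideal_power R I n) I"

text \<open>Completeness in the \<open>m\<close>-adic topology: the canonical map from \<open>R\<close> to the inverse limit
  of the rings \<open>R/m^n\<close> is bijective. A sequence \<open>x\<close> as below represents the element
  \<open>(x n + m^n)\<close> of the inverse limit.\<close>

definition complete_local_ring :: "('a, 'b) ring_scheme \<Rightarrow> bool" where
  "complete_local_ring R \<longleftrightarrow> local_ring R \<and>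
     (\<forall>x :: nat \<Rightarrow> 'a.
        (\<forall>n. x n \<in> carrier R \<and> x (Suc n) \<ominus>\<^bsub>R\<^esub> x n \<in> ideal_power R (max_ideal R) n) \<longrightarrow>
        (\<exists>!y. y \<in> carrier R \<and> (\<forall>n. y \<ominus>\<^bsub>R\<^esub> x n \<in> ideal_power R (max_ideal R) n)))"

definition reduced_ring :: "('a, 'b) ring_scheme \<Rightarrow> bool" where
  "reduced_ring R \<longleftrightarrow> cring R \<and>
     (\<forall>x \<in> carrier R. \<forall>n::nat. x [^]\<^bsub>R\<^esub> n = \<zero>\<^bsub>R\<^esub> \<longrightarrow> x = \<zero>\<^bsub>R\<^esub>)"

text \<open>\<open>R\<close> is a one-dimensional complete hypersurface ring, presented as \<open>S/(f)\<close>. The ring \<open>S\<close>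
  is an argument because a definition cannot quantify over the type of its elements.\<close>

definition complete_hypersurface_1 ::
    "('a, 'b) ring_scheme \<Rightarrow> ('s, 't) ring_scheme \<Rightarrow> 's \<Rightarrow> bool" where
  "complete_hypersurface_1 R S f \<longleftrightarrow>
     regular_local_ring S \<and> complete_local_ring S \<and> krull_dim S = 2 \<and>
     f \<in> max_ideal S \<and> f \<noteq> \<zero>\<^bsub>S\<^esub> \<and>
     cring R \<and> R \<simeq> S Quot (PIdl\<^bsub>S\<^esub> f) \<and> krull_dim R = 1"


section \<open>Free modules and presentations\<close>

text \<open>The free module on a set \<open>A\<close>: finitely supported functions \<open>A \<rightarrow> R\<close>, extended by zero
  outside \<open>A\<close>. The ring multiplication in the record type of modules plays no role.\<close>

definition free_on :: "('a, 'b) ring_scheme \<Rightarrow> 'x set \<Rightarrow> ('a, 'x \<Rightarrow> 'a) module" where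
  "free_on R A =
     \<lparr>carrier = {g. (\<forall>x. g x \<in> carrier R) \<and> (\<forall>x. x \<notin> A \<longrightarrow> g x = \<zero>\<^bsub>R\<^esub>) \<and>
                    finite {x. g x \<noteq> \<zero>\<^bsub>R\<^esub>}},
      monoid.mult = undefined, one = undefined,
      zero = (\<lambda>x. \<zero>\<^bsub>R\<^esub>),
      add = (\<lambda>g h x. g x \<oplus>\<^bsub>R\<^esub> h x),
      smult = (\<lambda>r g x. r \<otimes>\<^bsub>R\<^esub> g x)\<rparr>"

definition lincomb :: "('a, 'b) ring_scheme \<Rightarrow> ('a, 'm) module \<Rightarrow> ('m \<Rightarrow> 'a) \<Rightarrow> 'm" where
  "lincomb R M g = (\<Oplus>\<^bsub>M\<^esub>x\<in>{x. g x \<noteq> \<zero>\<^bsub>R\<^esub>}. g x \<odot>\<^bsub>M\<^esub> x)"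

definition fin_gen_module :: "('a, 'b) ring_scheme \<Rightarrow> ('a, 'm) module \<Rightarrow> bool" where
  "fin_gen_module R M \<longleftrightarrow> module R M \<and>
     (\<exists>B \<subseteq> carrier M. finite B \<and> lincomb R M ` carrier (free_on R B) = carrier M)"

text \<open>A module is free if it has a basis \<open>B\<close>.\<close>

definition free_module :: "('a, 'b) ring_scheme \<Rightarrow> ('a, 'm) module \<Rightarrow> bool" where
  "free_module R M \<longleftrightarrow> module R M \<and>
     (\<exists>B \<subseteq> carrier M. bij_betw (lincomb R M) (carrier (free_on R B)) (carrier M))"

definition relations :: "('a, 'b) ring_scheme \<Rightarrow> ('a, 'm) module \<Rightarrow> 'm set \<Rightarrow> ('m \<Rightarrow> 'a) set" where
  "relations R M A = {g \<in> carrier (free_on R A). lincomb R M g = \<zero>\<^bsub>M\<^esub>}"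

definition module_hom ::
    "('a, 'b) ring_scheme \<Rightarrow> ('a, 'm) module \<Rightarrow> ('a, 'n) module \<Rightarrow> ('m \<Rightarrow> 'n) set" where
  "module_hom R M N =
     {h \<in> extensional (carrier M). h \<in> hom (add_monoid M) (add_monoid N) \<and>
        (\<forall>r \<in> carrier R. \<forall>x \<in> carrier M. h (r \<odot>\<^bsub>M\<^esub> x) = r \<odot>\<^bsub>N\<^esub> h x)}"


section \<open>Ext\<close>

text \<open>The beginning \<open>F2 \<rightarrow> F1 \<rightarrow> F0 \<rightarrow> M \<rightarrow> 0\<close> of the canonical free resolution of \<open>M\<close>: every
  \<open>Fi\<close> is free on the set of all elements of the module it covers (\<open>M\<close>, respectively the kernel of
  the previous map), and every map, the augmentation included, is \<^const>\<open>lincomb\<close>.\<close>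

definition res0 :: "('a, 'b) ring_scheme \<Rightarrow> ('a, 'm) module \<Rightarrow> ('a, 'm \<Rightarrow> 'a) module" where
  "res0 R M = free_on R (carrier M)"

definition res1 ::
    "('a, 'b) ring_scheme \<Rightarrow> ('a, 'm) module \<Rightarrow> ('a, ('m \<Rightarrow> 'a) \<Rightarrow> 'a) module" where
  "res1 R M = free_on R (relations R M (carrier M))"

definition res2 ::
    "('a, 'b) ring_scheme \<Rightarrow> ('a, 'm) module \<Rightarrow> ('a, (('m \<Rightarrow> 'a) \<Rightarrow> 'a) \<Rightarrow> 'a) module" where
  "res2 R M = free_on R (relations R (res0 R M) (relations R M (carrier M)))"

definition Ext1_cocycles ::
    "('a, 'b) ring_scheme \<Rightarrow> ('a, 'm) module \<Rightarrow> ('a, 'n) module \<Rightarrow> ((('m \<Rightarrow> 'a) \<Rightarrow> 'a) \<Rightarrow> 'n) set" where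
  "Ext1_cocycles R M N =
     {h \<in> module_hom R (res1 R M) N.
        \<forall>z \<in> carrier (res2 R M). h (lincomb R (res1 R M) z) = \<zero>\<^bsub>N\<^esub>}"

definition Ext1_coboundaries ::
    "('a, 'b) ring_scheme \<Rightarrow> ('a, 'm) module \<Rightarrow> ('a, 'n) module \<Rightarrow> ((('m \<Rightarrow> 'a) \<Rightarrow> 'a) \<Rightarrow> 'n) set" where
  "Ext1_coboundaries R M N =
     {\<lambda>z \<in> carrier (res1 R M). h (lincomb R (res0 R M) z) | h. h \<in> module_hom R (res0 R M) N}"

text \<open>The first cohomology group of the complex \<open>Hom(F0,N) \<rightarrow> Hom(F1,N) \<rightarrow> Hom(F2,N)\<close>.\<close>

definition Ext1 ::
    "('a, 'b) ring_scheme \<Rightarrow> ('a, 'm) module \<Rightarrow> ('a, 'n) module \<Rightarrow> ((('m \<Rightarrow> 'a) \<Rightarrow> 'a) \<Rightarrow> 'n) set monoid"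
  where
  "Ext1 R M N =
     \<lparr>carrier = Ext1_cocycles R M N,
      monoid.mult = (\<lambda>h k. \<lambda>z \<in> carrier (res1 R M). h z \<oplus>\<^bsub>N\<^esub> k z),
      one = (\<lambda>z \<in> carrier (res1 R M). \<zero>\<^bsub>N\<^esub>)\<rparr> Mod Ext1_coboundaries R M N"

definition rigid :: "('a, 'b) ring_scheme \<Rightarrow> ('a, 'm) module \<Rightarrow> bool" where
  "rigid R M \<longleftrightarrow> trivial_group (Ext1 R M M)"


section \<open>Well-definedness\<close>

lemma free_on_module:
  assumes "cring R" shows "module R (free_on R A)"
proof -
  interpret R: cring R by fact
  have fin: "finite {x. g x \<oplus>\<^bsub>R\<^esub> h x \<noteq> \<zero>\<^bsub>R\<^esub>}"
    if "finite {x. g x \<noteq> \<zero>\<^bsub>R\<^esub>}" "finite {x. h x \<noteq> \<zero>\<^bsub>R\<^esub>}" for g h :: "'c \<Rightarrow> 'a"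
    by (rule finite_subset[OF _ finite_UnI[OF that]]) auto
  have fins: "finite {x. r \<otimes>\<^bsub>R\<^esub> g x \<noteq> \<zero>\<^bsub>R\<^esub>}"
    if "r \<in> carrier R" "finite {x. g x \<noteq> \<zero>\<^bsub>R\<^esub>}" for r and g :: "'c \<Rightarrow> 'a"
    by (rule finite_subset[OF _ that(2)]) (use that in auto)
  show ?thesis
  proof (intro moduleI abelian_groupI)
    fix g assume g: "g \<in> carrier (free_on R A)"
    show "\<exists>h\<in>carrier (free_on R A). h \<oplus>\<^bsub>free_on R A\<^esub> g = \<zero>\<^bsub>free_on R A\<^esub>"
    proof (rule bexI[of _ "\<lambda>x. \<ominus>\<^bsub>R\<^esub> g x"])
      show "(\<lambda>x. \<ominus>\<^bsub>R\<^esub> g x) \<in> carrier (free_on R A)"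
        using g by (auto simp: free_on_def elim!: rev_finite_subset)
    qed (use g in \<open>auto simp: free_on_def R.l_neg\<close>)
  qed (use assms in \<open>auto simp: free_on_def R.a_ac R.m_assoc R.l_distr R.r_distr fin fins\<close>)
qed

lemma lincomb_closed:
  fixes M :: "('a,'m) module" and R (structure)
  assumes M: "module R M" and "A \<subseteq> carrier M" "g \<in> carrier (free_on R A)"
  shows "lincomb R M g \<in> carrier M"
proof -
  interpret module R M by fact
  show ?thesis unfolding lincomb_def by (rule M.finsum_closed) (use assms in \<open>auto simp: free_on_def\<close>)
qed

lemma lincomb_superset:
  fixes M :: "('a,'m) module" and R (structure)
  assumes M: "module R M" and "A \<subseteq> carrier M" "g \<in> carrier (free_on R A)" "finite T" "{x. g x \<noteq> \<zero>} \<subseteq> T" "T \<subseteq> carrier M"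
  shows "lincomb R M g = (\<Oplus>\<^bsub>M\<^esub>x\<in>T. g x \<odot>\<^bsub>M\<^esub> x)"
proof -
  interpret module R M by fact
  have z: "g i \<odot>\<^bsub>M\<^esub> i = \<zero>\<^bsub>M\<^esub>" if "i \<in> T - {x. g x \<noteq> \<zero>}" for i
    using that assms by auto
  have c: "g x \<odot>\<^bsub>M\<^esub> x \<in> carrier M" if "x \<in> T" for x using that assms by (auto simp: free_on_def)
  show ?thesis unfolding lincomb_def
  by (rule M.add.finprod_mono_neutral_cong_left) (use assms z c in auto)
qed

lemma lincomb_add:
  fixes M :: "('a,'m) module" and R (structure)
  assumes M: "module R M" and "A \<subseteq> carrier M" "g \<in> carrier (free_on R A)" "h \<in> carrier (free_on R A)"
  shows "lincomb R M (g \<oplus>\<^bsub>free_on R A\<^esub> h) = lincomb R M g \<oplus>\<^bsub>M\<^esub> lincomb R M h"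
proof -
  interpret module R M by fact
  interpret F: module R "free_on R A" by (rule free_on_module) (rule R.is_cring)
  let ?T = "{x. g x \<noteq> \<zero>} \<union> {x. h x \<noteq> \<zero>}"
  have T: "finite ?T" "?T \<subseteq> A" using assms by (auto simp: free_on_def)
  have c: "g x \<in> carrier R" "h x \<in> carrier R" for x using assms by (auto simp: free_on_def)
  have s: "{x. (g \<oplus>\<^bsub>free_on R A\<^esub> h) x \<noteq> \<zero>} \<subseteq> ?T" by (auto simp: free_on_def)
  have "lincomb R M (g \<oplus>\<^bsub>free_on R A\<^esub> h) = (\<Oplus>\<^bsub>M\<^esub>x\<in>?T. (g \<oplus>\<^bsub>free_on R A\<^esub> h) x \<odot>\<^bsub>M\<^esub> x)"
    using s T assms by (intro lincomb_superset[OF M, of A]) auto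
  also have "\<dots> = (\<Oplus>\<^bsub>M\<^esub>x\<in>?T. g x \<odot>\<^bsub>M\<^esub> x \<oplus>\<^bsub>M\<^esub> h x \<odot>\<^bsub>M\<^esub> x)"
    by (rule M.finsum_cong') (use T assms c in \<open>auto simp: free_on_def intro!: smult_l_distr M.a_closed smult_closed\<close>)
  also have "\<dots> = (\<Oplus>\<^bsub>M\<^esub>x\<in>?T. g x \<odot>\<^bsub>M\<^esub> x) \<oplus>\<^bsub>M\<^esub> (\<Oplus>\<^bsub>M\<^esub>x\<in>?T. h x \<odot>\<^bsub>M\<^esub> x)"
    by (rule M.finsum_addf) (use T assms c in auto)
  also have "\<dots> = lincomb R M g \<oplus>\<^bsub>M\<^esub> lincomb R M h"
    using T assms by (subst (1 2) lincomb_superset[OF M, of A]) auto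
  finally show ?thesis .
qed

lemma lincomb_smult:
  fixes M :: "('a,'m) module" and R (structure)
  assumes M: "module R M" and "A \<subseteq> carrier M" "g \<in> carrier (free_on R A)" "r \<in> carrier R"
  shows "lincomb R M (r \<odot>\<^bsub>free_on R A\<^esub> g) = r \<odot>\<^bsub>M\<^esub> lincomb R M g"
proof -
  interpret module R M by fact
  let ?T = "{x. g x \<noteq> \<zero>}"
  have T: "finite ?T" "?T \<subseteq> A" using assms by (auto simp: free_on_def)
  interpret F: module R "free_on R A" by (rule free_on_module) (rule R.is_cring)
  have c: "g x \<in> carrier R" for x using assms by (auto simp: free_on_def)
  have s: "{x. (r \<odot>\<^bsub>free_on R A\<^esub> g) x \<noteq> \<zero>} \<subseteq> ?T" using assms by (auto simp: free_on_def)
  have "lincomb R M (r \<odot>\<^bsub>free_on R A\<^esub> g) = (\<Oplus>\<^bsub>M\<^esub>x\<in>?T. (r \<odot>\<^bsub>free_on R A\<^esub> g) x \<odot>\<^bsub>M\<^esub> x)"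
    using s T assms by (intro lincomb_superset[OF M, of A]) auto
  also have "\<dots> = (\<Oplus>\<^bsub>M\<^esub>x\<in>?T. r \<odot>\<^bsub>M\<^esub> (g x \<odot>\<^bsub>M\<^esub> x))"
    by (rule M.finsum_cong') (use T assms c in \<open>auto simp: free_on_def intro!: smult_assoc1 smult_closed\<close>)
  also have "\<dots> = r \<odot>\<^bsub>M\<^esub> (\<Oplus>\<^bsub>M\<^esub>x\<in>?T. g x \<odot>\<^bsub>M\<^esub> x)"
    by (rule finsum_smult_ldistr[symmetric]) (use T assms c in auto)
  finally show ?thesis by (simp add: lincomb_def)
qed

lemma module_hom_zero:
  assumes "module R M" "module R N" "h \<in> module_hom R M N"
  shows "h \<zero>\<^bsub>M\<^esub> = \<zero>\<^bsub>N\<^esub>"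
proof -
  interpret M: module R M by fact
  interpret N: module R N by fact
  have "h \<in> hom (add_monoid M) (add_monoid N)" using assms by (auto simp: module_hom_def)
  from hom_one[OF this] show ?thesis by (simp add: M.a_group N.a_group)
qed

lemma Ext1_group:
  assumes "module R M" "module R N"
  defines "G \<equiv> \<lparr>carrier = Ext1_cocycles R M N,
      monoid.mult = (\<lambda>h k. \<lambda>z \<in> carrier (res1 R M). h z \<oplus>\<^bsub>N\<^esub> k z),
      one = (\<lambda>z \<in> carrier (res1 R M). \<zero>\<^bsub>N\<^esub>)\<rparr>"
  shows "comm_group G" "subgroup (Ext1_coboundaries R M N) G"
proof -
  interpret M: module R M by fact
  interpret N: module R N by fact
  have R: "cring R" by (rule M.R.is_cring)
  interpret F0: module R "res0 R M" unfolding res0_def by (rule free_on_module[OF R])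
  interpret F1: module R "res1 R M" unfolding res1_def by (rule free_on_module[OF R])
  interpret F2: module R "res2 R M" unfolding res2_def by (rule free_on_module[OF R])
  note F0m = free_on_module[OF R, of "carrier M", folded res0_def] and F1m = free_on_module[OF R, of "relations R M (carrier M)", folded res1_def]
  have sub: "relations R M (carrier M) \<subseteq> carrier (res0 R M)"
    "relations R (res0 R M) (relations R M (carrier M)) \<subseteq> carrier (res1 R M)"
    by (auto simp: relations_def res0_def res1_def)
  have d2c: "lincomb R (res1 R M) z \<in> carrier (res1 R M)" if "z \<in> carrier (res2 R M)" for z
    using lincomb_closed[OF F1m sub(2)] that by (simp add: res2_def)
  have d1c: "lincomb R (res0 R M) z \<in> carrier (res0 R M)" if "z \<in> carrier (res1 R M)" for z
    using lincomb_closed[OF F0m sub(1)] that by (simp add: res1_def)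
  show G: "comm_group G"
  proof (rule comm_groupI)
    fix h assume h: "h \<in> carrier G"
    show "\<exists>k\<in>carrier G. k \<otimes>\<^bsub>G\<^esub> h = \<one>\<^bsub>G\<^esub>"
    proof (rule bexI[of _ "\<lambda>z \<in> carrier (res1 R M). \<ominus>\<^bsub>N\<^esub> h z"])
      show "(\<lambda>z \<in> carrier (res1 R M). \<ominus>\<^bsub>N\<^esub> h z) \<in> carrier G"
        using h by (auto simp: G_def Ext1_cocycles_def module_hom_def hom_def Pi_iff d2c N.minus_add N.smult_r_minus)
    qed (use h in \<open>auto simp: G_def Ext1_cocycles_def module_hom_def hom_def Pi_iff N.l_neg fun_eq_iff restrict_def extensional_def\<close>)
  qed (auto simp: G_def Ext1_cocycles_def module_hom_def hom_def Pi_iff d2c N.a_ac N.smult_r_distr fun_eq_iff restrict_def extensional_def)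
  have d1a: "lincomb R (res0 R M) (y \<oplus>\<^bsub>res1 R M\<^esub> z) = lincomb R (res0 R M) y \<oplus>\<^bsub>res0 R M\<^esub> lincomb R (res0 R M) z"
    if "y \<in> carrier (res1 R M)" "z \<in> carrier (res1 R M)" for y z
    using lincomb_add[OF F0m sub(1)] that by (simp add: res1_def)
  have d1s: "lincomb R (res0 R M) (r \<odot>\<^bsub>res1 R M\<^esub> z) = r \<odot>\<^bsub>res0 R M\<^esub> lincomb R (res0 R M) z"
    if "r \<in> carrier R" "z \<in> carrier (res1 R M)" for r z
    using lincomb_smult[OF F0m sub(1)] that by (simp add: res1_def)
  have d10: "lincomb R (res0 R M) \<zero>\<^bsub>res1 R M\<^esub> = \<zero>\<^bsub>res0 R M\<^esub>"
    by (simp add: lincomb_def res1_def free_on_def)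
  have d1d2: "lincomb R (res0 R M) (lincomb R (res1 R M) z) = \<zero>\<^bsub>res0 R M\<^esub>"
    if z: "z \<in> carrier (res2 R M)" for z
  proof -
    let ?K = "relations R (res0 R M) (relations R M (carrier M))"
    have c: "z x \<in> carrier R" for x using z by (auto simp: res2_def free_on_def)
    have T: "finite {x. z x \<noteq> \<zero>\<^bsub>R\<^esub>}" "{x. z x \<noteq> \<zero>\<^bsub>R\<^esub>} \<subseteq> ?K"
      using z by (auto simp: res2_def free_on_def)
    have "lincomb R (res0 R M) (\<Oplus>\<^bsub>res1 R M\<^esub>x\<in>T. z x \<odot>\<^bsub>res1 R M\<^esub> x) = \<zero>\<^bsub>res0 R M\<^esub>"
      if "finite T" "T \<subseteq> ?K" for T
      using that
    proof (induction T)
      case (insert x T)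
      have x: "x \<in> carrier (res1 R M)" "T \<subseteq> carrier (res1 R M)" "lincomb R (res0 R M) x = \<zero>\<^bsub>res0 R M\<^esub>"
        using insert.prems sub(2) by (auto simp: relations_def res1_def)
      have "(\<Oplus>\<^bsub>res1 R M\<^esub>y\<in>T. z y \<odot>\<^bsub>res1 R M\<^esub> y) \<in> carrier (res1 R M)"
        by (rule F1.finsum_closed) (use x c in auto)
      moreover have "(\<Oplus>\<^bsub>res1 R M\<^esub>y\<in>insert x T. z y \<odot>\<^bsub>res1 R M\<^esub> y) = z x \<odot>\<^bsub>res1 R M\<^esub> x \<oplus>\<^bsub>res1 R M\<^esub> (\<Oplus>\<^bsub>res1 R M\<^esub>y\<in>T. z y \<odot>\<^bsub>res1 R M\<^esub> y)"
        by (rule F1.finsum_insert) (use insert.hyps x c in auto)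
      ultimately show ?case using insert x c by (simp add: d1a d1s)
    qed (simp add: d10)
    from this[OF T] show ?thesis unfolding lincomb_def[of R "res1 R M" z] .
  qed
  have hc: "h x \<in> carrier N" if "h \<in> module_hom R (res0 R M) N" "x \<in> carrier (res0 R M)" for h x
    using that by (auto simp: module_hom_def hom_def)
  have ha: "h (x \<oplus>\<^bsub>res0 R M\<^esub> y) = h x \<oplus>\<^bsub>N\<^esub> h y"
    if "h \<in> module_hom R (res0 R M) N" "x \<in> carrier (res0 R M)" "y \<in> carrier (res0 R M)" for h x y
    using that by (auto simp: module_hom_def hom_def)
  have hs: "h (r \<odot>\<^bsub>res0 R M\<^esub> x) = r \<odot>\<^bsub>N\<^esub> h x"
    if "h \<in> module_hom R (res0 R M) N" "x \<in> carrier (res0 R M)" "r \<in> carrier R" for h x r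
    using that by (auto simp: module_hom_def)
  have h0: "h \<zero>\<^bsub>res0 R M\<^esub> = \<zero>\<^bsub>N\<^esub>" if "h \<in> module_hom R (res0 R M) N" for h
    by (rule module_hom_zero[OF F0m assms(2) that])
  have incl: "Ext1_coboundaries R M N \<subseteq> carrier G"
    by (auto simp: Ext1_coboundaries_def G_def Ext1_cocycles_def module_hom_def[of R "res1 R M"] hom_def
        d1c d2c d1d2 d1a d1s hc ha hs h0)
  interpret G: comm_group G by fact
  have add: "(\<lambda>x \<in> carrier (res0 R M). h x \<oplus>\<^bsub>N\<^esub> k x) \<in> module_hom R (res0 R M) N"
    if "h \<in> module_hom R (res0 R M) N" "k \<in> module_hom R (res0 R M) N" for h k
    using that by (auto simp: module_hom_def hom_def Pi_iff N.smult_r_distr N.a_ac)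
  have neg: "(\<lambda>x \<in> carrier (res0 R M). \<ominus>\<^bsub>N\<^esub> h x) \<in> module_hom R (res0 R M) N"
    if "h \<in> module_hom R (res0 R M) N" for h
    using that by (auto simp: module_hom_def hom_def Pi_iff N.smult_r_minus N.minus_add)
  have one: "(\<lambda>x \<in> carrier (res0 R M). \<zero>\<^bsub>N\<^esub>) \<in> module_hom R (res0 R M) N"
    by (auto simp: module_hom_def hom_def)
  show "subgroup (Ext1_coboundaries R M N) G"
  proof (rule G.subgroupI[OF incl])
    show "Ext1_coboundaries R M N \<noteq> {}" using one by (auto simp: Ext1_coboundaries_def)
  next
    fix a assume a: "a \<in> Ext1_coboundaries R M N"
    then obtain h where h: "h \<in> module_hom R (res0 R M) N"
      "a = (\<lambda>z \<in> carrier (res1 R M). h (lincomb R (res0 R M) z))" by (auto simp: Ext1_coboundaries_def)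
    let ?b = "\<lambda>z \<in> carrier (res1 R M). (\<lambda>x \<in> carrier (res0 R M). \<ominus>\<^bsub>N\<^esub> h x) (lincomb R (res0 R M) z)"
    have b: "?b \<in> Ext1_coboundaries R M N" using neg[OF h(1)] unfolding Ext1_coboundaries_def by blast
    have "?b \<otimes>\<^bsub>G\<^esub> a = \<one>\<^bsub>G\<^esub>" using h by (auto simp: G_def fun_eq_iff hc d1c N.l_neg)
    then have "inv\<^bsub>G\<^esub> a = ?b" using a b incl by (intro G.inv_equality) auto
    then show "inv\<^bsub>G\<^esub> a \<in> Ext1_coboundaries R M N" using b by simp
  next
    fix a b assume "a \<in> Ext1_coboundaries R M N" "b \<in> Ext1_coboundaries R M N"
    then obtain h k where h: "h \<in> module_hom R (res0 R M) N"
      "a = (\<lambda>z \<in> carrier (res1 R M). h (lincomb R (res0 R M) z))"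
      and k: "k \<in> module_hom R (res0 R M) N"
      "b = (\<lambda>z \<in> carrier (res1 R M). k (lincomb R (res0 R M) z))" by (auto simp: Ext1_coboundaries_def)
    have "a \<otimes>\<^bsub>G\<^esub> b = (\<lambda>z \<in> carrier (res1 R M). (\<lambda>x \<in> carrier (res0 R M). h x \<oplus>\<^bsub>N\<^esub> k x) (lincomb R (res0 R M) z))"
      using h k by (auto simp: G_def fun_eq_iff d1c)
    then show "a \<otimes>\<^bsub>G\<^esub> b \<in> Ext1_coboundaries R M N" using add[OF h(1) k(1)] unfolding Ext1_coboundaries_def by blast
  qed
qed

lemma Ext1_comm_group:
  assumes "module R M" "module R N"
  shows "comm_group (Ext1 R M N)"
  unfolding Ext1_def using Ext1_group[OF assms] by (intro comm_group.abelian_FactGroup)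

text \<open>Modules can only be quantified over with elements in a fixed type. If \<open>'m\<close> has room for the
  lists over \<open>R\<close>, then the modules with elements in \<open>'m\<close> are, up to isomorphism, all finitely
  generated modules, whatever the type of their elements.\<close>

lemma fin_gen_module_copy:
  fixes N :: "('a, 'n) module"
  assumes "fin_gen_module R N" and "lists (carrier R) \<lesssim> (UNIV :: 'm set)"
  shows "\<exists>(M :: ('a, 'm) module) h. module R M \<and> h \<in> module_hom R N M \<and> bij_betw h (carrier N) (carrier M)"
proof -
  obtain B where B: "B \<subseteq> carrier N" "finite B" "lincomb R N ` carrier (free_on R B) = carrier N"
    and N: "module R N"
    using assms(1) by (auto simp: fin_gen_module_def)
  interpret N: module R N by fact
  obtain bs where bs: "set bs = B" using B finite_list by blast
  have "inj_on (\<lambda>g. map g bs) (carrier (free_on R B))"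
  proof (intro inj_onI ext)
    fix g h x assume "g \<in> carrier (free_on R B)" "h \<in> carrier (free_on R B)" "map g bs = map h bs"
    then show "g x = h x" using bs by (cases "x \<in> B") (auto simp: free_on_def)
  qed
  then have "carrier (free_on R B) \<lesssim> lists (carrier R)"
    by (auto simp: lepoll_def free_on_def intro!: exI[of _ "\<lambda>g. map g bs"])
  moreover have "carrier N \<lesssim> carrier (free_on R B)"
    using B(3) by (metis image_lepoll)
  ultimately obtain j :: "'n \<Rightarrow> 'm" where j: "inj_on j (carrier N)"
    using assms(2) by (meson lepoll_def lepoll_trans)
  define i where "i = inv_into (carrier N) j"
  have ij[simp]: "i (j x) = x" if "x \<in> carrier N" for x using that j by (simp add: i_def)
  define M :: "('a, 'm) module" where
    "M = \<lparr>carrier = j ` carrier N, monoid.mult = undefined, one = undefined, zero = j \<zero>\<^bsub>N\<^esub>,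
       add = \<lambda>x y. j (i x \<oplus>\<^bsub>N\<^esub> i y), smult = \<lambda>r x. j (r \<odot>\<^bsub>N\<^esub> i x)\<rparr>"
  have "module R M"
  proof (intro moduleI abelian_groupI)
    fix x assume "x \<in> carrier M"
    then show "\<exists>y\<in>carrier M. y \<oplus>\<^bsub>M\<^esub> x = \<zero>\<^bsub>M\<^esub>"
      by (auto simp: M_def N.l_neg intro!: bexI[of _ "\<ominus>\<^bsub>N\<^esub> _"])
  qed (auto simp: M_def N.a_ac N.smult_l_distr N.smult_r_distr N.smult_assoc1 N.R.is_cring)
  moreover have "restrict j (carrier N) \<in> module_hom R N M"
    by (auto simp: module_hom_def hom_def M_def)
  moreover have "bij_betw (restrict j (carrier N)) (carrier N) (carrier M)"
    using j by (auto simp: bij_betw_def M_def)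
  ultimately show ?thesis by blast
qed

end

theory Submission
  imports Defs
begin

text \<open>
  Over a commutative ring, the vanishing of \<open>Ext(M, N)\<close> in degree one can be read off from a set of generators of
  \<open>M\<close>: it means that every homomorphism from the relations to \<open>N\<close> extends to the free module on the
  generators (\<open>Ext1_trivial_iff\<close>). Both directions of the theorem work with this criterion.

  If \<open>R\<close> is reduced and \<open>a b = 0\<close> with \<open>a\<close> and \<open>b\<close> nonzero, the ideal \<open>R a\<close> is rigid, because it has no
  nonzero homomorphisms from its relations to itself. It is not free, because \<open>b\<close> kills it
  (\<open>rigid_not_free_if_not_domain\<close>).

  Conversely, let \<open>R = S/(f)\<close> be a domain and \<open>M\<close> a rigid module. Let \<open>G\<close> be free on a minimal set of
  generators of \<open>M\<close>, and \<open>N\<close> the module of relations. The claim is \<open>N = 0\<close> (\<open>relations_vanish\<close>).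

  As a module over the two-dimensional regular ring \<open>S\<close>, the torsion-free \<open>R\<close>-module \<open>N\<close> has a presentation
  by a square matrix \<open>A\<close>, and a matrix \<open>B\<close> satisfies \<open>A B = B A = f\<close> (\<open>matrix_factorization\<close>). For this one
  needs that \<open>S\<close> is a domain and that its quotient by one of two generators of the maximal ideal is a discrete
  valuation ring (\<open>regular_local_ring_dim_2\<close>). Over \<open>R\<close>, the matrices \<open>A\<close> and \<open>B\<close> alternate in a free
  resolution of \<open>N\<close>. Consequently \<open>Ext(N, L)\<close> is two-periodic for every \<open>L\<close>, and it vanishes for free \<open>L\<close>
  (\<open>factorization_row_exact\<close>). The latter and the rigidity of \<open>M\<close> imply that \<open>Ext(N, N)\<close> vanishes in degree
  one.

  This is where it matters that \<open>R\<close> is a domain of dimension one: \<open>N\<close> contains a free module with a quotient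
  of finite length (\<open>power_in_height_two_ideal\<close>, \<open>length_span_finite\<close>). On the free module both Ext groups
  vanish, and on a module of finite length they have the same length; hence they have the same length on \<open>N\<close>
  (\<open>two_periodic_exactness\<close>). So \<open>Ext(N, N)\<close> vanishes in degree two as well, which means that \<open>N\<close> is a direct
  summand of a free module. A nonzero such \<open>N\<close> has a homomorphism to \<open>M\<close> that does not map into the maximal
  ideal times \<open>M\<close>. But all homomorphisms from \<open>N\<close> to \<open>M\<close> extend to \<open>G\<close>, and \<open>N\<close> lies in the maximal ideal
  times \<open>G\<close>, by minimality of the generators.
\<close>

section \<open>Linear maps, submodules and spans\<close>

definition linear_map ::
    "('a, 'b) ring_scheme \<Rightarrow> ('a, 'm) module \<Rightarrow> ('a, 'n) module \<Rightarrow> ('m \<Rightarrow> 'n) \<Rightarrow> bool" where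
  "linear_map R M N h \<longleftrightarrow> h \<in> carrier M \<rightarrow> carrier N \<and>
     (\<forall>x \<in> carrier M. \<forall>y \<in> carrier M. h (x \<oplus>\<^bsub>M\<^esub> y) = h x \<oplus>\<^bsub>N\<^esub> h y) \<and>
     (\<forall>r \<in> carrier R. \<forall>x \<in> carrier M. h (r \<odot>\<^bsub>M\<^esub> x) = r \<odot>\<^bsub>N\<^esub> h x)"

lemma linear_mapD:
  assumes "linear_map R M N h"
  shows "x \<in> carrier M \<Longrightarrow> h x \<in> carrier N"
    and "x \<in> carrier M \<Longrightarrow> y \<in> carrier M \<Longrightarrow> h (x \<oplus>\<^bsub>M\<^esub> y) = h x \<oplus>\<^bsub>N\<^esub> h y"
    and "r \<in> carrier R \<Longrightarrow> x \<in> carrier M \<Longrightarrow> h (r \<odot>\<^bsub>M\<^esub> x) = r \<odot>\<^bsub>N\<^esub> h x"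
  using assms by (auto simp: linear_map_def)

lemma module_hom_iff: "h \<in> module_hom R M N \<longleftrightarrow> h \<in> extensional (carrier M) \<and> linear_map R M N h"
  by (auto simp: module_hom_def linear_map_def hom_def)

lemma linear_map_cong:
  assumes "module R M" "linear_map R M N h" "\<And>x. x \<in> carrier M \<Longrightarrow> k x = h x"
  shows "linear_map R M N k"
proof -
  interpret module R M by fact
  show ?thesis using assms(2,3) by (auto simp: linear_map_def Pi_iff)
qed

lemma restrict_module_hom:
  assumes "module R M" "linear_map R M N h"
  shows "restrict h (carrier M) \<in> module_hom R M N"
  unfolding module_hom_iff using linear_map_cong[OF assms, of "restrict h (carrier M)"] by auto

lemma linear_map_comp:
  "linear_map R M N h \<Longrightarrow> linear_map R N P k \<Longrightarrow> linear_map R M P (\<lambda>x. k (h x))"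
  by (auto simp: linear_map_def Pi_iff)

lemma linear_map_into:
  "linear_map R M N h \<Longrightarrow> h ` carrier M \<subseteq> H \<Longrightarrow> linear_map R M (N\<lparr>carrier := H\<rparr>) h"
  by (auto simp: linear_map_def)

lemma linear_map_from:
  "linear_map R M (N\<lparr>carrier := H\<rparr>) h \<Longrightarrow> H \<subseteq> carrier N \<Longrightarrow> linear_map R M N h"
  by (auto simp: linear_map_def)

lemma set_add_memI: "h \<in> H \<Longrightarrow> k \<in> K \<Longrightarrow> h \<oplus>\<^bsub>M\<^esub> k \<in> H <+>\<^bsub>M\<^esub> K"
  by (auto simp: set_add_def')

lemma set_add_mono_right: "K \<subseteq> K' \<Longrightarrow> H <+>\<^bsub>M\<^esub> K \<subseteq> H <+>\<^bsub>M\<^esub> K'"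
  unfolding set_add_def' by blast

lemma set_add_mono_left: "H \<subseteq> H' \<Longrightarrow> H <+>\<^bsub>M\<^esub> K \<subseteq> H' <+>\<^bsub>M\<^esub> K"
  unfolding set_add_def' by blast

context module
begin

lemma minus_eq_smult: "x \<in> carrier M \<Longrightarrow> \<ominus>\<^bsub>M\<^esub> x = (\<ominus> \<one>) \<odot>\<^bsub>M\<^esub> x"
  by (simp add: smult_l_minus)

lemma minus_add_cancel:
  "x \<in> carrier M \<Longrightarrow> y \<in> carrier M \<Longrightarrow> (x \<ominus>\<^bsub>M\<^esub> y) \<oplus>\<^bsub>M\<^esub> y = x"
  by (simp add: a_minus_def M.a_assoc M.l_neg)

lemma submodule_iff:
  "submodule H R M \<longleftrightarrow> H \<subseteq> carrier M \<and> \<zero>\<^bsub>M\<^esub> \<in> H \<and> (\<forall>x\<in>H. \<forall>y\<in>H. x \<oplus>\<^bsub>M\<^esub> y \<in> H) \<and>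
     (\<forall>r\<in>carrier R. \<forall>x\<in>H. r \<odot>\<^bsub>M\<^esub> x \<in> H)"
  (is "_ \<longleftrightarrow> ?P")
proof
  assume "submodule H R M"
  then interpret H: submodule H R M .
  show ?P using H.subset H.one_closed H.m_closed H.smult_closed by auto
next
  assume P: ?P
  then show "submodule H R M"
    by (intro submoduleI) (auto simp: minus_eq_smult subset_iff)
qed

lemma submoduleD:
  assumes "submodule H R M"
  shows "x \<in> H \<Longrightarrow> x \<in> carrier M" "\<zero>\<^bsub>M\<^esub> \<in> H"
    "x \<in> H \<Longrightarrow> y \<in> H \<Longrightarrow> x \<oplus>\<^bsub>M\<^esub> y \<in> H" "r \<in> carrier R \<Longrightarrow> x \<in> H \<Longrightarrow> r \<odot>\<^bsub>M\<^esub> x \<in> H"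
    "x \<in> H \<Longrightarrow> \<ominus>\<^bsub>M\<^esub> x \<in> H" "x \<in> H \<Longrightarrow> y \<in> H \<Longrightarrow> x \<ominus>\<^bsub>M\<^esub> y \<in> H"
  using assms submoduleE(3)[OF assms] unfolding submodule_iff by (auto simp: a_minus_def)

lemma submodule_add_cancel:
  assumes "submodule H R M" "x \<in> carrier M" "y \<in> H" "x \<oplus>\<^bsub>M\<^esub> y \<in> H"
  shows "x \<in> H"
proof -
  have "y \<in> carrier M" using assms submoduleD by blast
  then have "x = (x \<oplus>\<^bsub>M\<^esub> y) \<ominus>\<^bsub>M\<^esub> y" using assms(2) by (simp add: a_minus_def M.a_assoc M.r_neg)
  then show ?thesis using submoduleD(6)[OF assms(1,4,3)] by simp
qed

lemma submodule_zero: "submodule {\<zero>\<^bsub>M\<^esub>} R M"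
  by (simp add: submodule_iff)

lemma submodule_Int: "submodule H R M \<Longrightarrow> submodule K R M \<Longrightarrow> submodule (H \<inter> K) R M"
  by (auto simp: submodule_iff)

lemma submodule_restrict_iff:
  assumes "submodule K R M"
  shows "submodule H R (M\<lparr>carrier := K\<rparr>) \<longleftrightarrow> submodule H R M \<and> H \<subseteq> K"
proof -
  interpret K: module R "M\<lparr>carrier := K\<rparr>"
    using submodule.submodule_is_module[OF assms module_axioms] .
  show ?thesis unfolding K.submodule_iff submodule_iff using submoduleD(1)[OF assms] by auto
qed

lemma mem_set_add: "v \<in> H <+>\<^bsub>M\<^esub> K \<longleftrightarrow> (\<exists>h\<in>H. \<exists>k\<in>K. v = h \<oplus>\<^bsub>M\<^esub> k)"
  by (auto simp: set_add_def')

lemma submodule_sum: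
  assumes "submodule H R M" "submodule K R M"
  shows "submodule (H <+>\<^bsub>M\<^esub> K) R M"
proof -
  note H = submoduleD[OF assms(1)] and K = submoduleD[OF assms(2)]
  show ?thesis unfolding submodule_iff
  proof (intro conjI ballI)
    show "H <+>\<^bsub>M\<^esub> K \<subseteq> carrier M" using H(1) K(1) by (auto simp: mem_set_add)
    show "\<zero>\<^bsub>M\<^esub> \<in> H <+>\<^bsub>M\<^esub> K" using set_add_memI[where M = M, OF H(2) K(2)] by simp
  next
    fix x y assume "x \<in> H <+>\<^bsub>M\<^esub> K" "y \<in> H <+>\<^bsub>M\<^esub> K"
    then obtain h k h' k' where *: "h \<in> H" "k \<in> K" "x = h \<oplus>\<^bsub>M\<^esub> k" "h' \<in> H" "k' \<in> K" "y = h' \<oplus>\<^bsub>M\<^esub> k'"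
      by (auto simp: mem_set_add)
    then have "x \<oplus>\<^bsub>M\<^esub> y = (h \<oplus>\<^bsub>M\<^esub> h') \<oplus>\<^bsub>M\<^esub> (k \<oplus>\<^bsub>M\<^esub> k')" using H(1) K(1) by (simp add: M.a_ac)
    then show "x \<oplus>\<^bsub>M\<^esub> y \<in> H <+>\<^bsub>M\<^esub> K" using set_add_memI[where M = M, OF H(3)[OF *(1,4)] K(3)[OF *(2,5)]] by simp
  next
    fix r x assume r: "r \<in> carrier R" and "x \<in> H <+>\<^bsub>M\<^esub> K"
    then obtain h k where *: "h \<in> H" "k \<in> K" "x = h \<oplus>\<^bsub>M\<^esub> k" by (auto simp: mem_set_add)
    then have "r \<odot>\<^bsub>M\<^esub> x = r \<odot>\<^bsub>M\<^esub> h \<oplus>\<^bsub>M\<^esub> r \<odot>\<^bsub>M\<^esub> k" using r H(1) K(1) by (simp add: smult_r_distr)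
    then show "r \<odot>\<^bsub>M\<^esub> x \<in> H <+>\<^bsub>M\<^esub> K" using set_add_memI[where M = M, OF H(4)[OF r *(1)] K(4)[OF r *(2)]] by simp
  qed
qed

lemma sum_upper:
  assumes "submodule H R M" "submodule K R M"
  shows "H \<subseteq> H <+>\<^bsub>M\<^esub> K" "K \<subseteq> H <+>\<^bsub>M\<^esub> K"
proof -
  note H = submoduleD[OF assms(1)] and K = submoduleD[OF assms(2)]
  show "H \<subseteq> H <+>\<^bsub>M\<^esub> K"
  proof
    fix h assume "h \<in> H"
    then show "h \<in> H <+>\<^bsub>M\<^esub> K" using set_add_memI[where M = M, OF _ K(2), of h H] H(1) by simp
  qed
  show "K \<subseteq> H <+>\<^bsub>M\<^esub> K"
  proof
    fix k assume "k \<in> K"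
    then show "k \<in> H <+>\<^bsub>M\<^esub> K" using set_add_memI[where M = M, OF H(2), of k K] K(1) by simp
  qed
qed

lemma sum_least:
  assumes "submodule L R M" "H \<subseteq> L" "K \<subseteq> L"
  shows "H <+>\<^bsub>M\<^esub> K \<subseteq> L"
  unfolding set_add_def' using submoduleD(3)[OF assms(1)] assms(2,3) by auto

end

definition span :: "('a, 'b) ring_scheme \<Rightarrow> ('a, 'm) module \<Rightarrow> 'm set \<Rightarrow> 'm set" where
  "span R M T = \<Inter>{H. submodule H R M \<and> T \<subseteq> H}"

lemma span_minimal: "submodule H R M \<Longrightarrow> T \<subseteq> H \<Longrightarrow> span R M T \<subseteq> H"
  by (auto simp: span_def)

lemma span_superset: "T \<subseteq> span R M T"
  by (auto simp: span_def)

lemma span_mono: "T \<subseteq> T' \<Longrightarrow> span R M T \<subseteq> span R M T'"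
  by (auto simp: span_def)

lemma span_submodule:
  fixes M :: "('a, 'm) module"
  assumes "module R M" "T \<subseteq> carrier M"
  shows "submodule (span R M T) R M"
proof -
  interpret module R M by fact
  have "submodule (carrier M) R M" by (rule carrier_is_submodule)
  then have "span R M T \<subseteq> carrier M" by (rule span_minimal) (rule assms(2))
  then show ?thesis unfolding submodule_iff unfolding span_def by (auto dest: submoduleD(2-4))
qed

lemma span_insert:
  fixes M :: "('a, 'm) module"
  assumes "module R M" "g \<in> carrier M" "T \<subseteq> carrier M" "v \<in> span R M (insert g T)"
  obtains r t where "r \<in> carrier R" "t \<in> span R M T" "v = r \<odot>\<^bsub>M\<^esub> g \<oplus>\<^bsub>M\<^esub> t"
proof -
  interpret module R M by fact
  let ?Q = "{r \<odot>\<^bsub>M\<^esub> g \<oplus>\<^bsub>M\<^esub> t | r t. r \<in> carrier R \<and> t \<in> span R M T}"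
  note T = submoduleD[OF span_submodule[OF assms(1,3)]]
  have "submodule ?Q R M" unfolding submodule_iff
  proof (intro conjI ballI)
    show "\<zero>\<^bsub>M\<^esub> \<in> ?Q" using assms(2) T(2) by (force intro!: exI[of _ "\<zero>\<^bsub>R\<^esub>"] exI[of _ "\<zero>\<^bsub>M\<^esub>"])
  next
    fix x y assume "x \<in> ?Q" "y \<in> ?Q"
    then obtain r t r' t' where *: "r \<in> carrier R" "r' \<in> carrier R" "t \<in> span R M T" "t' \<in> span R M T"
      "x = r \<odot>\<^bsub>M\<^esub> g \<oplus>\<^bsub>M\<^esub> t" "y = r' \<odot>\<^bsub>M\<^esub> g \<oplus>\<^bsub>M\<^esub> t'" by auto
    then have "x \<oplus>\<^bsub>M\<^esub> y = (r \<oplus>\<^bsub>R\<^esub> r') \<odot>\<^bsub>M\<^esub> g \<oplus>\<^bsub>M\<^esub> (t \<oplus>\<^bsub>M\<^esub> t')"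
      using assms(2) T(1) by (simp add: smult_l_distr M.a_ac)
    then show "x \<oplus>\<^bsub>M\<^esub> y \<in> ?Q" using * T(3) R.a_closed by blast
  next
    fix s x assume s: "s \<in> carrier R" and "x \<in> ?Q"
    then obtain r t where *: "r \<in> carrier R" "t \<in> span R M T" "x = r \<odot>\<^bsub>M\<^esub> g \<oplus>\<^bsub>M\<^esub> t" by auto
    then have "s \<odot>\<^bsub>M\<^esub> x = (s \<otimes>\<^bsub>R\<^esub> r) \<odot>\<^bsub>M\<^esub> g \<oplus>\<^bsub>M\<^esub> s \<odot>\<^bsub>M\<^esub> t"
      using s assms(2) T(1) by (simp add: smult_r_distr smult_assoc1)
    then show "s \<odot>\<^bsub>M\<^esub> x \<in> ?Q" using * s T(4) R.m_closed by blast
  qed (use assms(2) T(1) in auto)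
  moreover have "g \<in> ?Q" using assms(2) T(2) by (force intro!: exI[of _ "\<one>\<^bsub>R\<^esub>"] exI[of _ "\<zero>\<^bsub>M\<^esub>"])
  moreover have "T \<subseteq> ?Q"
  proof
    fix t assume "t \<in> T"
    then have "t \<in> span R M T" "t \<in> carrier M" using span_superset[of T R M] assms(3) by auto
    then show "t \<in> ?Q" using assms(2) by (force intro!: exI[of _ "\<zero>\<^bsub>R\<^esub>"] exI[of _ t])
  qed
  ultimately have "span R M (insert g T) \<subseteq> ?Q" by (intro span_minimal) auto
  then show ?thesis using assms(4) that by blast
qed

lemma linear_map_zero:
  assumes "module R M" "module R N" "linear_map R M N h"
  shows "h \<zero>\<^bsub>M\<^esub> = \<zero>\<^bsub>N\<^esub>"
proof -
  interpret M: module R M by fact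
  interpret N: module R N by fact
  have "h (\<zero>\<^bsub>R\<^esub> \<odot>\<^bsub>M\<^esub> \<zero>\<^bsub>M\<^esub>) = \<zero>\<^bsub>R\<^esub> \<odot>\<^bsub>N\<^esub> h \<zero>\<^bsub>M\<^esub>"
    by (rule linear_mapD(3)[OF assms(3)]) auto
  then show ?thesis using linear_mapD(1)[OF assms(3)] by simp
qed

lemma linear_map_minus:
  assumes "module R M" "module R N" "linear_map R M N h" "x \<in> carrier M" "y \<in> carrier M"
  shows "h (\<ominus>\<^bsub>M\<^esub> x) = \<ominus>\<^bsub>N\<^esub> h x" "h (x \<ominus>\<^bsub>M\<^esub> y) = h x \<ominus>\<^bsub>N\<^esub> h y"
proof -
  interpret M: module R M by fact
  interpret N: module R N by fact
  note h = linear_mapD[OF assms(3)]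
  have *: "h (\<ominus>\<^bsub>M\<^esub> x) = \<ominus>\<^bsub>N\<^esub> h x" if "x \<in> carrier M" for x
    using that h(1,3) by (simp add: M.minus_eq_smult N.minus_eq_smult)
  show "h (\<ominus>\<^bsub>M\<^esub> x) = \<ominus>\<^bsub>N\<^esub> h x" "h (x \<ominus>\<^bsub>M\<^esub> y) = h x \<ominus>\<^bsub>N\<^esub> h y"
    using * assms(4,5) h(1,2) by (auto simp: a_minus_def)
qed

lemma linear_map_preimage:
  assumes "module R M" "module R N" "linear_map R M N h" "submodule L R N" "submodule H R M"
  shows "submodule {x \<in> H. h x \<in> L} R M"
proof -
  interpret M: module R M by fact
  interpret N: module R N by fact
  show ?thesis unfolding M.submodule_iff
    using M.submoduleD[OF assms(5)] N.submoduleD[OF assms(4)] linear_mapD[OF assms(3)] linear_map_zero[OF assms(1-3)]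
    by auto
qed

lemma linear_map_image:
  assumes "module R M" "module R N" "linear_map R M N h" "submodule H R M"
  shows "submodule (h ` H) R N"
proof -
  interpret M: module R M by fact
  interpret N: module R N by fact
  note H = M.submoduleD[OF assms(4)] and h = linear_mapD[OF assms(3)]
  have "\<zero>\<^bsub>N\<^esub> = h \<zero>\<^bsub>M\<^esub>" using linear_map_zero[OF assms(1-3)] by simp
  moreover have "h x \<oplus>\<^bsub>N\<^esub> h y = h (x \<oplus>\<^bsub>M\<^esub> y)" if "x \<in> H" "y \<in> H" for x y using that H(1) h(2) by simp
  moreover have "r \<odot>\<^bsub>N\<^esub> h x = h (r \<odot>\<^bsub>M\<^esub> x)" if "x \<in> H" "r \<in> carrier R" for x r using that H(1) h(3) by simp
  ultimately show ?thesis unfolding N.submodule_iff using H h(1) by auto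
qed

lemma linear_maps_agree_on_span:
  assumes "module R M" "module R N" "linear_map R M N h" "linear_map R M N k"
    "T \<subseteq> carrier M" "\<And>t. t \<in> T \<Longrightarrow> h t = k t" "v \<in> span R M T"
  shows "h v = k v"
proof -
  interpret M: module R M by fact
  interpret N: module R N by fact
  have "submodule {x \<in> carrier M. h x = k x} R M" unfolding M.submodule_iff
    using linear_mapD[OF assms(3)] linear_mapD[OF assms(4)] linear_map_zero[OF assms(1-3)] linear_map_zero[OF assms(1,2,4)]
    by auto
  then have "span R M T \<subseteq> {x \<in> carrier M. h x = k x}" using assms(5,6) by (intro span_minimal) auto
  then show ?thesis using assms(7) by auto
qed

lemma linear_map_span_into:
  assumes "module R M" "module R N" "linear_map R M N h" "submodule L R N" "T \<subseteq> carrier M"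
    "\<And>t. t \<in> T \<Longrightarrow> h t \<in> L" "v \<in> span R M T"
  shows "h v \<in> L"
proof -
  interpret M: module R M by fact
  have "span R M T \<subseteq> {x \<in> carrier M. h x \<in> L}"
    using assms(5,6) by (intro span_minimal linear_map_preimage[OF assms(1-4) M.carrier_is_submodule]) auto
  then show ?thesis using assms(7) by auto
qed

section \<open>Free modules\<close>

definition basis_vec :: "('a, 'b) ring_scheme \<Rightarrow> 'x \<Rightarrow> 'x \<Rightarrow> 'a" where
  "basis_vec R a = (\<lambda>x. if x = a then \<one>\<^bsub>R\<^esub> else \<zero>\<^bsub>R\<^esub>)"

definition lin_ext :: "('a, 'b) ring_scheme \<Rightarrow> ('a, 'm) module \<Rightarrow> ('x \<Rightarrow> 'm) \<Rightarrow> ('x \<Rightarrow> 'a) \<Rightarrow> 'm" where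
  "lin_ext R M s g = (\<Oplus>\<^bsub>M\<^esub>x\<in>{x. g x \<noteq> \<zero>\<^bsub>R\<^esub>}. g x \<odot>\<^bsub>M\<^esub> s x)"

lemma lincomb_eq_lin_ext: "lincomb R M = lin_ext R M (\<lambda>x. x)"
  by (auto simp: lincomb_def lin_ext_def fun_eq_iff)

lemma free_on_simps [simp]:
  "(g \<oplus>\<^bsub>free_on R A\<^esub> h) = (\<lambda>x. g x \<oplus>\<^bsub>R\<^esub> h x)" "\<zero>\<^bsub>free_on R A\<^esub> = (\<lambda>x. \<zero>\<^bsub>R\<^esub>)"
  "(r \<odot>\<^bsub>free_on R A\<^esub> g) = (\<lambda>x. r \<otimes>\<^bsub>R\<^esub> g x)"
  by (auto simp: free_on_def)

lemma free_on_carrier: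
  "g \<in> carrier (free_on R A) \<longleftrightarrow>
     (\<forall>x. g x \<in> carrier R) \<and> (\<forall>x. x \<notin> A \<longrightarrow> g x = \<zero>\<^bsub>R\<^esub>) \<and> finite {x. g x \<noteq> \<zero>\<^bsub>R\<^esub>}"
  by (auto simp: free_on_def)

lemma free_onD:
  assumes "g \<in> carrier (free_on R A)"
  shows "g x \<in> carrier R" "x \<notin> A \<Longrightarrow> g x = \<zero>\<^bsub>R\<^esub>" "finite {x. g x \<noteq> \<zero>\<^bsub>R\<^esub>}"
  using assms by (auto simp: free_on_carrier)

lemma free_on_finiteI:
  assumes "finite A" "\<And>x. g x \<in> carrier R" "\<And>x. x \<notin> A \<Longrightarrow> g x = \<zero>\<^bsub>R\<^esub>"
  shows "g \<in> carrier (free_on R A)"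
  using assms unfolding free_on_carrier by (auto intro: finite_subset[OF _ assms(1)])

lemma free_on_mono: "A \<subseteq> B \<Longrightarrow> carrier (free_on R A) \<subseteq> carrier (free_on R B)"
  by (simp add: free_on_carrier subset_iff) blast

lemma lin_ext_superset:
  fixes M :: "('a,'m) module" and R (structure)
  assumes M: "module R M" and "s \<in> A \<rightarrow> carrier M" "g \<in> carrier (free_on R A)" "finite T" "{x. g x \<noteq> \<zero>} \<subseteq> T" "T \<subseteq> A"
  shows "lin_ext R M s g = (\<Oplus>\<^bsub>M\<^esub>x\<in>T. g x \<odot>\<^bsub>M\<^esub> s x)"
proof -
  interpret module R M by fact
  have z: "g i \<odot>\<^bsub>M\<^esub> s i = \<zero>\<^bsub>M\<^esub>" if "i \<in> T - {x. g x \<noteq> \<zero>}" for i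
    using that assms(2,6) by (auto simp: Pi_iff subset_iff)
  have c: "g x \<odot>\<^bsub>M\<^esub> s x \<in> carrier M" if "x \<in> T" for x
    using that assms(2,6) free_onD(1)[OF assms(3)] by (intro smult_closed) auto
  show ?thesis unfolding lin_ext_def
    by (rule M.add.finprod_mono_neutral_cong_left) (use assms z c in auto)
qed

lemma linear_lin_ext:
  fixes M :: "('a,'m) module" and R (structure)
  assumes M: "module R M" and s: "s \<in> A \<rightarrow> carrier M"
  shows "linear_map R (free_on R A) M (lin_ext R M s)"
proof -
  interpret module R M by fact
  interpret F: module R "free_on R A" by (rule free_on_module) (rule R.is_cring)
  show ?thesis unfolding linear_map_def
  proof (intro conjI ballI)
    show "lin_ext R M s \<in> carrier (free_on R A) \<rightarrow> carrier M"
    proof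
      fix g assume "g \<in> carrier (free_on R A)"
      then show "lin_ext R M s g \<in> carrier M" unfolding lin_ext_def
        by (intro M.finsum_closed) (use s in \<open>auto simp: free_on_def\<close>)
    qed
  next
    fix g h assume g: "g \<in> carrier (free_on R A)" and h: "h \<in> carrier (free_on R A)"
    let ?T = "{x. g x \<noteq> \<zero>} \<union> {x. h x \<noteq> \<zero>}"
    have T: "finite ?T" "?T \<subseteq> A" using g h by (auto simp: free_on_def)
    have c: "g x \<in> carrier R" "h x \<in> carrier R" for x using g h by (auto simp: free_on_def)
    have sA: "s x \<in> carrier M" if "x \<in> ?T" for x using that T(2) s by blast
    have gh: "g \<oplus>\<^bsub>free_on R A\<^esub> h \<in> carrier (free_on R A)" using g h by (rule F.a_closed)
    have sub: "{x. (g \<oplus>\<^bsub>free_on R A\<^esub> h) x \<noteq> \<zero>} \<subseteq> ?T" by auto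
    have "lin_ext R M s (g \<oplus>\<^bsub>free_on R A\<^esub> h) = (\<Oplus>\<^bsub>M\<^esub>x\<in>?T. (g \<oplus>\<^bsub>free_on R A\<^esub> h) x \<odot>\<^bsub>M\<^esub> s x)"
      by (rule lin_ext_superset[OF M s gh T(1) sub T(2)])
    also have "\<dots> = (\<Oplus>\<^bsub>M\<^esub>x\<in>?T. g x \<odot>\<^bsub>M\<^esub> s x \<oplus>\<^bsub>M\<^esub> h x \<odot>\<^bsub>M\<^esub> s x)"
      by (rule M.finsum_cong') (use T c sA in \<open>auto intro!: smult_l_distr M.a_closed smult_closed\<close>)
    also have "\<dots> = (\<Oplus>\<^bsub>M\<^esub>x\<in>?T. g x \<odot>\<^bsub>M\<^esub> s x) \<oplus>\<^bsub>M\<^esub> (\<Oplus>\<^bsub>M\<^esub>x\<in>?T. h x \<odot>\<^bsub>M\<^esub> s x)"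
      by (rule M.finsum_addf) (use T c sA in auto)
    also have "\<dots> = lin_ext R M s g \<oplus>\<^bsub>M\<^esub> lin_ext R M s h"
      using T g h by (subst (1 2) lin_ext_superset[OF M s]) auto
    finally show "lin_ext R M s (g \<oplus>\<^bsub>free_on R A\<^esub> h) = lin_ext R M s g \<oplus>\<^bsub>M\<^esub> lin_ext R M s h" .
  next
    fix r g assume r: "r \<in> carrier R" and g: "g \<in> carrier (free_on R A)"
    let ?T = "{x. g x \<noteq> \<zero>}"
    have T: "finite ?T" "?T \<subseteq> A" using g by (auto simp: free_on_def)
    have c: "g x \<in> carrier R" for x using g by (auto simp: free_on_def)
    have rg: "r \<odot>\<^bsub>free_on R A\<^esub> g \<in> carrier (free_on R A)" using r g by (rule F.smult_closed)
    have sub: "{x. (r \<odot>\<^bsub>free_on R A\<^esub> g) x \<noteq> \<zero>} \<subseteq> ?T" using r by auto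
    have "lin_ext R M s (r \<odot>\<^bsub>free_on R A\<^esub> g) = (\<Oplus>\<^bsub>M\<^esub>x\<in>?T. (r \<odot>\<^bsub>free_on R A\<^esub> g) x \<odot>\<^bsub>M\<^esub> s x)"
      by (rule lin_ext_superset[OF M s rg T(1) sub T(2)])
    also have "\<dots> = (\<Oplus>\<^bsub>M\<^esub>x\<in>?T. r \<odot>\<^bsub>M\<^esub> (g x \<odot>\<^bsub>M\<^esub> s x))"
      by (rule M.finsum_cong') (use T c r s in \<open>auto intro!: smult_assoc1 smult_closed\<close>)
    also have "\<dots> = r \<odot>\<^bsub>M\<^esub> (\<Oplus>\<^bsub>M\<^esub>x\<in>?T. g x \<odot>\<^bsub>M\<^esub> s x)"
      by (rule finsum_smult_ldistr[symmetric]) (use T c r s in auto)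
    finally show "lin_ext R M s (r \<odot>\<^bsub>free_on R A\<^esub> g) = r \<odot>\<^bsub>M\<^esub> lin_ext R M s g" by (simp add: lin_ext_def)
  qed
qed

lemma linear_lincomb:
  assumes "module R M" "A \<subseteq> carrier M"
  shows "linear_map R (free_on R A) M (lincomb R M)"
  unfolding lincomb_eq_lin_ext using assms by (intro linear_lin_ext) auto

lemma basis_vec_closed:
  assumes "cring R" "a \<in> A"
  shows "basis_vec R a \<in> carrier (free_on R A)"
proof -
  interpret cring R by fact
  have "{x. x = a \<and> P} \<subseteq> {a}" for P by auto
  then show ?thesis using assms(2) unfolding free_on_carrier basis_vec_def by (auto intro: finite_subset)
qed

lemma lin_ext_basis_vec:
  assumes "module R M" "s a \<in> carrier M"
  shows "lin_ext R M s (basis_vec R a) = s a"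
proof -
  interpret module R M by fact
  have "lin_ext R M s (basis_vec R a) = (\<Oplus>\<^bsub>M\<^esub>x\<in>{a}. basis_vec R a x \<odot>\<^bsub>M\<^esub> s x)"
    by (rule lin_ext_superset[OF assms(1), of s "{a}"])
      (use assms(2) basis_vec_closed[OF R.is_cring, of a "{a}"] in \<open>auto simp: basis_vec_def\<close>)
  then show ?thesis using assms(2) by (simp add: basis_vec_def)
qed

lemma lincomb_basis_vec:
  assumes "module R M" "a \<in> carrier M"
  shows "lincomb R M (basis_vec R a) = a"
  unfolding lincomb_eq_lin_ext using lin_ext_basis_vec[OF assms(1), of "\<lambda>x. x" a] assms(2) by simp

lemma span_basis_vec:
  assumes "cring R"
  shows "span R (free_on R A) (basis_vec R ` A) = carrier (free_on R A)"
proof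
  interpret cring R by fact
  interpret F: module R "free_on R A" by (rule free_on_module) fact
  have b: "basis_vec R ` A \<subseteq> carrier (free_on R A)" using basis_vec_closed[OF assms] by auto
  show "span R (free_on R A) (basis_vec R ` A) \<subseteq> carrier (free_on R A)"
    by (rule span_minimal[OF F.carrier_is_submodule b])
  note S = F.submoduleD[OF span_submodule[OF F.module_axioms b]]
  show "carrier (free_on R A) \<subseteq> span R (free_on R A) (basis_vec R ` A)"
  proof
    fix g assume "g \<in> carrier (free_on R A)"
    then have "finite {x. g x \<noteq> \<zero>\<^bsub>R\<^esub>}" by (rule free_onD)
    then show "g \<in> span R (free_on R A) (basis_vec R ` A)" using \<open>g \<in> carrier (free_on R A)\<close>
    proof (induction "{x. g x \<noteq> \<zero>\<^bsub>R\<^esub>}" arbitrary: g rule: finite_induct)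
      case empty
      then have "g = (\<lambda>x. \<zero>\<^bsub>R\<^esub>)" by auto
      then show ?case using S(2) by simp
    next
      case (insert a T)
      note g = free_onD[OF insert.prems]
      let ?h = "g(a := \<zero>\<^bsub>R\<^esub>)"
      have T: "T = {x. ?h x \<noteq> \<zero>\<^bsub>R\<^esub>}" using insert.hyps(2,4) by auto
      have h: "?h \<in> carrier (free_on R A)" using g insert.hyps(1) T by (auto simp: free_on_carrier)
      have a: "a \<in> A" using g(2) insert.hyps(4) by blast
      have "?h \<in> span R (free_on R A) (basis_vec R ` A)" by (rule insert.hyps(3)[OF T h])
      moreover have "g a \<odot>\<^bsub>free_on R A\<^esub> basis_vec R a \<in> span R (free_on R A) (basis_vec R ` A)"
        using a g(1) span_superset[of "basis_vec R ` A" R "free_on R A"] by (intro S(4)) auto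
      ultimately have "?h \<oplus>\<^bsub>free_on R A\<^esub> (g a \<odot>\<^bsub>free_on R A\<^esub> basis_vec R a)
          \<in> span R (free_on R A) (basis_vec R ` A)" by (rule S(3))
      moreover have "?h \<oplus>\<^bsub>free_on R A\<^esub> (g a \<odot>\<^bsub>free_on R A\<^esub> basis_vec R a) = g"
        using g(1) by (auto simp: basis_vec_def fun_eq_iff)
      ultimately show ?case by simp
    qed
  qed
qed

lemma free_linear_map_eq:
  assumes "cring R" "module R N" "linear_map R (free_on R A) N h" "linear_map R (free_on R A) N k"
    "\<And>a. a \<in> A \<Longrightarrow> h (basis_vec R a) = k (basis_vec R a)" "v \<in> carrier (free_on R A)"
  shows "h v = k v"
  by (rule linear_maps_agree_on_span[OF free_on_module[OF assms(1)] assms(2-4), where T = "basis_vec R ` A"])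
    (use assms basis_vec_closed[OF assms(1)] span_basis_vec[OF assms(1), of A] in auto)

lemma free_linear_map_into:
  assumes "cring R" "module R N" "linear_map R (free_on R A) N h" "submodule L R N"
    "\<And>a. a \<in> A \<Longrightarrow> h (basis_vec R a) \<in> L" "v \<in> carrier (free_on R A)"
  shows "h v \<in> L"
  by (rule linear_map_span_into[OF free_on_module[OF assms(1)] assms(2-4), where T = "basis_vec R ` A"])
    (use assms basis_vec_closed[OF assms(1)] span_basis_vec[OF assms(1), of A] in auto)

lemma lincomb_image:
  fixes M :: "('a, 'm) module"
  assumes "module R M" "B \<subseteq> carrier M"
  shows "lincomb R M ` carrier (free_on R B) = span R M B"
proof
  interpret module R M by fact
  have F: "module R (free_on R B)" by (rule free_on_module) (rule R.is_cring)
  interpret F: module R "free_on R B" by fact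
  note lin = linear_lincomb[OF assms]
  show "lincomb R M ` carrier (free_on R B) \<subseteq> span R M B"
  proof
    fix v assume "v \<in> lincomb R M ` carrier (free_on R B)"
    then obtain g where g: "g \<in> carrier (free_on R B)" "v = lincomb R M g" by auto
    show "v \<in> span R M B" unfolding g(2)
      by (rule free_linear_map_into[OF R.is_cring assms(1) lin span_submodule[OF assms] _ g(1)])
        (use assms lincomb_basis_vec[OF assms(1)] span_superset[of B R M] in \<open>simp add: subset_iff\<close>)
  qed
  show "span R M B \<subseteq> lincomb R M ` carrier (free_on R B)"
  proof (rule span_minimal)
    show "submodule (lincomb R M ` carrier (free_on R B)) R M"
      by (rule linear_map_image[OF F assms(1) lin F.carrier_is_submodule])
    show "B \<subseteq> lincomb R M ` carrier (free_on R B)"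
    proof
      fix b assume "b \<in> B"
      then show "b \<in> lincomb R M ` carrier (free_on R B)"
        using assms lincomb_basis_vec[OF assms(1), of b] basis_vec_closed[OF R.is_cring, of b B]
        by (metis image_eqI subsetD)
    qed
  qed
qed

section \<open>Nakayama's lemma and Noetherian modules\<close>

definition ideal_smult ::
    "('a, 'b) ring_scheme \<Rightarrow> ('a, 'm) module \<Rightarrow> 'a set \<Rightarrow> 'm set \<Rightarrow> 'm set" where
  "ideal_smult R M I K = span R M {r \<odot>\<^bsub>M\<^esub> k | r k. r \<in> I \<and> k \<in> K}"

lemma ideal_smult_submodule:
  assumes "module R M" "I \<subseteq> carrier R" "K \<subseteq> carrier M"
  shows "submodule (ideal_smult R M I K) R M"
proof -
  interpret module R M by fact
  show ?thesis unfolding ideal_smult_def using assms(2,3) by (intro span_submodule assms(1)) auto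
qed

lemma ideal_smultI: "r \<in> I \<Longrightarrow> k \<in> K \<Longrightarrow> r \<odot>\<^bsub>M\<^esub> k \<in> ideal_smult R M I K"
  unfolding ideal_smult_def by (rule subsetD[OF span_superset]) auto

lemma ideal_smult_span_insert:
  fixes M :: "('a, 'm) module"
  assumes M: "module R M" and I: "ideal I R" and g: "g \<in> carrier M" and T: "T \<subseteq> carrier M"
    and v: "v \<in> ideal_smult R M I (span R M (insert g T))"
  obtains r w where "r \<in> I" "w \<in> ideal_smult R M I (span R M T)" "v = r \<odot>\<^bsub>M\<^esub> g \<oplus>\<^bsub>M\<^esub> w"
proof -
  interpret module R M by fact
  interpret I: ideal I R by fact
  let ?W = "ideal_smult R M I (span R M T)"
  let ?Q = "{r \<odot>\<^bsub>M\<^esub> g \<oplus>\<^bsub>M\<^esub> w | r w. r \<in> I \<and> w \<in> ?W}"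
  have IR: "I \<subseteq> carrier R" by (rule I.a_subset)
  note sT = submoduleD[OF span_submodule[OF M T]]
  have "submodule ?W R M" using IR sT(1) by (intro ideal_smult_submodule M) auto
  note W = submoduleD[OF this]
  have QI: "r \<odot>\<^bsub>M\<^esub> g \<oplus>\<^bsub>M\<^esub> w \<in> ?Q" if "r \<in> I" "w \<in> ?W" for r w using that by blast
  have Q: "submodule ?Q R M" unfolding submodule_iff
  proof (intro conjI ballI)
    show "?Q \<subseteq> carrier M" using IR g W(1) by auto
    show "\<zero>\<^bsub>M\<^esub> \<in> ?Q" using QI[OF I.zero_closed W(2)] g by simp
  next
    fix x y assume "x \<in> ?Q" "y \<in> ?Q"
    then obtain r t r' t' where *: "r \<in> I" "r' \<in> I" "t \<in> ?W" "t' \<in> ?W"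
      "x = r \<odot>\<^bsub>M\<^esub> g \<oplus>\<^bsub>M\<^esub> t" "y = r' \<odot>\<^bsub>M\<^esub> g \<oplus>\<^bsub>M\<^esub> t'" by auto
    then have "x \<oplus>\<^bsub>M\<^esub> y = (r \<oplus>\<^bsub>R\<^esub> r') \<odot>\<^bsub>M\<^esub> g \<oplus>\<^bsub>M\<^esub> (t \<oplus>\<^bsub>M\<^esub> t')"
      using g W(1) IR by (simp add: smult_l_distr M.a_ac subset_iff)
    then show "x \<oplus>\<^bsub>M\<^esub> y \<in> ?Q" using QI[OF I.a_closed[OF *(1,2)] W(3)[OF *(3,4)]] by simp
  next
    fix s x assume s: "s \<in> carrier R" and "x \<in> ?Q"
    then obtain r t where *: "r \<in> I" "t \<in> ?W" "x = r \<odot>\<^bsub>M\<^esub> g \<oplus>\<^bsub>M\<^esub> t" by auto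
    then have "s \<odot>\<^bsub>M\<^esub> x = (s \<otimes>\<^bsub>R\<^esub> r) \<odot>\<^bsub>M\<^esub> g \<oplus>\<^bsub>M\<^esub> s \<odot>\<^bsub>M\<^esub> t"
      using s g W(1) IR by (simp add: smult_r_distr smult_assoc1 subset_iff)
    then show "s \<odot>\<^bsub>M\<^esub> x \<in> ?Q" using QI[OF I.I_l_closed[OF *(1) s] W(4)[OF s *(2)]] by simp
  qed
  have "ideal_smult R M I (span R M (insert g T)) \<subseteq> ?Q" unfolding ideal_smult_def
  proof (rule span_minimal, fold ideal_smult_def)
    show "submodule ?Q R M" by fact
    show "{r \<odot>\<^bsub>M\<^esub> k |r k. r \<in> I \<and> k \<in> span R M (insert g T)} \<subseteq> ?Q"
    proof
      fix v assume "v \<in> {r \<odot>\<^bsub>M\<^esub> k |r k. r \<in> I \<and> k \<in> span R M (insert g T)}"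
      then obtain r k where r: "r \<in> I" and k: "k \<in> span R M (insert g T)" and v: "v = r \<odot>\<^bsub>M\<^esub> k" by auto
      obtain s t where st: "s \<in> carrier R" "t \<in> span R M T" "k = s \<odot>\<^bsub>M\<^esub> g \<oplus>\<^bsub>M\<^esub> t"
        by (rule span_insert[OF M g T k])
      have "v = (r \<otimes>\<^bsub>R\<^esub> s) \<odot>\<^bsub>M\<^esub> g \<oplus>\<^bsub>M\<^esub> r \<odot>\<^bsub>M\<^esub> t"
        using st v r IR g sT(1) by (simp add: smult_r_distr smult_assoc1 subset_iff)
      then show "v \<in> ?Q" using QI[OF I.I_r_closed[OF r st(1)] ideal_smultI[OF r st(2)]] by simp
    qed
  qed
  then show ?thesis using v that by blast
qed

text \<open>Induction on the generators. The hypothesis for \<open>g\<close> rewrites \<open>(1 - r) g\<close>, for some \<open>r\<close> in \<open>I\<close>,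
  as an element of \<open>L + I T\<close>. As \<open>1 - r\<close> is a unit, \<open>g\<close> itself lies there, so that it can be
  eliminated from the hypotheses for the remaining generators.\<close>

lemma nakayama:
  fixes M :: "('a, 'm) module"
  assumes M: "module R M" and I: "ideal I R" and U: "\<And>r. r \<in> I \<Longrightarrow> \<one>\<^bsub>R\<^esub> \<ominus>\<^bsub>R\<^esub> r \<in> Units R"
    and L: "submodule L R M" and "finite T" "T \<subseteq> carrier M"
    and "T \<subseteq> L <+>\<^bsub>M\<^esub> ideal_smult R M I (span R M T)"
  shows "T \<subseteq> L"
  using assms(5-7)
proof (induction T)
  case (insert g T)
  interpret module R M by fact
  interpret I: ideal I R by fact
  have IR: "I \<subseteq> carrier R" by (rule I.a_subset)
  have g: "g \<in> carrier M" and T: "T \<subseteq> carrier M" using insert.prems by auto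
  note L' = submoduleD[OF L]
  let ?W = "ideal_smult R M I (span R M T)"
  have W: "submodule ?W R M"
    using IR submoduleD(1)[OF span_submodule[OF M T]] by (intro ideal_smult_submodule M) auto
  note W' = submoduleD[OF W]
  note LW = submoduleD[OF submodule_sum[OF L W]]
  have *: "\<exists>r\<in>I. \<exists>u\<in>L <+>\<^bsub>M\<^esub> ?W. v = r \<odot>\<^bsub>M\<^esub> g \<oplus>\<^bsub>M\<^esub> u" if "v \<in> insert g T" for v
  proof -
    have "v \<in> L <+>\<^bsub>M\<^esub> ideal_smult R M I (span R M (insert g T))" using insert.prems(2) that by auto
    then obtain l w where l: "l \<in> L" and w: "w \<in> ideal_smult R M I (span R M (insert g T))"
      and v: "v = l \<oplus>\<^bsub>M\<^esub> w" unfolding mem_set_add by auto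
    obtain r w' where r: "r \<in> I" "w' \<in> ?W" "w = r \<odot>\<^bsub>M\<^esub> g \<oplus>\<^bsub>M\<^esub> w'"
      by (rule ideal_smult_span_insert[OF M I g T w])
    have "v = r \<odot>\<^bsub>M\<^esub> g \<oplus>\<^bsub>M\<^esub> (l \<oplus>\<^bsub>M\<^esub> w')"
      using v r l g IR L'(1) W'(1) by (simp add: M.a_ac subset_iff)
    then show ?thesis using r set_add_memI[where M = M, OF l r(2)] by blast
  qed
  obtain r u where r: "r \<in> I" and u: "u \<in> L <+>\<^bsub>M\<^esub> ?W" and gr: "g = r \<odot>\<^bsub>M\<^esub> g \<oplus>\<^bsub>M\<^esub> u"
    using *[of g] by auto
  have rR: "r \<in> carrier R" using r IR by auto
  have uM: "u \<in> carrier M" by (rule LW(1)[OF u])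
  have unit: "\<one>\<^bsub>R\<^esub> \<ominus>\<^bsub>R\<^esub> r \<in> Units R" by (rule U[OF r])
  have "(\<one>\<^bsub>R\<^esub> \<ominus>\<^bsub>R\<^esub> r) \<odot>\<^bsub>M\<^esub> g = g \<ominus>\<^bsub>M\<^esub> r \<odot>\<^bsub>M\<^esub> g"
    using rR g by (simp add: a_minus_def smult_l_distr smult_l_minus)
  also have "\<dots> = (r \<odot>\<^bsub>M\<^esub> g \<oplus>\<^bsub>M\<^esub> u) \<ominus>\<^bsub>M\<^esub> r \<odot>\<^bsub>M\<^esub> g" using gr by simp
  also have "\<dots> = u" using rR g uM by (simp add: a_minus_def M.a_ac M.r_neg M.r_neg1 M.r_neg2)
  finally have "(\<one>\<^bsub>R\<^esub> \<ominus>\<^bsub>R\<^esub> r) \<odot>\<^bsub>M\<^esub> g = u" .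
  then have "inv\<^bsub>R\<^esub> (\<one>\<^bsub>R\<^esub> \<ominus>\<^bsub>R\<^esub> r) \<odot>\<^bsub>M\<^esub> u = (inv\<^bsub>R\<^esub> (\<one>\<^bsub>R\<^esub> \<ominus>\<^bsub>R\<^esub> r) \<otimes>\<^bsub>R\<^esub> (\<one>\<^bsub>R\<^esub> \<ominus>\<^bsub>R\<^esub> r)) \<odot>\<^bsub>M\<^esub> g"
    using smult_assoc1[of "inv\<^bsub>R\<^esub> (\<one>\<^bsub>R\<^esub> \<ominus>\<^bsub>R\<^esub> r)" "\<one>\<^bsub>R\<^esub> \<ominus>\<^bsub>R\<^esub> r" g] unit g rR by simp
  then have "g = inv\<^bsub>R\<^esub> (\<one>\<^bsub>R\<^esub> \<ominus>\<^bsub>R\<^esub> r) \<odot>\<^bsub>M\<^esub> u" using unit g by simp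
  then have gLW: "g \<in> L <+>\<^bsub>M\<^esub> ?W" using LW(4)[OF R.Units_inv_closed[OF unit] u] by simp
  have "T \<subseteq> L <+>\<^bsub>M\<^esub> ?W"
  proof
    fix t assume "t \<in> T"
    then obtain r u where "r \<in> I" "u \<in> L <+>\<^bsub>M\<^esub> ?W" "t = r \<odot>\<^bsub>M\<^esub> g \<oplus>\<^bsub>M\<^esub> u" using *[of t] by auto
    then show "t \<in> L <+>\<^bsub>M\<^esub> ?W" using LW(3)[OF LW(4)[OF _ gLW]] IR by auto
  qed
  then have TL: "T \<subseteq> L" by (rule insert.IH[OF T])
  have "?W \<subseteq> L" unfolding ideal_smult_def
    using L'(4) IR subsetD[OF span_minimal[OF L TL]] by (intro span_minimal[OF L]) auto
  then have "L <+>\<^bsub>M\<^esub> ?W \<subseteq> L" by (intro sum_least[OF L]) auto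
  then show ?case using gLW TL by auto
qed simp

lemma nakayama_span:
  fixes M :: "('a, 'm) module"
  assumes M: "module R M" and I: "ideal I R" and U: "\<And>r. r \<in> I \<Longrightarrow> \<one>\<^bsub>R\<^esub> \<ominus>\<^bsub>R\<^esub> r \<in> Units R"
    and L: "submodule L R M" and T: "finite T" "T \<subseteq> carrier M" "span R M T = K"
    and K: "\<And>v. v \<in> K \<Longrightarrow> \<exists>l\<in>L. \<exists>w\<in>ideal_smult R M I K. v = l \<oplus>\<^bsub>M\<^esub> w"
  shows "K \<subseteq> L"
proof -
  interpret module R M by fact
  have "T \<subseteq> L <+>\<^bsub>M\<^esub> ideal_smult R M I (span R M T)"
    using K span_superset[of T R M] T(3) by (auto simp: mem_set_add)
  then have "T \<subseteq> L" using U by (intro nakayama[OF M I _ L T(1,2)])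
  then show ?thesis using span_minimal[OF L] T(3) by blast
qed

text \<open>The ring as a module over itself, so that the lemmas on submodules apply to ideals.\<close>

definition ring_module :: "('a, 'b) ring_scheme \<Rightarrow> ('a, 'a) module" where
  "ring_module R = \<lparr>carrier = carrier R, monoid.mult = (\<otimes>\<^bsub>R\<^esub>), one = \<one>\<^bsub>R\<^esub>,
     zero = \<zero>\<^bsub>R\<^esub>, add = (\<oplus>\<^bsub>R\<^esub>), smult = (\<otimes>\<^bsub>R\<^esub>)\<rparr>"

lemma ring_module_simps [simp]:
  "carrier (ring_module R) = carrier R" "\<zero>\<^bsub>ring_module R\<^esub> = \<zero>\<^bsub>R\<^esub>"
  "x \<oplus>\<^bsub>ring_module R\<^esub> y = x \<oplus>\<^bsub>R\<^esub> y" "x \<odot>\<^bsub>ring_module R\<^esub> y = x \<otimes>\<^bsub>R\<^esub> y"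
  by (auto simp: ring_module_def)

lemma ring_module_module:
  assumes "cring R" shows "module R (ring_module R)"
proof -
  interpret cring R by fact
  show ?thesis
  proof (intro moduleI abelian_groupI)
    fix x assume "x \<in> carrier (ring_module R)"
    then show "\<exists>y\<in>carrier (ring_module R). y \<oplus>\<^bsub>ring_module R\<^esub> x = \<zero>\<^bsub>ring_module R\<^esub>"
      by (auto intro!: bexI[of _ "\<ominus>\<^bsub>R\<^esub> x"] simp: l_neg)
  qed (auto simp: a_ac m_assoc l_distr r_distr is_cring)
qed

lemma submodule_ring_module_iff:
  assumes "cring R" shows "submodule I R (ring_module R) \<longleftrightarrow> ideal I R"
proof -
  interpret cring R by fact
  interpret M: module R "ring_module R" by (rule ring_module_module) fact
  show ?thesis
  proof
    assume I: "submodule I R (ring_module R)"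
    note D = M.submoduleD[OF I, simplified]
    show "ideal I R"
    proof (rule idealI)
      show "subgroup I (add_monoid R)"
      proof (rule add.subgroupI)
        fix a assume a: "a \<in> I"
        then have "(\<ominus>\<^bsub>R\<^esub> \<one>\<^bsub>R\<^esub>) \<otimes>\<^bsub>R\<^esub> a \<in> I" by (intro D(4)) auto
        then show "\<ominus>\<^bsub>R\<^esub> a \<in> I" using D(1)[OF a] by (simp add: l_minus)
      qed (use D in auto)
      fix a x assume "a \<in> I" "x \<in> carrier R"
      then show "x \<otimes>\<^bsub>R\<^esub> a \<in> I" "a \<otimes>\<^bsub>R\<^esub> x \<in> I" using D(1,4) m_comm[of a x] by auto
    qed (rule ring_axioms)
  next
    assume "ideal I R"
    then interpret I: ideal I R .
    show "submodule I R (ring_module R)" unfolding M.submodule_iff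
      using I.Icarr I.zero_closed I.a_closed I.I_l_closed by auto
  qed
qed

lemma linear_map_coordinate:
  assumes "cring R" shows "linear_map R (free_on R A) (ring_module R) (\<lambda>v. v i)"
proof -
  interpret cring R by fact
  show ?thesis by (auto simp: linear_map_def free_on_carrier)
qed

lemma noetherian_ideal_span:
  assumes "cring R" "noetherian_ring R" "ideal J R"
  obtains T where "finite T" "T \<subseteq> J" "span R (ring_module R) T = J"
proof -
  interpret noetherian_ring R by fact
  interpret M: module R "ring_module R" by (rule ring_module_module) fact
  obtain A where A: "A \<subseteq> carrier R" "finite A" "J = Idl\<^bsub>R\<^esub> A" using finetely_gen[OF assms(3)] by auto
  have "submodule (span R (ring_module R) A) R (ring_module R)"
    by (rule span_submodule[OF M.module_axioms]) (use A in simp)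
  then have "ideal (span R (ring_module R) A) R" using submodule_ring_module_iff[OF assms(1)] by simp
  then have "J \<subseteq> span R (ring_module R) A" unfolding A(3) by (rule genideal_minimal) (rule span_superset)
  moreover have AJ: "A \<subseteq> J" using genideal_self[OF A(1)] A(3) by simp
  moreover have "span R (ring_module R) A \<subseteq> J"
    using submodule_ring_module_iff[OF assms(1)] assms(3) AJ by (intro span_minimal) auto
  ultimately show ?thesis using that A(2) by blast
qed

text \<open>Induction on the rank. The \<open>j\<close>-th coordinates of the elements of \<open>K\<close> form an ideal. Elements of
  \<open>K\<close> that lift finitely many generators of it clear the \<open>j\<close>-th coordinate of every element of \<open>K\<close>, and
  what is left lies in a free module of smaller rank.\<close>

lemma submodule_of_free_finitely_generated:
  fixes R :: "('a, 'b) ring_scheme" and K :: "('x \<Rightarrow> 'a) set"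
  assumes R: "cring R" "noetherian_ring R" and "finite A" "submodule K R (free_on R A)"
  shows "\<exists>T \<subseteq> K. finite T \<and> span R (free_on R A) T = K"
  using assms(3,4)
proof (induction A arbitrary: K)
  case empty
  interpret F: module R "free_on R ({} :: 'x set)" by (rule free_on_module) fact
  have "K = {\<zero>\<^bsub>free_on R {}\<^esub>}" using F.submoduleD(1,2)[OF empty] by (auto simp: free_on_carrier fun_eq_iff)
  moreover have "span R (free_on R {}) {} = {\<zero>\<^bsub>free_on R ({} :: 'x set)\<^esub>}"
  proof
    show "span R (free_on R {}) {} \<subseteq> {\<zero>\<^bsub>free_on R ({} :: 'x set)\<^esub>}"
      by (rule span_minimal[OF F.submodule_zero]) simp
    show "{\<zero>\<^bsub>free_on R ({} :: 'x set)\<^esub>} \<subseteq> span R (free_on R {}) {}"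
      using F.submoduleD(2)[OF span_submodule[OF F.module_axioms, of "{}"]] by simp
  qed
  ultimately show ?case by blast
next
  case (insert j A)
  interpret R: cring R by fact
  let ?F = "free_on R (insert j A)"
  interpret F: module R ?F by (rule free_on_module) fact
  interpret F': module R "free_on R A" by (rule free_on_module) fact
  interpret M: module R "ring_module R" by (rule ring_module_module) fact
  note K = F.submoduleD[OF insert.prems]
  have FA: "carrier (free_on R A) = {v \<in> carrier ?F. v j = \<zero>\<^bsub>R\<^esub>}"
    using insert.hyps(2) by (auto simp: free_on_carrier)
  let ?K0 = "{v \<in> K. v j = \<zero>\<^bsub>R\<^esub>}"
  have K0: "submodule ?K0 R (free_on R A)"
    unfolding F'.submodule_iff FA using K by auto
  obtain T0 where T0: "T0 \<subseteq> ?K0" "finite T0" "span R (free_on R A) T0 = ?K0"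
    using insert.IH[OF K0] by auto
  let ?J = "(\<lambda>v. v j) ` K"
  have J: "submodule ?J R (ring_module R)"
    by (rule linear_map_image[OF F.module_axioms M.module_axioms linear_map_coordinate[OF R(1)] insert.prems])
  then obtain A' where A': "finite A'" "A' \<subseteq> ?J" "span R (ring_module R) A' = ?J"
    using noetherian_ideal_span[OF R] submodule_ring_module_iff[OF R(1)] by metis
  obtain T1 where T1: "T1 \<subseteq> K" "finite T1" "A' = (\<lambda>v. v j) ` T1"
    using finite_subset_image[OF A'(1,2)] by auto
  have TF: "T0 \<union> T1 \<subseteq> carrier ?F" using T0(1) T1(1) K(1) by auto
  let ?S = "span R ?F (T0 \<union> T1)"
  have S: "submodule ?S R ?F" by (rule span_submodule[OF F.module_axioms TF])
  note S' = F.submoduleD[OF S]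
  have SK: "?S \<subseteq> K" by (rule span_minimal[OF insert.prems]) (use T0(1) T1(1) in auto)
  have "K \<subseteq> ?S"
  proof
    fix v assume v: "v \<in> K"
    have "?J \<subseteq> (\<lambda>v. v j) ` ?S" unfolding A'(3)[symmetric]
    proof (rule span_minimal)
      show "submodule ((\<lambda>v. v j) ` ?S) R (ring_module R)"
        by (rule linear_map_image[OF F.module_axioms M.module_axioms linear_map_coordinate[OF R(1)] S])
      show "A' \<subseteq> (\<lambda>v. v j) ` ?S" using span_superset[of "T0 \<union> T1" R ?F] T1(3) by auto
    qed
    then have "v j \<in> (\<lambda>v. v j) ` ?S" using v by blast
    then obtain s where s: "s \<in> ?S" "s j = v j" by auto
    let ?w = "v \<ominus>\<^bsub>?F\<^esub> s"
    have w: "?w \<in> K" using K(6)[OF v] s(1) SK by auto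
    have vs: "v \<in> carrier ?F" "s \<in> carrier ?F" using K(1) v s(1) SK by auto
    have "?w j = v j \<ominus>\<^bsub>ring_module R\<^esub> s j"
      by (rule linear_map_minus(2)[OF F.module_axioms M.module_axioms linear_map_coordinate[OF R(1)] vs])
    then have "?w j = \<zero>\<^bsub>R\<^esub>"
      using s(2) M.r_neg[of "v j"] free_onD(1)[OF vs(1), of j] by (simp add: a_minus_def)
    then have "?w \<in> span R (free_on R A) T0" using w T0(3) by auto
    also have "\<dots> \<subseteq> {v \<in> ?S. v j = \<zero>\<^bsub>R\<^esub>}"
    proof (rule span_minimal)
      show "submodule {v \<in> ?S. v j = \<zero>\<^bsub>R\<^esub>} R (free_on R A)" unfolding F'.submodule_iff FA using S' by auto
      show "T0 \<subseteq> {v \<in> ?S. v j = \<zero>\<^bsub>R\<^esub>}" using T0(1) span_superset[of "T0 \<union> T1" R ?F] by auto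
    qed
    finally have wS: "?w \<in> ?S" by simp
    show "v \<in> ?S" using S'(3)[OF wS s(1)] by (simp only: F.minus_add_cancel[OF vs])
  qed
  then have "?S = K" using SK by auto
  then show ?case using T0 T1 by (intro exI[of _ "T0 \<union> T1"]) auto
qed

section \<open>Length\<close>

text \<open>A chain leaves out the bottom \<open>Y\<close>. Hence the length of the quotient of \<open>X\<close> by \<open>Y\<close> is the largest
  cardinality of a chain.\<close>

definition submodule_chain ::
    "('a, 'b) ring_scheme \<Rightarrow> ('a, 'm) module \<Rightarrow> 'm set \<Rightarrow> 'm set \<Rightarrow> 'm set set \<Rightarrow> bool" where
  "submodule_chain R M Y X C \<longleftrightarrow> finite C \<and> (\<forall>L\<in>C. submodule L R M \<and> Y \<subset> L \<and> L \<subseteq> X) \<and>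
     (\<forall>L\<in>C. \<forall>L'\<in>C. L \<subseteq> L' \<or> L' \<subseteq> L)"

definition length_le ::
    "('a, 'b) ring_scheme \<Rightarrow> ('a, 'm) module \<Rightarrow> 'm set \<Rightarrow> 'm set \<Rightarrow> nat \<Rightarrow> bool" where
  "length_le R M Y X n \<longleftrightarrow> (\<forall>C. submodule_chain R M Y X C \<longrightarrow> card C \<le> n)"

definition has_length ::
    "('a, 'b) ring_scheme \<Rightarrow> ('a, 'm) module \<Rightarrow> 'm set \<Rightarrow> 'm set \<Rightarrow> nat \<Rightarrow> bool" where
  "has_length R M Y X n \<longleftrightarrow> length_le R M Y X n \<and> (\<exists>C. submodule_chain R M Y X C \<and> card C = n)"

lemma submodule_chain_empty: "submodule_chain R M Y X {}"
  by (simp add: submodule_chain_def)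

lemma length_le_imp_has_length:
  assumes "length_le R M Y X n"
  obtains m where "has_length R M Y X m" "m \<le> n"
proof -
  let ?P = "\<lambda>m. \<exists>C. submodule_chain R M Y X C \<and> card C = m"
  have "?P 0" using submodule_chain_empty by (intro exI[of _ "{}"]) auto
  moreover have b: "\<forall>m. ?P m \<longrightarrow> m \<le> n" using assms by (auto simp: length_le_def)
  ultimately have "?P (GREATEST m. ?P m)" "\<forall>m. ?P m \<longrightarrow> m \<le> (GREATEST m. ?P m)"
    using GreatestI_nat[of ?P 0 n] Greatest_le_nat[of ?P _ n] by blast+
  then have "has_length R M Y X (GREATEST m. ?P m)" unfolding has_length_def length_le_def by blast
  then show ?thesis using that b \<open>?P (GREATEST m. ?P m)\<close> by blast
qed

lemma has_length_unique: "has_length R M Y X m \<Longrightarrow> has_length R M Y X n \<Longrightarrow> m = n"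
  unfolding has_length_def length_le_def by (metis le_antisym)

lemma length_le_mono:
  assumes "length_le R M Y X n" "Y \<subseteq> Y'" "X' \<subseteq> X"
  shows "length_le R M Y' X' n"
proof -
  have "Y \<subset> L \<and> L \<subseteq> X" if "Y' \<subset> L \<and> L \<subseteq> X'" for L using that assms(2,3) by auto
  then have "submodule_chain R M Y X C" if "submodule_chain R M Y' X' C" for C
    using that unfolding submodule_chain_def by simp
  then show ?thesis using assms(1) by (auto simp: length_le_def)
qed

text \<open>The largest element of the chain is separated from the next one by \<open>f\<close> or by \<open>g\<close>. By monotonicity,
  its value under that map then differs from all others, so each element of the chain adds a new value to
  one of the two images.\<close>

lemma card_chain_le:
  assumes "finite C" "\<And>L. L \<in> C \<Longrightarrow> Y \<subset> L" "\<And>L L'. L \<in> C \<Longrightarrow> L' \<in> C \<Longrightarrow> L \<subseteq> L' \<or> L' \<subseteq> L"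
    and "\<And>L L'. L \<in> insert Y C \<Longrightarrow> L' \<in> insert Y C \<Longrightarrow> L \<subset> L' \<Longrightarrow>
      (f L :: 'x set) \<subseteq> f L' \<and> (g L :: 'y set) \<subseteq> g L' \<and> (f L \<noteq> f L' \<or> g L \<noteq> g L')"
  shows "card C \<le> card (f ` C - {f Y}) + card (g ` C - {g Y})"
  using assms
proof (induction "card C" arbitrary: C)
  case (Suc n)
  have "C \<noteq> {}" using Suc.hyps(2) by auto
  then obtain T where T: "T \<in> C" "\<forall>L\<in>C. T \<subseteq> L \<longrightarrow> L = T" using finite_has_maximal[OF Suc.prems(1)] by metis
  then have top: "L \<subseteq> T" if "L \<in> C" for L using Suc.prems(3)[OF T(1) that] that by auto
  let ?C = "C - {T}"
  have C: "card ?C = n" "finite ?C" using Suc.hyps(2) Suc.prems(1) T(1) by auto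
  have fin: "finite (insert Y ?C)" "insert Y ?C \<noteq> {}" using C by auto
  obtain S where S: "S \<in> insert Y ?C" "\<forall>L\<in>insert Y ?C. S \<subseteq> L \<longrightarrow> L = S"
    using finite_has_maximal[OF fin] by metis
  have le: "L \<subseteq> S" if "L \<in> insert Y ?C" for L
    using S that Suc.prems(2,3) by (metis DiffD1 insertE psubset_imp_subset subset_refl)
  have ST: "S \<subset> T" using S(1) top T(1) Suc.prems(2) by auto
  have IH: "card ?C \<le> card (f ` ?C - {f Y}) + card (g ` ?C - {g Y})"
  proof (rule Suc.hyps(1))
    fix L L' assume "L \<in> insert Y ?C" "L' \<in> insert Y ?C" "L \<subset> L'"
    then show "f L \<subseteq> f L' \<and> g L \<subseteq> g L' \<and> (f L \<noteq> f L' \<or> g L \<noteq> g L')"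
      by (intro Suc.prems(4)) auto
  qed (use C Suc.prems(2,3) in simp_all)
  have mono: "f L \<subseteq> f S \<and> g L \<subseteq> g S" if "L \<in> insert Y ?C" for L
    using Suc.prems(4)[of L S] le[OF that] that S(1) by (cases "L = S") auto
  have STm: "f S \<subseteq> f T" "g S \<subseteq> g T" "f S \<noteq> f T \<or> g S \<noteq> g T"
    using Suc.prems(4)[of S T] S(1) T(1) ST by auto
  have fC: "f ` C - {f Y} = (if f T = f Y then {} else {f T}) \<union> (f ` ?C - {f Y})"
    "g ` C - {g Y} = (if g T = g Y then {} else {g T}) \<union> (g ` ?C - {g Y})" using T(1) by auto
  have lef: "card (f ` ?C - {f Y}) \<le> card (f ` C - {f Y})" "card (g ` ?C - {g Y}) \<le> card (g ` C - {g Y})"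
    using Suc.prems(1) by (auto intro!: card_mono)
  from STm(3) show ?case
  proof
    assume "f S \<noteq> f T"
    then have "f T \<notin> f ` insert Y ?C" using mono STm(1) by blast
    then have "card (f ` C - {f Y}) = Suc (card (f ` ?C - {f Y}))" using fC(1) C(2) by auto
    then show ?thesis using IH lef C(1) Suc.hyps(2) by linarith
  next
    assume "g S \<noteq> g T"
    then have "g T \<notin> g ` insert Y ?C" using mono STm(2) by blast
    then have "card (g ` C - {g Y}) = Suc (card (g ` ?C - {g Y}))" using fC(2) C(2) by auto
    then show ?thesis using IH lef C(1) Suc.hyps(2) by linarith
  qed
qed simp

lemma submodule_eqI_linear_map:
  assumes V: "module R V" and W: "module R W" and h: "linear_map R V W h"
    and L: "submodule L R V" and L': "submodule L' R V" and sub: "L \<subseteq> L'"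
    and ker: "L' \<inter> {v. h v = \<zero>\<^bsub>W\<^esub>} \<subseteq> L" and im: "h ` L' \<subseteq> h ` L"
  shows "L' \<subseteq> L"
proof
  interpret V: module R V by fact
  interpret W: module R W by fact
  fix v assume v: "v \<in> L'"
  then obtain w where w: "w \<in> L" "h v = h w" using im by auto
  have c: "v \<in> carrier V" "w \<in> carrier V" using v w V.submoduleD(1) L L' by blast+
  have "h (v \<ominus>\<^bsub>V\<^esub> w) = \<zero>\<^bsub>W\<^esub>"
    using linear_map_minus(2)[OF V W h c] w(2) linear_mapD(1)[OF h c(2)] by (simp add: a_minus_def W.M.r_neg)
  then have "v \<ominus>\<^bsub>V\<^esub> w \<in> L" using ker V.submoduleD(6)[OF L' v] w(1) sub by auto
  then show "v \<in> L" using V.submoduleD(3)[OF L _ w(1)] V.minus_add_cancel[OF c] by metis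
qed

text \<open>In a chain, a submodule is determined by its image and by its intersection with the kernel.\<close>

lemma length_le_linear_map:
  assumes V: "module R V" and W: "module R W" and h: "linear_map R V W h"
    and Y: "submodule Y R V"
    and ker: "length_le R V (Y \<inter> {v. h v = \<zero>\<^bsub>W\<^esub>}) (X \<inter> {v. h v = \<zero>\<^bsub>W\<^esub>}) p"
    and im: "length_le R W (h ` Y) (h ` X) q"
  shows "length_le R V Y X (p + q)"
  unfolding length_le_def
proof (intro allI impI)
  interpret V: module R V by fact
  interpret W: module R W by fact
  fix C assume C: "submodule_chain R V Y X C"
  let ?K = "{v. h v = \<zero>\<^bsub>W\<^esub>}"
  let ?f = "\<lambda>L. L \<inter> ?K" and ?g = "\<lambda>L. h ` L"
  have sub: "submodule L R V" if "L \<in> insert Y C" for L using that C Y by (auto simp: submodule_chain_def)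
  have subK: "submodule (L \<inter> ?K) R V" if "submodule L R V" for L
    using linear_map_preimage[OF V W h W.submodule_zero that] by (simp add: Int_def)
  have "card C \<le> card (?f ` C - {?f Y}) + card (?g ` C - {?g Y})"
  proof (rule card_chain_le)
    fix L L' assume L: "L \<in> insert Y C" "L' \<in> insert Y C" "L \<subset> L'"
    have "?f L \<noteq> ?f L' \<or> ?g L \<noteq> ?g L'"
      using submodule_eqI_linear_map[OF V W h sub[OF L(1)] sub[OF L(2)]] L(3) by blast
    then show "?f L \<subseteq> ?f L' \<and> ?g L \<subseteq> ?g L' \<and> (?f L \<noteq> ?f L' \<or> ?g L \<noteq> ?g L')" using L(3) by auto
  qed (use C in \<open>auto simp: submodule_chain_def\<close>)
  moreover have "submodule_chain R V (?f Y) (?f X) (?f ` C - {?f Y})"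
    unfolding submodule_chain_def
  proof (intro conjI ballI)
    fix L assume "L \<in> ?f ` C - {?f Y}"
    then obtain L0 where L0: "L0 \<in> C" "L = ?f L0" "L \<noteq> ?f Y" by blast
    show "submodule L R V" unfolding L0 by (rule subK[OF sub]) (use L0 in auto)
    have "Y \<subseteq> L0" "L0 \<subseteq> X" using L0(1) C by (auto simp: submodule_chain_def)
    then show "?f Y \<subset> L" "L \<subseteq> ?f X" using L0(2,3) by auto
  next
    fix L L' assume "L \<in> ?f ` C - {?f Y}" "L' \<in> ?f ` C - {?f Y}"
    then obtain L0 L1 where L0: "L0 \<in> C" "L = ?f L0" "L1 \<in> C" "L' = ?f L1" by blast
    then have "L0 \<subseteq> L1 \<or> L1 \<subseteq> L0" using C by (auto simp: submodule_chain_def)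
    then show "L \<subseteq> L' \<or> L' \<subseteq> L" using L0 by auto
  qed (use C in \<open>auto simp: submodule_chain_def\<close>)
  then have "card (?f ` C - {?f Y}) \<le> p" using ker by (simp add: length_le_def)
  moreover have "submodule_chain R W (?g Y) (?g X) (?g ` C - {?g Y})"
    unfolding submodule_chain_def
  proof (intro conjI ballI)
    fix L assume "L \<in> ?g ` C - {?g Y}"
    then obtain L0 where L0: "L0 \<in> C" "L = h ` L0" "L \<noteq> h ` Y" by blast
    show "submodule L R W" unfolding L0 by (rule linear_map_image[OF V W h sub]) (use L0 in auto)
    have "Y \<subseteq> L0" "L0 \<subseteq> X" using L0(1) C by (auto simp: submodule_chain_def)
    then show "h ` Y \<subset> L" "L \<subseteq> h ` X" using L0(2,3) by auto
  next
    fix L L' assume "L \<in> ?g ` C - {?g Y}" "L' \<in> ?g ` C - {?g Y}"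
    then obtain L0 L1 where L0: "L0 \<in> C" "L = h ` L0" "L1 \<in> C" "L' = h ` L1" by blast
    then have "L0 \<subseteq> L1 \<or> L1 \<subseteq> L0" using C by (auto simp: submodule_chain_def)
    then show "L \<subseteq> L' \<or> L' \<subseteq> L" using L0 by auto
  qed (use C in \<open>auto simp: submodule_chain_def\<close>)
  then have "card (?g ` C - {?g Y}) \<le> q" using im by (simp add: length_le_def)
  ultimately show "card C \<le> p + q" by linarith
qed

text \<open>A chain \<open>C1\<close> in the kernel and a chain \<open>C2\<close> in the image can be glued: \<open>Y + L\<close> for \<open>L\<close> in \<open>C1\<close>
  lies below the preimages of the elements of \<open>C2\<close>, and neither operation identifies two submodules.\<close>

lemma has_length_linear_map:
  assumes V: "module R V" and W: "module R W" and h: "linear_map R V W h"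
    and Y: "submodule Y R V" and X: "submodule X R V" and YX: "Y \<subseteq> X"
    and n: "has_length R V Y X n"
  obtains p q where "has_length R V (Y \<inter> {v. h v = \<zero>\<^bsub>W\<^esub>}) (X \<inter> {v. h v = \<zero>\<^bsub>W\<^esub>}) p"
    "has_length R W (h ` Y) (h ` X) q" "n = p + q"
proof -
  interpret V: module R V by fact
  interpret W: module R W by fact
  let ?K = "{v. h v = \<zero>\<^bsub>W\<^esub>}"
  note Y' = V.submoduleD[OF Y] and X' = V.submoduleD[OF X]
  have subK: "submodule (L \<inter> ?K) R V" if "submodule L R V" for L
    using linear_map_preimage[OF V W h W.submodule_zero that] by (simp add: Int_def)
  have XK: "submodule (X \<inter> ?K) R V" by (rule subK[OF X])
  have glue: "card C1 + card C2 \<le> n"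
    if C1: "submodule_chain R V (Y \<inter> ?K) (X \<inter> ?K) C1" and C2: "submodule_chain R W (h ` Y) (h ` X) C2" for C1 C2
  proof -
    let ?f = "\<lambda>L. Y <+>\<^bsub>V\<^esub> L" and ?g = "\<lambda>L. {x \<in> X. h x \<in> L}"
    have s1: "submodule L R V" "Y \<inter> ?K \<subset> L" "L \<subseteq> X \<inter> ?K" if "L \<in> C1" for L
      using C1 that by (auto simp: submodule_chain_def)
    have s2: "submodule L R W" "h ` Y \<subset> L" "L \<subseteq> h ` X" if "L \<in> C2" for L
      using C2 that by (auto simp: submodule_chain_def)
    have fK: "?f L \<inter> ?K \<subseteq> L" if "L \<in> C1" for L
    proof
      fix v assume v: "v \<in> ?f L \<inter> ?K"
      then obtain y l where y: "y \<in> Y" "l \<in> L" "v = y \<oplus>\<^bsub>V\<^esub> l" by (auto simp: V.mem_set_add)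
      have c: "y \<in> carrier V" "l \<in> carrier V" using y Y'(1) V.submoduleD(1)[OF s1(1)[OF that]] by auto
      have "h l = \<zero>\<^bsub>W\<^esub>" using s1(3)[OF that] y by auto
      then have "h y = \<zero>\<^bsub>W\<^esub>" using v y linear_mapD(2)[OF h c] linear_mapD(1)[OF h c(1)] by simp
      then have "y \<in> L" using s1(2)[OF that] y by auto
      then show "v \<in> L" using y V.submoduleD(3)[OF s1(1)[OF that]] by auto
    qed
    have up: "Y \<subseteq> ?f L" "L \<subseteq> ?f L" if "L \<in> C1" for L
      using V.sum_upper[OF Y s1(1)[OF that]] by auto
    have fX: "?f L \<subseteq> X" if "L \<in> C1" for L
      using V.sum_least[OF X YX] s1(3)[OF that] by auto
    have inj1: "inj_on ?f C1"
    proof (rule inj_onI)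
      have *: "L \<subseteq> L'" if "L \<in> C1" "L' \<in> C1" "?f L = ?f L'" for L L'
        using fK[OF that(2)] up(2)[OF that(1)] s1(3)[OF that(1)] that(3) by auto
      fix L L' assume "L \<in> C1" "L' \<in> C1" "?f L = ?f L'"
      then show "L = L'" using *[of L L'] *[of L' L] by auto
    qed
    have hg: "h ` ?g L = L" if "L \<in> C2" for L using s2(3)[OF that] by auto
    have inj2: "inj_on ?g C2" by (rule inj_onI) (metis hg)
    have kerg: "X \<inter> ?K \<subseteq> ?g L" if "L \<in> C2" for L using W.submoduleD(2)[OF s2(1)[OF that]] by auto
    have Yg: "Y \<subseteq> ?g L" if "L \<in> C2" for L using YX s2(2)[OF that] by auto
    have fg: "?f L \<subseteq> ?g M" if "L \<in> C1" "M \<in> C2" for L M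
    proof (rule V.sum_least[OF _ Yg[OF that(2)]])
      show "submodule (?g M) R V" by (rule linear_map_preimage[OF V W h s2(1)[OF that(2)] X])
      show "L \<subseteq> ?g M" using s1(3)[OF that(1)] kerg[OF that(2)] by blast
    qed
    have hf: "h ` ?f L \<subseteq> h ` Y" if "L \<in> C1" for L
    proof
      fix w assume "w \<in> h ` ?f L"
      then obtain y l where y: "y \<in> Y" "l \<in> L" "w = h (y \<oplus>\<^bsub>V\<^esub> l)" by (auto simp: V.mem_set_add)
      have c: "y \<in> carrier V" "l \<in> carrier V" using y Y'(1) V.submoduleD(1)[OF s1(1)[OF that]] by auto
      have "h l = \<zero>\<^bsub>W\<^esub>" using s1(3)[OF that] y by auto
      then have "w = h y" using y(3) linear_mapD(2)[OF h c] linear_mapD(1)[OF h c(1)] by simp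
      then show "w \<in> h ` Y" using y by auto
    qed
    have neq: "?f L \<noteq> ?g M" if "L \<in> C1" "M \<in> C2" for L M
      using hf[OF that(1)] hg[OF that(2)] s2(2)[OF that(2)] by auto
    have "submodule_chain R V Y X (?f ` C1 \<union> ?g ` C2)"
      unfolding submodule_chain_def
    proof (intro conjI ballI)
      show "finite (?f ` C1 \<union> ?g ` C2)" using C1 C2 by (auto simp: submodule_chain_def)
    next
      fix L assume "L \<in> ?f ` C1 \<union> ?g ` C2"
      then consider (1) M where "M \<in> C1" "L = ?f M" | (2) M where "M \<in> C2" "L = ?g M" by blast
      then have "submodule L R V \<and> Y \<subset> L \<and> L \<subseteq> X"
      proof cases
        case 1
        have "M \<subseteq> Y \<inter> ?K" if "?f M = Y" using that up(2)[OF 1(1)] s1(3)[OF 1(1)] by auto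
        then have "?f M \<noteq> Y" using s1(2)[OF 1(1)] by auto
        then show ?thesis using 1 V.submodule_sum[OF Y s1(1)[OF 1(1)]] up(1)[OF 1(1)] fX[OF 1(1)] by auto
      next
        case 2
        have "?g M \<noteq> Y" using hg[OF 2(1)] s2(2)[OF 2(1)] by auto
        then show ?thesis using 2 linear_map_preimage[OF V W h s2(1)[OF 2(1)] X] Yg[OF 2(1)] by auto
      qed
      then show "submodule L R V" "Y \<subset> L" "L \<subseteq> X" by auto
    next
      fix L L' assume "L \<in> ?f ` C1 \<union> ?g ` C2" "L' \<in> ?f ` C1 \<union> ?g ` C2"
      then consider (1) M M' where "M \<in> C1" "L = ?f M" "M' \<in> C1" "L' = ?f M'"
        | (2) M M' where "M \<in> C2" "L = ?g M" "M' \<in> C2" "L' = ?g M'"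
        | (3) M M' where "M \<in> C1" "L = ?f M" "M' \<in> C2" "L' = ?g M'"
        | (4) M M' where "M \<in> C2" "L = ?g M" "M' \<in> C1" "L' = ?f M'" by blast
      then show "L \<subseteq> L' \<or> L' \<subseteq> L"
      proof cases
        case 1
        then have "M \<subseteq> M' \<or> M' \<subseteq> M" using C1 by (auto simp: submodule_chain_def)
        then show ?thesis using 1 set_add_mono_right by metis
      next
        case 2
        then have "M \<subseteq> M' \<or> M' \<subseteq> M" using C2 by (auto simp: submodule_chain_def)
        then show ?thesis using 2 by auto
      qed (use fg in auto)
    qed
    then have "card (?f ` C1 \<union> ?g ` C2) \<le> n" using n by (auto simp: has_length_def length_le_def)
    moreover have "?f ` C1 \<inter> ?g ` C2 = {}" using neq by auto
    moreover have "finite C1" "finite C2" using C1 C2 by (auto simp: submodule_chain_def)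
    ultimately show ?thesis using card_image[OF inj1] card_image[OF inj2] by (simp add: card_Un_disjoint)
  qed
  have "length_le R V (Y \<inter> ?K) (X \<inter> ?K) n" "length_le R W (h ` Y) (h ` X) n"
    unfolding length_le_def using glue[OF _ submodule_chain_empty] glue[OF submodule_chain_empty] by auto
  then obtain p q where p: "has_length R V (Y \<inter> ?K) (X \<inter> ?K) p" and q: "has_length R W (h ` Y) (h ` X) q"
    by (metis length_le_imp_has_length)
  have "p + q \<le> n" using p q glue unfolding has_length_def by blast
  moreover have "length_le R V Y X (p + q)"
    using p q by (intro length_le_linear_map[OF V W h Y]) (auto simp: has_length_def)
  then have "n \<le> p + q" using n by (auto simp: has_length_def length_le_def)
  ultimately show ?thesis using that p q by auto
qed

text \<open>The Herbrand quotient, written with lengths. Let \<open>a\<^sub>V\<close> and \<open>a\<^sub>Y\<close> denote the restrictions of \<open>a\<close> to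
  \<open>V\<close> and \<open>Y\<close>. Additivity along \<open>a\<close> shows that the length of \<open>V\<close> over \<open>Y\<close> is the length of
  \<open>ker a\<^sub>V\<close> over \<open>ker a\<^sub>Y\<close> plus that of \<open>ker b\<^sub>V\<close> over \<open>ker b\<^sub>Y\<close>. Additivity along \<open>b\<close> shows that it is also
  the length of \<open>ker b\<^sub>V\<close> over \<open>ker b\<^sub>Y\<close> plus that of the image of \<open>b\<^sub>V\<close> over \<open>ker a\<^sub>Y\<close>. Hence \<open>ker a\<^sub>V\<close>
  and its submodule \<open>b V\<close> have the same finite length over \<open>ker a\<^sub>Y\<close>, so they are equal.\<close>

lemma two_periodic_exactness:
  assumes V: "module R V" and a: "linear_map R V V a" and b: "linear_map R V V b"
    and Y: "submodule Y R V" and fin: "length_le R V Y (carrier V) n"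
    and a_V: "a ` carrier V = carrier V \<inter> {v. b v = \<zero>\<^bsub>V\<^esub>}"
    and a_Y: "a ` Y = Y \<inter> {v. b v = \<zero>\<^bsub>V\<^esub>}" and b_Y: "b ` Y = Y \<inter> {v. a v = \<zero>\<^bsub>V\<^esub>}"
    and b_V: "b ` carrier V \<subseteq> {v. a v = \<zero>\<^bsub>V\<^esub>}"
  shows "b ` carrier V = carrier V \<inter> {v. a v = \<zero>\<^bsub>V\<^esub>}"
proof (rule ccontr)
  interpret V: module R V by fact
  let ?A = "{v. a v = \<zero>\<^bsub>V\<^esub>}" and ?B = "{v. b v = \<zero>\<^bsub>V\<^esub>}"
  assume neq: "b ` carrier V \<noteq> carrier V \<inter> ?A"
  have YV: "Y \<subseteq> carrier V" using V.submoduleD(1)[OF Y] by auto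
  note VV = V.carrier_is_submodule
  obtain m where m: "has_length R V Y (carrier V) m" using length_le_imp_has_length[OF fin] by auto
  obtain p q where p: "has_length R V (Y \<inter> ?A) (carrier V \<inter> ?A) p"
    and q: "has_length R V (Y \<inter> ?B) (carrier V \<inter> ?B) q" and pq: "m = p + q"
    using has_length_linear_map[OF V V a Y VV YV m] a_V a_Y by metis
  obtain p' q' where p': "has_length R V (Y \<inter> ?B) (carrier V \<inter> ?B) p'"
    and q': "has_length R V (Y \<inter> ?A) (b ` carrier V) q'" and pq': "m = p' + q'"
    using has_length_linear_map[OF V V b Y VV YV m] b_Y by metis
  have "p' = q" by (rule has_length_unique[OF p' q])
  then have "q' = p" using pq pq' by simp
  then obtain C where C: "submodule_chain R V (Y \<inter> ?A) (b ` carrier V) C" "card C = p"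
    using q' by (auto simp: has_length_def)
  have bV: "b ` carrier V \<subset> carrier V \<inter> ?A" using b_V neq linear_mapD(1)[OF b] by blast
  have sA: "submodule (carrier V \<inter> ?A) R V"
    using linear_map_preimage[OF V V a V.submodule_zero VV] by (simp add: Int_def)
  have YbV: "Y \<inter> ?A \<subseteq> b ` carrier V" using b_Y YV by blast
  have CL: "submodule L R V" "Y \<inter> ?A \<subset> L" "L \<subset> carrier V \<inter> ?A" if "L \<in> C" for L
    using C(1) that bV unfolding submodule_chain_def by (simp, simp, meson subset_psubset_trans)
  have "Y \<inter> ?A \<subset> carrier V \<inter> ?A" by (rule subset_psubset_trans[OF YbV bV])
  then have "submodule_chain R V (Y \<inter> ?A) (carrier V \<inter> ?A) (insert (carrier V \<inter> ?A) C)"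
    using C(1) sA CL psubset_imp_subset[OF CL(3)] unfolding submodule_chain_def by simp
  then have "card (insert (carrier V \<inter> ?A) C) \<le> p" using p by (auto simp: has_length_def length_le_def)
  moreover have "carrier V \<inter> ?A \<notin> C" using CL(3) by blast
  ultimately show False using C by (simp add: submodule_chain_def)
qed

text \<open>In a chain, a submodule \<open>L\<close> is determined by \<open>L \<inter> Y\<close> and \<open>L + Y\<close>.\<close>

lemma length_le_trans:
  fixes M :: "('a, 'm) module"
  assumes M: "module R M" and Z: "submodule Z R M" and Y: "submodule Y R M"
    and ZY: "Z \<subseteq> Y" and YX: "Y \<subseteq> X" and X: "submodule X R M"
    and p: "length_le R M Z Y p" and q: "length_le R M Y X q"
  shows "length_le R M Z X (p + q)"
  unfolding length_le_def
proof (intro allI impI)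
  interpret module R M by fact
  fix C assume C: "submodule_chain R M Z X C"
  let ?f = "\<lambda>L. L \<inter> Y" and ?g = "\<lambda>L. L <+>\<^bsub>M\<^esub> Y"
  have C': "submodule L R M" "Z \<subset> L" "L \<subseteq> X" if "L \<in> C" for L using C that by (auto simp: submodule_chain_def)
  have fin: "finite C" using C by (auto simp: submodule_chain_def)
  have cc: "L \<subseteq> L' \<or> L' \<subseteq> L" if "L \<in> C" "L' \<in> C" for L L' using C that by (auto simp: submodule_chain_def)
  have gmono: "?g L \<subseteq> ?g L'" if "L \<subseteq> L'" for L L' using that by (rule set_add_mono_left)
  have gZ: "?g Z = Y"
    using sum_least[OF Y ZY, of Y] sum_upper(2)[OF Z Y] by auto
  have "card C \<le> card (?f ` C - {?f Z}) + card (?g ` C - {?g Z})"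
  proof (rule card_chain_le[OF fin])
    fix L L' assume L: "L \<in> insert Z C" "L' \<in> insert Z C" "L \<subset> L'"
    have s: "submodule L R M" "submodule L' R M" using L C' Z by auto
    have "L' \<subseteq> L" if f: "?f L = ?f L'" and g: "?g L = ?g L'"
    proof
      fix v assume v: "v \<in> L'"
      then have "v \<in> ?g L" using sum_upper(1)[OF s(2) Y] g by auto
      then obtain l y where ly: "l \<in> L" "y \<in> Y" "v = l \<oplus>\<^bsub>M\<^esub> y" by (auto simp: mem_set_add)
      have c: "l \<in> carrier M" "y \<in> carrier M" using ly submoduleD(1)[OF s(1)] submoduleD(1)[OF Y] by auto
      have "y \<in> L'" using submodule_add_cancel[OF s(2) c(2), of l] ly v L(3) c by (auto simp: M.a_comm)
      then have "y \<in> L" using f ly by auto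
      then show "v \<in> L" using ly submoduleD(3)[OF s(1)] by auto
    qed
    then show "?f L \<subseteq> ?f L' \<and> ?g L \<subseteq> ?g L' \<and> (?f L \<noteq> ?f L' \<or> ?g L \<noteq> ?g L')"
      using L(3) gmono[of L L'] by blast
  qed (use C' cc in auto)
  moreover have "submodule_chain R M Z Y (?f ` C - {?f Z})"
    unfolding submodule_chain_def
  proof (intro conjI ballI)
    fix L assume "L \<in> ?f ` C - {?f Z}"
    then obtain L0 where L0: "L0 \<in> C" "L = ?f L0" "L \<noteq> ?f Z" by blast
    show "submodule L R M" "Z \<subset> L" "L \<subseteq> Y" using L0 C'(1,2)[OF L0(1)] submodule_Int[OF _ Y] ZY by auto
  next
    fix L L' assume "L \<in> ?f ` C - {?f Z}" "L' \<in> ?f ` C - {?f Z}"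
    then obtain L0 L1 where L0: "L0 \<in> C" "L = ?f L0" "L1 \<in> C" "L' = ?f L1" by blast
    then show "L \<subseteq> L' \<or> L' \<subseteq> L" using cc[OF L0(1,3)] by auto
  qed (use fin in auto)
  then have "card (?f ` C - {?f Z}) \<le> p" using p by (simp add: length_le_def)
  moreover have "submodule_chain R M Y X (?g ` C - {?g Z})"
    unfolding submodule_chain_def
  proof (intro conjI ballI)
    fix L assume "L \<in> ?g ` C - {?g Z}"
    then obtain L0 where L0: "L0 \<in> C" "L = ?g L0" "L \<noteq> ?g Z" by blast
    note s = C'[OF L0(1)]
    show "submodule L R M" "L \<subseteq> X" using L0 submodule_sum[OF s(1) Y] sum_least[OF X s(3) YX] by auto
    show "Y \<subset> L" using L0 gZ sum_upper(2)[OF s(1) Y] by auto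
  next
    fix L L' assume "L \<in> ?g ` C - {?g Z}" "L' \<in> ?g ` C - {?g Z}"
    then obtain L0 L1 where L0: "L0 \<in> C" "L = ?g L0" "L1 \<in> C" "L' = ?g L1" by blast
    then show "L \<subseteq> L' \<or> L' \<subseteq> L" using cc[OF L0(1,3)] gmono by auto
  qed (use fin in auto)
  then have "card (?g ` C - {?g Z}) \<le> q" using q by (simp add: length_le_def)
  ultimately show "card C \<le> p + q" by linarith
qed

lemma length_le_refl: "length_le R M Y Y 0"
  unfolding length_le_def submodule_chain_def by auto

text \<open>An element of \<open>R g + Y\<close> outside \<open>Y\<close> has a unit as its coefficient of \<open>g\<close>, so together with \<open>Y\<close> it
  generates \<open>g\<close>.\<close>

lemma length_le_simple:
  fixes M :: "('a, 'm) module"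
  assumes M: "module R M" and I: "I \<subseteq> carrier R" and U: "\<And>r. r \<in> carrier R \<Longrightarrow> r \<in> I \<or> r \<in> Units R"
    and Y: "submodule Y R M" and g: "g \<in> carrier M" "\<And>r. r \<in> I \<Longrightarrow> r \<odot>\<^bsub>M\<^esub> g \<in> Y"
  shows "length_le R M Y (span R M (insert g Y)) 1"
  unfolding length_le_def
proof (intro allI impI)
  interpret module R M by fact
  fix C assume C: "submodule_chain R M Y (span R M (insert g Y)) C"
  have YM: "Y \<subseteq> carrier M" using submoduleD(1)[OF Y] by auto
  have "L = span R M (insert g Y)" if "L \<in> C" for L
  proof -
    have L: "submodule L R M" "Y \<subset> L" "L \<subseteq> span R M (insert g Y)" using C that by (auto simp: submodule_chain_def)
    then obtain l where l: "l \<in> L" "l \<notin> Y" "l \<in> span R M (insert g Y)" by auto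
    obtain r t where r: "r \<in> carrier R" "t \<in> span R M Y" "l = r \<odot>\<^bsub>M\<^esub> g \<oplus>\<^bsub>M\<^esub> t"
      by (rule span_insert[OF M g(1) YM l(3)])
    have t: "t \<in> Y" using r(2) span_minimal[OF Y order_refl] by auto
    have "r \<notin> I" using r(3) l(2) g(2) t submoduleD(3)[OF Y] by auto
    then have u: "r \<in> Units R" using U r(1) by auto
    have rg: "r \<odot>\<^bsub>M\<^esub> g \<in> L"
      using submodule_add_cancel[OF L(1), of "r \<odot>\<^bsub>M\<^esub> g" t] r g(1) t L(2) l(1) by auto
    have "inv\<^bsub>R\<^esub> r \<odot>\<^bsub>M\<^esub> (r \<odot>\<^bsub>M\<^esub> g) = g" using u g(1) r(1) smult_assoc1[of "inv\<^bsub>R\<^esub> r" r g] by simp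
    then have "g \<in> L" using submoduleD(4)[OF L(1) _ rg, of "inv\<^bsub>R\<^esub> r"] u by simp
    then show ?thesis using L span_minimal[OF L(1), of "insert g Y"] by auto
  qed
  then have "C \<subseteq> {span R M (insert g Y)}" by auto
  from card_mono[OF _ this] show "card C \<le> 1" by simp
qed

text \<open>Adjoining \<open>x g\<close>, then \<open>y g\<close>, then \<open>g\<close> to \<open>Y\<close> splits the extension into three steps. The first two
  have smaller exponents, and in the last one \<open>x\<close> and \<open>y\<close> kill the new generator.\<close>

lemma length_cyclic_finite:
  fixes M :: "('a, 'm) module" and R (structure)
  assumes M: "module R M" and xy: "x \<in> carrier R" "y \<in> carrier R"
    and U: "\<And>r. r \<in> carrier R \<Longrightarrow> r \<in> Units R \<or> (\<exists>a\<in>carrier R. \<exists>b\<in>carrier R. r = a \<otimes> x \<oplus> b \<otimes> y)"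
    and "submodule Y R M" "g \<in> carrier M" "x [^] (i::nat) \<odot>\<^bsub>M\<^esub> g \<in> Y" "y [^] (j::nat) \<odot>\<^bsub>M\<^esub> g \<in> Y"
  shows "\<exists>n. length_le R M Y (span R M (insert g Y)) n"
  using assms(5-)
proof (induction "i + j" arbitrary: i j g Y rule: less_induct)
  case less
  interpret module R M by fact
  note Y = less.prems(1) and g = less.prems(2)
  have YM: "Y \<subseteq> carrier M" using submoduleD(1)[OF Y] by auto
  show ?case
  proof (cases "i = 0 \<or> j = 0")
    case True
    then have "g \<in> Y" using less.prems by auto
    then have "span R M (insert g Y) \<subseteq> Y" by (intro span_minimal[OF Y]) auto
    then show ?thesis using length_le_mono[OF length_le_refl order_refl] by blast
  next
    case False
    then obtain i' j' where ij: "i = Suc i'" "j = Suc j'" by (metis not0_implies_Suc)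
    let ?g1 = "x \<odot>\<^bsub>M\<^esub> g" and ?g2 = "y \<odot>\<^bsub>M\<^esub> g"
    have g12: "?g1 \<in> carrier M" "?g2 \<in> carrier M" using xy g by auto
    have x1: "x [^] i' \<odot>\<^bsub>M\<^esub> ?g1 = x [^] i \<odot>\<^bsub>M\<^esub> g" using ij xy g by (simp add: smult_assoc1)
    have y1: "y [^] j \<odot>\<^bsub>M\<^esub> ?g1 = x \<odot>\<^bsub>M\<^esub> (y [^] j \<odot>\<^bsub>M\<^esub> g)" using xy g by (simp add: smult_assoc1[symmetric] R.m_comm)
    have x2: "x [^] i \<odot>\<^bsub>M\<^esub> ?g2 = y \<odot>\<^bsub>M\<^esub> (x [^] i \<odot>\<^bsub>M\<^esub> g)" using xy g by (simp add: smult_assoc1[symmetric] R.m_comm)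
    have y2: "y [^] j' \<odot>\<^bsub>M\<^esub> ?g2 = y [^] j \<odot>\<^bsub>M\<^esub> g" using ij xy g by (simp add: smult_assoc1)
    let ?Y1 = "span R M (insert ?g1 Y)"
    let ?Y2 = "span R M (insert ?g2 ?Y1)"
    let ?Y3 = "span R M (insert g ?Y2)"
    have s1: "submodule ?Y1 R M" using g12 YM by (intro span_submodule[OF M]) auto
    have s2: "submodule ?Y2 R M" using g12 submoduleD(1)[OF s1] by (intro span_submodule[OF M]) auto
    have s3: "submodule ?Y3 R M" using g submoduleD(1)[OF s2] by (intro span_submodule[OF M]) auto
    have up: "insert ?g1 Y \<subseteq> ?Y1" "insert ?g2 ?Y1 \<subseteq> ?Y2" "insert g ?Y2 \<subseteq> ?Y3"
      by (rule span_superset)+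
    obtain n1 where n1: "length_le R M Y ?Y1 n1"
      using less.hyps[of i' j Y ?g1] ij Y g12 x1 y1 less.prems xy submoduleD(4)[OF Y xy(1)] by auto
    have "\<exists>n. length_le R M ?Y1 ?Y2 n"
    proof (rule less.hyps[of i j'])
      show "x [^] i \<odot>\<^bsub>M\<^esub> ?g2 \<in> ?Y1" "y [^] j' \<odot>\<^bsub>M\<^esub> ?g2 \<in> ?Y1"
        using x2 y2 less.prems up(1) submoduleD(4)[OF Y xy(2)] by auto
    qed (use ij s1 g12 in auto)
    then obtain n2 where n2: "length_le R M ?Y1 ?Y2 n2" by auto
    let ?I = "{a \<otimes> x \<oplus> b \<otimes> y | a b. a \<in> carrier R \<and> b \<in> carrier R}"
    have n3: "length_le R M ?Y2 ?Y3 1"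
    proof (rule length_le_simple[OF M _ _ s2 g])
      show "?I \<subseteq> carrier R" using xy by auto
      show "r \<in> ?I \<or> r \<in> Units R" if "r \<in> carrier R" for r using U[OF that] by blast
      fix r assume "r \<in> ?I"
      then obtain a b where ab: "a \<in> carrier R" "b \<in> carrier R" "r = a \<otimes> x \<oplus> b \<otimes> y" by auto
      then have "r \<odot>\<^bsub>M\<^esub> g = a \<odot>\<^bsub>M\<^esub> ?g1 \<oplus>\<^bsub>M\<^esub> b \<odot>\<^bsub>M\<^esub> ?g2" using xy g by (simp add: smult_l_distr smult_assoc1)
      moreover have "?g1 \<in> ?Y2" "?g2 \<in> ?Y2" using up by auto
      ultimately show "r \<odot>\<^bsub>M\<^esub> g \<in> ?Y2" using ab submoduleD(3,4)[OF s2] by auto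
    qed
    have n12: "length_le R M Y ?Y2 (n1 + n2)"
      by (rule length_le_trans[OF M Y s1 _ _ s2 n1 n2]) (use up in auto)
    have "length_le R M Y ?Y3 (n1 + n2 + 1)"
      by (rule length_le_trans[OF M Y s2 _ _ s3 n12 n3]) (use up in auto)
    moreover have "span R M (insert g Y) \<subseteq> ?Y3" by (rule span_minimal[OF s3]) (use up in auto)
    ultimately show ?thesis using length_le_mono[OF _ order_refl] by blast
  qed
qed

lemma length_span_finite:
  fixes M :: "('a, 'm) module" and R (structure)
  assumes M: "module R M" and xy: "x \<in> carrier R" "y \<in> carrier R"
    and U: "\<And>r. r \<in> carrier R \<Longrightarrow> r \<in> Units R \<or> (\<exists>a\<in>carrier R. \<exists>b\<in>carrier R. r = a \<otimes> x \<oplus> b \<otimes> y)"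
    and Y: "submodule Y R M" and "finite T" "T \<subseteq> carrier M"
    and "\<And>t. t \<in> T \<Longrightarrow> \<exists>i::nat. x [^] i \<odot>\<^bsub>M\<^esub> t \<in> Y" "\<And>t. t \<in> T \<Longrightarrow> \<exists>j::nat. y [^] j \<odot>\<^bsub>M\<^esub> t \<in> Y"
  shows "\<exists>n. length_le R M Y (span R M (T \<union> Y)) n"
  using assms(6-)
proof (induction T)
  case empty
  then show ?case using length_le_mono[OF length_le_refl order_refl span_minimal[OF Y]] by auto
next
  case (insert t T)
  interpret module R M by fact
  let ?X = "span R M (T \<union> Y)"
  have sub: "T \<union> Y \<subseteq> carrier M" "t \<in> carrier M" using insert.prems(1) submoduleD(1)[OF Y] by auto
  have X: "submodule ?X R M" by (rule span_submodule[OF M sub(1)])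
  have YX: "T \<union> Y \<subseteq> ?X" by (rule span_superset)
  obtain n where n: "length_le R M Y ?X n" using insert.IH insert.prems by auto
  obtain i j where "x [^] (i::nat) \<odot>\<^bsub>M\<^esub> t \<in> ?X" "y [^] (j::nat) \<odot>\<^bsub>M\<^esub> t \<in> ?X"
    using insert.prems(2,3)[of t] YX by auto
  then obtain m where m: "length_le R M ?X (span R M (insert t ?X)) m"
    using length_cyclic_finite[OF M xy U X sub(2)] by blast
  have X': "submodule (span R M (insert t ?X)) R M"
    using sub(2) submoduleD(1)[OF X] by (intro span_submodule[OF M]) auto
  have up: "insert t ?X \<subseteq> span R M (insert t ?X)" by (rule span_superset)
  have "length_le R M Y (span R M (insert t ?X)) (n + m)"
    by (rule length_le_trans[OF M Y X _ _ X' n m]) (use YX up in auto)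
  moreover have "span R M (insert t T \<union> Y) \<subseteq> span R M (insert t ?X)"
    by (rule span_minimal[OF X']) (use YX up in auto)
  ultimately show ?case using length_le_mono[OF _ order_refl] by blast
qed

section \<open>Regular local rings of dimension two\<close>

lemma noetherian_maximal:
  assumes "noetherian_ring R" "\<A> \<noteq> {}" "\<And>I. I \<in> \<A> \<Longrightarrow> ideal I R"
  obtains I where "I \<in> \<A>" "\<And>J. J \<in> \<A> \<Longrightarrow> I \<subseteq> J \<Longrightarrow> J = I"
proof -
  interpret noetherian_ring R by fact
  have "\<Union>C \<in> \<A>" if "C \<noteq> {}" "subset.chain \<A> C" for C
  proof -
    have "subset.chain {I. ideal I R} C" using that(2) assms(3) unfolding subset.chain_def by auto
    then have "\<Union>C \<in> C" by (rule ideal_chain_is_trivial[OF that(1)])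
    then show ?thesis using that(2) unfolding subset.chain_def by auto
  qed
  from subset_Zorn_nonempty[OF assms(2) this] show ?thesis using that by blast
qed

lemma local_ring_units:
  assumes "noetherian_ring S" "local_ring S"
  shows "maximalideal (max_ideal S) S" "r \<in> carrier S \<Longrightarrow> r \<notin> max_ideal S \<Longrightarrow> r \<in> Units S"
proof -
  interpret cring S using assms(2) by (simp add: local_ring_def)
  have ex1: "\<exists>!m. maximalideal m S" using assms(2) by (simp add: local_ring_def)
  show "maximalideal (max_ideal S) S" unfolding max_ideal_def by (rule theI'[OF ex1])
  assume r: "r \<in> carrier S" "r \<notin> max_ideal S"
  show "r \<in> Units S"
  proof (rule ccontr)
    assume nu: "r \<notin> Units S"
    let ?A = "{J. ideal J S \<and> r \<in> J \<and> \<one>\<^bsub>S\<^esub> \<notin> J}"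
    have "\<one>\<^bsub>S\<^esub> \<notin> PIdl\<^bsub>S\<^esub> r"
    proof
      assume "\<one>\<^bsub>S\<^esub> \<in> PIdl\<^bsub>S\<^esub> r"
      then obtain s where s: "s \<in> carrier S" "\<one>\<^bsub>S\<^esub> = s \<otimes>\<^bsub>S\<^esub> r" by (auto simp: cgenideal_def)
      then have "r \<in> Units S" using r(1) m_comm[of s r] unfolding Units_def by auto
      then show False using nu by simp
    qed
    then have "PIdl\<^bsub>S\<^esub> r \<in> ?A" using cgenideal_ideal[OF r(1)] cgenideal_self[OF r(1)] by auto
    then obtain J where J: "J \<in> ?A" "\<And>J'. J' \<in> ?A \<Longrightarrow> J \<subseteq> J' \<Longrightarrow> J' = J"
      using noetherian_maximal[OF assms(1), of ?A] by blast
    have "maximalideal J S"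
    proof (rule maximalidealI)
      show "ideal J S" "carrier S \<noteq> J" using J(1) by auto
      fix J' assume J': "ideal J' S" "J \<subseteq> J'" "J' \<subseteq> carrier S"
      show "J' = J \<or> J' = carrier S"
        using ideal.one_imp_carrier[OF J'(1)] J(2)[of J'] J(1) J' by blast
    qed
    then have "J = max_ideal S" using ex1 \<open>maximalideal (max_ideal S) S\<close> by auto
    then show False using J(1) r(2) by auto
  qed
qed

text \<open>The ring is local with maximal ideal \<open>(x, y)\<close>: the non-units are exactly the combinations of
  \<open>x\<close> and \<open>y\<close>. Stated like this, the situation is symmetric in \<open>x\<close> and \<open>y\<close>.\<close>

locale two_generated_local = cring S for S (structure) +
  fixes x y :: 'a
  assumes noeth: "noetherian_ring S"
    and x: "x \<in> carrier S" and y: "y \<in> carrier S"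
    and unit_or: "r \<in> carrier S \<Longrightarrow> r \<in> Units S \<or> (\<exists>a\<in>carrier S. \<exists>b\<in>carrier S. r = a \<otimes> x \<oplus> b \<otimes> y)"
    and not_one: "a \<in> carrier S \<Longrightarrow> b \<in> carrier S \<Longrightarrow> a \<otimes> x \<oplus> b \<otimes> y \<noteq> \<one>"
begin

lemma swap: "two_generated_local S y x"
proof (intro two_generated_local.intro two_generated_local_axioms.intro)
  fix r assume r: "r \<in> carrier S"
  show "r \<in> Units S \<or> (\<exists>a\<in>carrier S. \<exists>b\<in>carrier S. r = a \<otimes> y \<oplus> b \<otimes> x)"
    using unit_or[OF r] x y a_comm m_closed by metis
next
  fix a b assume "a \<in> carrier S" "b \<in> carrier S"
  then show "a \<otimes> y \<oplus> b \<otimes> x \<noteq> \<one>" using not_one[of b a] x y by (simp add: a_comm)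
qed (use x y noeth is_cring in auto)

definition nonunits where "nonunits = {a \<otimes> x \<oplus> b \<otimes> y | a b. a \<in> carrier S \<and> b \<in> carrier S}"

lemma nonunits_eq: "nonunits = PIdl x <+>\<^bsub>S\<^esub> PIdl y"
  unfolding nonunits_def cgenideal_def set_add_def' by blast

lemma nonunits_ideal: "ideal nonunits S"
  unfolding nonunits_eq by (intro add_ideals cgenideal_ideal x y)

lemma gens_in_nonunits: "x \<in> nonunits" "y \<in> nonunits"
proof -
  have "x = \<one> \<otimes> x \<oplus> \<zero> \<otimes> y" "y = \<zero> \<otimes> x \<oplus> \<one> \<otimes> y" using x y by auto
  then show "x \<in> nonunits" "y \<in> nonunits" unfolding nonunits_def by blast+
qed

lemma one_minus_nonunit: "r \<in> nonunits \<Longrightarrow> \<one> \<ominus> r \<in> Units S"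
proof (rule ccontr)
  interpret ideal nonunits S by (rule nonunits_ideal)
  assume r: "r \<in> nonunits" "\<one> \<ominus> r \<notin> Units S"
  have rS: "r \<in> carrier S" using r by auto
  have "\<one> \<ominus> r \<in> nonunits" using unit_or[of "\<one> \<ominus> r"] r rS unfolding nonunits_def by auto
  then have "(\<one> \<ominus> r) \<oplus> r \<in> nonunits" using r by auto
  moreover have "(\<one> \<ominus> r) \<oplus> r = \<one>" using rS by algebra
  ultimately show False using not_one unfolding nonunits_def by force
qed

lemma mem_nonunits_iff: "r \<in> carrier S \<Longrightarrow> r \<in> nonunits \<longleftrightarrow> r \<notin> Units S"
proof -
  interpret ideal nonunits S by (rule nonunits_ideal)
  assume r: "r \<in> carrier S"
  have "r \<notin> nonunits" if "r \<in> Units S"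
  proof
    assume "r \<in> nonunits"
    then have "inv r \<otimes> r \<in> nonunits" using that by (intro I_l_closed) auto
    then show False using not_one that unfolding nonunits_def by force
  qed
  then show ?thesis using unit_or[OF r] unfolding nonunits_def by auto
qed

lemma nakayama_ideal:
  assumes K: "ideal K S" and L: "ideal L S" and "\<And>v. v \<in> K \<Longrightarrow> \<exists>l\<in>L. \<exists>r\<in>nonunits. \<exists>w\<in>K. v = l \<oplus> r \<otimes> w"
  shows "K \<subseteq> L"
proof -
  have M: "module S (ring_module S)" by (rule ring_module_module) (rule is_cring)
  obtain T where T: "finite T" "T \<subseteq> K" "span S (ring_module S) T = K"
    by (rule noetherian_ideal_span[OF is_cring noeth K])
  have KS: "K \<subseteq> carrier S" using ideal.Icarr[OF K] by auto
  show ?thesis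
  proof (rule nakayama_span[OF M nonunits_ideal one_minus_nonunit _ T(1) _ T(3)])
    show "submodule L S (ring_module S)" using submodule_ring_module_iff[OF is_cring] L by simp
    show "T \<subseteq> carrier (ring_module S)" using T(2) KS by auto
    fix v assume "v \<in> K"
    then obtain l r w where "l \<in> L" "r \<in> nonunits" "w \<in> K" "v = l \<oplus> r \<otimes> w" using assms(3) by blast
    then show "\<exists>l\<in>L. \<exists>w\<in>ideal_smult S (ring_module S) nonunits K. v = l \<oplus>\<^bsub>ring_module S\<^esub> w"
      using ideal_smultI[of r nonunits w K "ring_module S" S] by auto
  qed
qed

text \<open>A counterexample \<open>r\<close> is not a unit, so \<open>r = a x + b y\<close>, and \<open>b\<close> is a counterexample as well. If
  \<open>(x, r)\<close> is maximal among the ideals that arise from counterexamples, then \<open>(x, r) = (x, b)\<close>. So \<open>b\<close>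
  is a multiple of \<open>b y\<close> modulo \<open>x\<close>, which makes it zero modulo \<open>x\<close>, as \<open>1 - d y\<close> is a unit.\<close>

lemma valuation_mod_x:
  assumes "r \<in> carrier S"
  shows "r \<in> PIdl x \<or> (\<exists>u\<in>Units S. \<exists>i::nat. \<exists>c\<in>carrier S. r = u \<otimes> y [^] i \<oplus> c \<otimes> x)"
proof (rule ccontr)
  define bad where "bad r \<longleftrightarrow> r \<in> carrier S \<and> r \<notin> PIdl x \<and>
    \<not> (\<exists>u\<in>Units S. \<exists>i::nat. \<exists>c\<in>carrier S. r = u \<otimes> y [^] i \<oplus> c \<otimes> x)" for r
  let ?A = "{PIdl x <+>\<^bsub>S\<^esub> PIdl r | r. bad r}"
  assume "\<not> ?thesis"
  then have "bad r" using assms unfolding bad_def by blast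
  then have "?A \<noteq> {}" by blast
  moreover have "ideal J S" if "J \<in> ?A" for J using that by (auto simp: bad_def intro!: add_ideals cgenideal_ideal x)
  ultimately obtain I where I: "I \<in> ?A" "\<And>J. J \<in> ?A \<Longrightarrow> I \<subseteq> J \<Longrightarrow> J = I"
    using noetherian_maximal[OF noeth, of ?A] by blast
  from I(1) obtain r where r: "bad r" "I = PIdl x <+>\<^bsub>S\<^esub> PIdl r" by blast
  have rS: "r \<in> carrier S" using r by (simp add: bad_def)
  have "r \<notin> Units S"
  proof
    assume "r \<in> Units S"
    moreover have "r = r \<otimes> y [^] (0::nat) \<oplus> \<zero> \<otimes> x" using rS x y by simp
    ultimately show False using r(1) unfolding bad_def by (meson zero_closed)
  qed
  then obtain a b where ab: "a \<in> carrier S" "b \<in> carrier S" "r = a \<otimes> x \<oplus> b \<otimes> y" using unit_or rS by blast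
  have b1: "b \<notin> PIdl x"
  proof
    assume "b \<in> PIdl x"
    then obtain c where c: "c \<in> carrier S" "b = c \<otimes> x" by (auto simp: cgenideal_def)
    then have "r = (a \<oplus> c \<otimes> y) \<otimes> x" using ab x y by (simp only: ab(3) c(2)) algebra
    then have "r \<in> PIdl x" using ab c y unfolding cgenideal_def by blast
    then show False using r(1) unfolding bad_def by blast
  qed
  have "\<not> (\<exists>u\<in>Units S. \<exists>i::nat. \<exists>c\<in>carrier S. b = u \<otimes> y [^] i \<oplus> c \<otimes> x)"
  proof
    assume "\<exists>u\<in>Units S. \<exists>i::nat. \<exists>c\<in>carrier S. b = u \<otimes> y [^] i \<oplus> c \<otimes> x"
    then obtain u c and i :: nat where c: "u \<in> Units S" "c \<in> carrier S" "b = u \<otimes> y [^] i \<oplus> c \<otimes> x" by blast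
    have yi: "y [^] i \<in> carrier S" "u \<in> carrier S" using y c by auto
    have "r = u \<otimes> (y [^] i \<otimes> y) \<oplus> (a \<oplus> c \<otimes> y) \<otimes> x"
      using ab x y yi c(2) by (simp only: ab(3) c(3)) algebra
    then have "r = u \<otimes> y [^] Suc i \<oplus> (a \<oplus> c \<otimes> y) \<otimes> x" by simp
    moreover have "a \<oplus> c \<otimes> y \<in> carrier S" using ab c y by simp
    ultimately show False using r(1) c(1) unfolding bad_def by blast
  qed
  then have "bad b" using b1 ab(2) unfolding bad_def by blast
  then have bA: "PIdl x <+>\<^bsub>S\<^esub> PIdl b \<in> ?A" by blast
  have "I \<subseteq> PIdl x <+>\<^bsub>S\<^esub> PIdl b"
  proof
    fix v assume "v \<in> I"
    then obtain c d where cd: "c \<in> carrier S" "d \<in> carrier S" "v = c \<otimes> x \<oplus> d \<otimes> r"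
      unfolding r(2) cgenideal_def set_add_def' by blast
    then have "v = (c \<oplus> d \<otimes> a) \<otimes> x \<oplus> (d \<otimes> y) \<otimes> b" using ab(1,2) cd(1,2) x y by (simp only: ab(3) cd(3)) algebra
    moreover have "c \<oplus> d \<otimes> a \<in> carrier S" "d \<otimes> y \<in> carrier S" using cd ab y by auto
    ultimately show "v \<in> PIdl x <+>\<^bsub>S\<^esub> PIdl b" unfolding cgenideal_def set_add_def' by blast
  qed
  then have eq: "PIdl x <+>\<^bsub>S\<^esub> PIdl b = I" by (rule I(2)[OF bA])
  have "b = \<zero> \<otimes> x \<oplus> \<one> \<otimes> b" using ab x by simp
  then have "b \<in> PIdl x <+>\<^bsub>S\<^esub> PIdl b" unfolding cgenideal_def set_add_def' by blast
  then have "b \<in> PIdl x <+>\<^bsub>S\<^esub> PIdl r" using eq r(2) by simp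
  then obtain c d where cd: "c \<in> carrier S" "d \<in> carrier S" "b = c \<otimes> x \<oplus> d \<otimes> r"
    unfolding cgenideal_def set_add_def' by blast
  have "(\<one> \<ominus> d \<otimes> y) \<otimes> b = b \<ominus> d \<otimes> y \<otimes> b" using ab(1,2) cd(1,2) x y by algebra
  also have "\<dots> = (c \<otimes> x \<oplus> d \<otimes> r) \<ominus> d \<otimes> y \<otimes> b" using cd(3) by simp
  also have "\<dots> = (c \<oplus> d \<otimes> a) \<otimes> x" using ab(1,2) cd(1,2) x y by (simp only: ab(3)) algebra
  finally have e: "(\<one> \<ominus> d \<otimes> y) \<otimes> b = (c \<oplus> d \<otimes> a) \<otimes> x" .
  have u: "\<one> \<ominus> d \<otimes> y \<in> Units S"
    using ideal.I_l_closed[OF nonunits_ideal gens_in_nonunits(2) cd(2)] by (rule one_minus_nonunit)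
  have "b = inv (\<one> \<ominus> d \<otimes> y) \<otimes> ((\<one> \<ominus> d \<otimes> y) \<otimes> b)"
    using u ab(2) cd y by (simp add: m_assoc[symmetric])
  also have "\<dots> = (inv (\<one> \<ominus> d \<otimes> y) \<otimes> (c \<oplus> d \<otimes> a)) \<otimes> x"
    unfolding e using u ab(1) cd(1,2) x by (simp add: m_assoc)
  finally have "b = (inv (\<one> \<ominus> d \<otimes> y) \<otimes> (c \<oplus> d \<otimes> a)) \<otimes> x" .
  moreover have "inv (\<one> \<ominus> d \<otimes> y) \<otimes> (c \<oplus> d \<otimes> a) \<in> carrier S" using u ab(1) cd(1,2) by simp
  ultimately have "b \<in> PIdl x" unfolding cgenideal_def by blast
  then show False using b1 by simp
qed

text \<open>A case of Krull's principal ideal theorem. For an \<open>a\<close> in \<open>P1\<close> outside \<open>P0\<close>, let \<open>I j\<close> be the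
  contraction to \<open>S\<close> of the ideal that \<open>P0\<close> and the \<open>j\<close>-th power of \<open>a\<close> generate in the localization at
  \<open>P1\<close>. If a power of \<open>y\<close> were in \<open>(x) + P0\<close>, then every ideal that contains \<open>(x) + P0\<close> would be
  determined by the least power of \<open>y\<close> in it, so the decreasing sequence \<open>I j + (x)\<close> would become
  stationary. As \<open>x\<close> is not in \<open>P1\<close>, this gives \<open>I j = I (j + 1) + x I j\<close>, so \<open>I j = I (j + 1)\<close> by
  Nakayama. Dividing by the \<open>j\<close>-th power of \<open>a\<close> turns an element outside \<open>P1\<close> into a multiple of \<open>a\<close>
  modulo \<open>P0\<close>, which is impossible.\<close>

lemma powers_of_y_not_in_x:
  assumes P0: "primeideal P0 S" and P1: "primeideal P1 S" and P01: "P0 \<subset> P1" and P1m: "\<not> nonunits \<subseteq> P1"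
  shows "y [^] (k::nat) \<notin> PIdl x <+>\<^bsub>S\<^esub> P0"
proof
  interpret P0: primeideal P0 S by fact
  interpret P1: primeideal P1 S by fact
  let ?Q = "PIdl x <+>\<^bsub>S\<^esub> P0"
  assume yk: "y [^] k \<in> ?Q"
  have Q: "ideal ?Q S" by (intro add_ideals cgenideal_ideal x P0.is_ideal)
  interpret Q: ideal ?Q S by fact
  have xQ: "c \<otimes> x \<in> ?Q" if "c \<in> carrier S" for c
  proof -
    have "c \<otimes> x = c \<otimes> x \<oplus> \<zero>" using that x by simp
    then show ?thesis using that P0.zero_closed unfolding cgenideal_def set_add_def' by blast
  qed
  have pow: "a \<in> P1" if "a [^] (j::nat) \<in> P1" "a \<in> carrier S" for a j
    using that
  proof (induction j)
    case 0
    then show ?case using P1.one_imp_carrier P1.I_notcarr by auto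
  next
    case (Suc j)
    then show ?case using P1.I_prime[of "a [^] j" a] by auto
  qed
  have xP1: "x \<notin> P1"
  proof
    assume xP: "x \<in> P1"
    obtain c p where cp: "c \<in> carrier S" "p \<in> P0" "y [^] k = c \<otimes> x \<oplus> p"
      using yk unfolding cgenideal_def set_add_def' by blast
    have "c \<otimes> x \<oplus> p \<in> P1" using P1.I_l_closed[OF xP cp(1)] cp(2) P01 by (intro P1.a_closed) auto
    then have "y [^] k \<in> P1" using cp(3) by simp
    then have "y \<in> P1" using pow y by auto
    then have "nonunits \<subseteq> P1" using xP unfolding nonunits_def by (auto intro!: P1.a_closed P1.I_l_closed)
    then show False using P1m by simp
  qed
  have claim: "r \<in> ?Q \<or> (\<exists>u\<in>Units S. \<exists>i. \<exists>q\<in>?Q. r = u \<otimes> y [^] (i::nat) \<oplus> q)" if r: "r \<in> carrier S" for r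
    using valuation_mod_x[OF r]
  proof
    assume "r \<in> PIdl x"
    then show ?thesis using xQ unfolding cgenideal_def by blast
  next
    assume "\<exists>u\<in>Units S. \<exists>i::nat. \<exists>c\<in>carrier S. r = u \<otimes> y [^] i \<oplus> c \<otimes> x"
    then show ?thesis using xQ by blast
  qed
  obtain a where a: "a \<in> P1" "a \<notin> P0" using P01 by auto
  have aS: "a \<in> carrier S" using a by auto
  define I where "I j = {r \<in> carrier S. \<exists>s\<in>carrier S - P1. \<exists>t\<in>carrier S. \<exists>p\<in>P0. s \<otimes> r = a [^] j \<otimes> t \<oplus> p}" for j :: nat
  have II: "r \<in> I j" if "r \<in> carrier S" "s \<in> carrier S - P1" "t \<in> carrier S" "p \<in> P0" "s \<otimes> r = a [^] j \<otimes> t \<oplus> p"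
    for r s t p j using that unfolding I_def by blast
  have one: "\<one> \<in> carrier S - P1" using P1.one_imp_carrier P1.I_notcarr by auto
  have Iid: "ideal (I j) S" for j
  proof -
    have M: "module S (ring_module S)" by (rule ring_module_module) (rule is_cring)
    interpret M: module S "ring_module S" by fact
    have aj: "a [^] j \<in> carrier S" using aS by auto
    have "submodule (I j) S (ring_module S)" unfolding M.submodule_iff
    proof (intro conjI ballI)
      show "I j \<subseteq> carrier (ring_module S)" by (auto simp: I_def)
      have "\<one> \<otimes> \<zero> = a [^] j \<otimes> \<zero> \<oplus> \<zero>" using aj by simp
      then show "\<zero>\<^bsub>ring_module S\<^esub> \<in> I j" using II[OF zero_closed one zero_closed P0.zero_closed] by simp
    next
      fix v w assume "v \<in> I j" "w \<in> I j"
      then obtain s t p s' t' p' where *: "v \<in> carrier S" "w \<in> carrier S" "s \<in> carrier S - P1" "s' \<in> carrier S - P1"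
        "t \<in> carrier S" "t' \<in> carrier S" "p \<in> P0" "p' \<in> P0" "s \<otimes> v = a [^] j \<otimes> t \<oplus> p" "s' \<otimes> w = a [^] j \<otimes> t' \<oplus> p'"
        unfolding I_def by blast
      have ss: "s \<otimes> s' \<in> carrier S - P1" using * P1.I_prime[of s s'] by auto
      have c: "s \<in> carrier S" "s' \<in> carrier S" "p \<in> carrier S" "p' \<in> carrier S" using * by auto
      have "(s \<otimes> s') \<otimes> (v \<oplus> w) = s' \<otimes> (s \<otimes> v) \<oplus> s \<otimes> (s' \<otimes> w)" using *(1,2) c by algebra
      also have "\<dots> = a [^] j \<otimes> (s' \<otimes> t \<oplus> s \<otimes> t') \<oplus> (s' \<otimes> p \<oplus> s \<otimes> p')"
        unfolding *(9,10) using *(5,6) c aj by algebra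
      finally have e: "(s \<otimes> s') \<otimes> (v \<oplus> w) = a [^] j \<otimes> (s' \<otimes> t \<oplus> s \<otimes> t') \<oplus> (s' \<otimes> p \<oplus> s \<otimes> p')" .
      have p: "s' \<otimes> p \<oplus> s \<otimes> p' \<in> P0" using * by (auto intro!: P0.a_closed P0.I_l_closed)
      have t: "s' \<otimes> t \<oplus> s \<otimes> t' \<in> carrier S" using * by auto
      show "v \<oplus>\<^bsub>ring_module S\<^esub> w \<in> I j" using II[OF _ ss t p e] *(1,2) by simp
    next
      fix r v assume r: "r \<in> carrier S" and "v \<in> I j"
      then obtain s t p where *: "v \<in> carrier S" "s \<in> carrier S - P1" "t \<in> carrier S" "p \<in> P0" "s \<otimes> v = a [^] j \<otimes> t \<oplus> p"
        unfolding I_def by blast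
      have c: "s \<in> carrier S" "p \<in> carrier S" using * by auto
      have "s \<otimes> (r \<otimes> v) = r \<otimes> (s \<otimes> v)" using *(1) c r by algebra
      also have "\<dots> = a [^] j \<otimes> (r \<otimes> t) \<oplus> r \<otimes> p" unfolding *(5) using *(3) c aj r by algebra
      finally have "s \<otimes> (r \<otimes> v) = a [^] j \<otimes> (r \<otimes> t) \<oplus> r \<otimes> p" .
      from II[OF _ *(2) _ _ this] show "r \<odot>\<^bsub>ring_module S\<^esub> v \<in> I j"
        using *(1,3,4) r P0.I_l_closed by simp
    qed
    then show ?thesis using submodule_ring_module_iff[OF is_cring] by simp
  qed
  have Idec: "I (Suc j) \<subseteq> I j" for j
  proof
    fix r assume "r \<in> I (Suc j)"
    then obtain s t p where *: "r \<in> carrier S" "s \<in> carrier S - P1" "t \<in> carrier S" "p \<in> P0" "s \<otimes> r = a [^] Suc j \<otimes> t \<oplus> p"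
      unfolding I_def by blast
    have "a [^] Suc j \<otimes> t = a [^] j \<otimes> (a \<otimes> t)" using aS * by (simp add: m_assoc)
    then show "r \<in> I j" using II[OF *(1,2) _ *(4), of "a \<otimes> t" j] * aS by simp
  qed
  have P0I: "P0 \<subseteq> I j" for j
  proof
    fix p assume p: "p \<in> P0"
    then have "\<one> \<otimes> p = a [^] j \<otimes> \<zero> \<oplus> p" using aS by auto
    then show "p \<in> I j" by (rule II[OF P0.Icarr[OF p] one zero_closed p])
  qed
  have IQ: "ideal (I j <+>\<^bsub>S\<^esub> ?Q) S" for j by (intro add_ideals Iid Q)
  have QI: "?Q \<subseteq> I j <+>\<^bsub>S\<^esub> ?Q" "I j \<subseteq> I j <+>\<^bsub>S\<^esub> ?Q" for j
  proof -
    have "q = \<zero> \<oplus> q" if "q \<in> ?Q" for q using that by auto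
    then show "?Q \<subseteq> I j <+>\<^bsub>S\<^esub> ?Q" using ideal.Icarr additive_subgroup.zero_closed[OF ideal.axioms(1)[OF Iid]] unfolding set_add_def'[of _ "I j" "?Q"] by blast
    have "q = q \<oplus> \<zero>" if "q \<in> I j" for q using ideal.Icarr[OF Iid that] by auto
    then show "I j \<subseteq> I j <+>\<^bsub>S\<^esub> ?Q" using Q.zero_closed unfolding set_add_def'[of _ "I j" "?Q"] by blast
  qed
  define e where "e j = (LEAST i. y [^] (i::nat) \<in> I j <+>\<^bsub>S\<^esub> ?Q)" for j
  have ek: "e j \<le> k" for j unfolding e_def by (rule Least_le) (use yk QI in auto)
  have e1: "y [^] e j \<in> I j <+>\<^bsub>S\<^esub> ?Q" for j unfolding e_def by (rule LeastI[of _ k]) (use yk QI in auto)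
  have e2: "e j \<le> i" if "y [^] (i::nat) \<in> I j <+>\<^bsub>S\<^esub> ?Q" for i j unfolding e_def by (rule Least_le) (rule that)
  have emono: "e j \<le> e (Suc j)" for j using e2 e1[of "Suc j"] set_add_mono_left[OF Idec[of j], of S ?Q] by auto
  have "\<exists>j. e (Suc j) = e j"
  proof (rule ccontr)
    assume "\<not> ?thesis"
    then have "e j < e (Suc j)" for j using emono[of j] by (metis le_neq_implies_less)
    then have "strict_mono e" by (rule strict_mono_Suc_iff[THEN iffD2, rule_format])
    then have "Suc k \<le> e (Suc k)" by (rule strict_mono_imp_increasing)
    then show False using ek[of "Suc k"] by simp
  qed
  then obtain j where j: "e (Suc j) = e j" by auto
  have sub: "I j \<subseteq> I (Suc j) <+>\<^bsub>S\<^esub> ?Q"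
  proof
    interpret J: ideal "I (Suc j) <+>\<^bsub>S\<^esub> ?Q" S by (rule IQ)
    interpret J0: ideal "I j <+>\<^bsub>S\<^esub> ?Q" S by (rule IQ)
    fix r assume r: "r \<in> I j"
    have rS: "r \<in> carrier S" using ideal.Icarr[OF Iid r] .
    from claim[OF rS] show "r \<in> I (Suc j) <+>\<^bsub>S\<^esub> ?Q"
    proof
      assume "r \<in> ?Q" then show ?thesis using QI by blast
    next
      assume "\<exists>u\<in>Units S. \<exists>i. \<exists>q\<in>?Q. r = u \<otimes> y [^] (i::nat) \<oplus> q"
      then obtain u q and i :: nat where u: "u \<in> Units S" "q \<in> ?Q" "r = u \<otimes> y [^] i \<oplus> q" by blast
      have c: "q \<in> carrier S" "u \<in> carrier S" "y [^] i \<in> carrier S" using u Q.Icarr y by auto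
      have "r \<oplus> (\<ominus> \<one>) \<otimes> q \<in> I j <+>\<^bsub>S\<^esub> ?Q"
        using r u QI[of j] c by (intro J0.a_closed J0.I_l_closed) auto
      moreover have "r \<oplus> (\<ominus> \<one>) \<otimes> q = u \<otimes> y [^] i" unfolding u(3) using c by algebra
      ultimately have h: "u \<otimes> y [^] i \<in> I j <+>\<^bsub>S\<^esub> ?Q" by simp
      have "inv u \<otimes> (u \<otimes> y [^] i) \<in> I j <+>\<^bsub>S\<^esub> ?Q"
        by (rule J0.I_l_closed[OF h]) (use u(1) in simp)
      then have "y [^] i \<in> I j <+>\<^bsub>S\<^esub> ?Q" using u c by (simp add: m_assoc[symmetric])
      then have "e (Suc j) \<le> i" using e2 j by auto
      then have "y [^] i = y [^] (i - e (Suc j)) \<otimes> y [^] e (Suc j)" using y by (simp add: nat_pow_mult)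
      then have "y [^] i \<in> I (Suc j) <+>\<^bsub>S\<^esub> ?Q" using e1[of "Suc j"] y by (auto intro!: J.I_l_closed)
      then show ?thesis unfolding u(3) using c u(2) QI by (intro J.a_closed J.I_l_closed) auto
    qed
  qed
  have "I j \<subseteq> I (Suc j)"
  proof (rule nakayama_ideal[OF Iid Iid])
    interpret I0: ideal "I j" S by (rule Iid)
    interpret I1: ideal "I (Suc j)" S by (rule Iid)
    fix v assume v: "v \<in> I j"
    then obtain w c p where w: "w \<in> I (Suc j)" "c \<in> carrier S" "p \<in> P0" "v = w \<oplus> (c \<otimes> x \<oplus> p)"
      using sub unfolding cgenideal_def set_add_def' by blast
    have cc: "w \<in> carrier S" "p \<in> carrier S" "v \<in> carrier S" using w v I1.Icarr I0.Icarr by auto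
    have e: "v = (w \<oplus> p) \<oplus> x \<otimes> c" unfolding w(4) using cc w(2) x by algebra
    have wp: "w \<oplus> p \<in> I (Suc j)" using w P0I by (intro I1.a_closed) auto
    have "w \<oplus> p \<in> I j" using wp Idec by blast
    then have "v \<oplus> (\<ominus> \<one>) \<otimes> (w \<oplus> p) \<in> I j" using I0.a_closed[OF v I0.I_l_closed[OF _ a_inv_closed[OF one_closed]]] by blast
    moreover have "v \<oplus> (\<ominus> \<one>) \<otimes> (w \<oplus> p) = x \<otimes> c" unfolding e using cc(1,2) w(2) x by algebra
    ultimately have "x \<otimes> c \<in> I j" by simp
    then obtain s t q where s: "s \<in> carrier S - P1" "t \<in> carrier S" "q \<in> P0" "s \<otimes> (x \<otimes> c) = a [^] j \<otimes> t \<oplus> q"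
      unfolding I_def by blast
    have "s \<otimes> x \<in> carrier S - P1" using s(1) x xP1 P1.I_prime[of s x] by auto
    moreover have "(s \<otimes> x) \<otimes> c = a [^] j \<otimes> t \<oplus> q" using s w(2) x by (simp add: m_assoc)
    ultimately have "c \<in> I j" using II[OF w(2) _ s(2,3)] by blast
    then show "\<exists>l\<in>I (Suc j). \<exists>r\<in>nonunits. \<exists>w\<in>I j. v = l \<oplus> r \<otimes> w" using e wp gens_in_nonunits(1) by blast
  qed
  moreover have "\<one> \<otimes> a [^] j = a [^] j \<otimes> \<one> \<oplus> \<zero>" using aS by simp
  then have "a [^] j \<in> I j" by (rule II[OF nat_pow_closed[OF aS] one one_closed P0.zero_closed])
  ultimately have "a [^] j \<in> I (Suc j)" by auto
  then obtain s t p where s: "s \<in> carrier S - P1" "t \<in> carrier S" "p \<in> P0" "s \<otimes> a [^] j = a [^] Suc j \<otimes> t \<oplus> p"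
    unfolding I_def by blast
  have c: "s \<in> carrier S" "p \<in> carrier S" "a [^] j \<in> carrier S" using s aS by auto
  have "a [^] j \<otimes> (s \<ominus> a \<otimes> t) = s \<otimes> a [^] j \<ominus> (a [^] j \<otimes> a) \<otimes> t" using c s(2) aS by algebra
  also have "\<dots> = p" using s(4) c s(2) aS by (simp, algebra)
  finally have "a [^] j \<otimes> (s \<ominus> a \<otimes> t) \<in> P0" using s(3) by simp
  moreover have "a [^] i \<notin> P0" for i :: nat
  proof (induction i)
    case 0
    then show ?case using one P01 by auto
  next
    case (Suc i)
    then show ?case using a aS P0.I_prime[of "a [^] i" a] by auto
  qed
  ultimately have "s \<ominus> a \<otimes> t \<in> P1" using P0.I_prime[of "a [^] j" "s \<ominus> a \<otimes> t"] c s(2) aS P01 by auto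
  then have "(s \<ominus> a \<otimes> t) \<oplus> t \<otimes> a \<in> P1" using a s(2) by (intro P1.a_closed P1.I_l_closed) auto
  moreover have "(s \<ominus> a \<otimes> t) \<oplus> t \<otimes> a = s" using c s(2) aS by algebra
  ultimately show False using s(1) by simp
qed

text \<open>An element outside \<open>(x)\<close> is a unit times a power of \<open>y\<close> modulo \<open>x\<close>, and no such power lies in
  \<open>(x) + P0\<close>. Hence \<open>P0\<close> is contained in \<open>(x)\<close>. As \<open>x\<close> is not in \<open>P0\<close>, it follows that \<open>P0 = x P0\<close>, and
  Nakayama's lemma applies. In a regular local ring of dimension two, this shows that \<open>S\<close> is a domain.\<close>

lemma prime_chain_bottom_zero:
  assumes P0: "primeideal P0 S" and P1: "primeideal P1 S" and P01: "P0 \<subset> P1" and P1m: "\<not> nonunits \<subseteq> P1"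
  shows "P0 = {\<zero>}"
proof -
  interpret P0: primeideal P0 S by fact
  interpret P1: primeideal P1 S by fact
  note y_pow = powers_of_y_not_in_x[OF assms]
  have one: "\<one> \<notin> P1" using P1.one_imp_carrier P1.I_notcarr by auto
  have unit_times: "y [^] i \<in> J" if J: "ideal J S" and u: "u \<in> Units S" and uy: "u \<otimes> y [^] (i::nat) \<in> J" for u i J
  proof -
    have "inv u \<otimes> (u \<otimes> y [^] i) \<in> J" by (rule ideal.I_l_closed[OF J uy]) (use u in simp)
    moreover have "inv u \<otimes> (u \<otimes> y [^] i) = y [^] i" using u Units_closed[OF u] y by (simp add: m_assoc[symmetric])
    ultimately show ?thesis by simp
  qed
  have P0x: "P0 \<subseteq> PIdl x"
  proof
    fix p assume p: "p \<in> P0"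
    show "p \<in> PIdl x"
    proof (rule ccontr)
      assume "p \<notin> PIdl x"
      then obtain u c and i :: nat where u: "u \<in> Units S" "c \<in> carrier S" "p = u \<otimes> y [^] i \<oplus> c \<otimes> x"
        using valuation_mod_x[of p] p by auto
      have c: "u \<in> carrier S" "y [^] i \<in> carrier S" using u y by auto
      have e: "u \<otimes> y [^] i = (\<ominus> c) \<otimes> x \<oplus> p" unfolding u(3) using c u(2) x by algebra
      have "u \<otimes> y [^] i \<in> PIdl x <+>\<^bsub>S\<^esub> P0"
        unfolding e by (intro set_add_memI p ideal.I_l_closed[OF cgenideal_ideal[OF x] cgenideal_self[OF x]]) (use u(2) in simp)
      then have "y [^] i \<in> PIdl x <+>\<^bsub>S\<^esub> P0"
        by (intro unit_times[OF _ u(1)] add_ideals cgenideal_ideal x P0.is_ideal)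
      then show False using y_pow by simp
    qed
  qed
  have xP0: "x \<notin> P0"
  proof
    assume xP: "x \<in> P0"
    obtain a where a: "a \<in> P1" "a \<notin> P0" using P01 by auto
    have "a \<notin> PIdl x" using a(2) xP P0.I_l_closed unfolding cgenideal_def by auto
    then obtain u c and i :: nat where u: "u \<in> Units S" "c \<in> carrier S" "a = u \<otimes> y [^] i \<oplus> c \<otimes> x"
      using valuation_mod_x[of a] a P1.Icarr by auto
    have c: "u \<in> carrier S" "y [^] i \<in> carrier S" using u y by auto
    have "x \<in> P1" using xP P01 by auto
    then have "a \<oplus> (\<ominus> c) \<otimes> x \<in> P1" using a u(2) by (intro P1.a_closed P1.I_l_closed) auto
    moreover have "a \<oplus> (\<ominus> c) \<otimes> x = u \<otimes> y [^] i" unfolding u(3) using c u(2) x by algebra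
    ultimately have "y [^] i \<in> P1" using unit_times[OF P1.is_ideal u(1)] by simp
    then have "y \<in> P1"
    proof (induction i)
      case 0 then show ?case using one by simp
    next
      case (Suc i) then show ?case using P1.I_prime[of "y [^] i" y] y by auto
    qed
    then have "nonunits \<subseteq> P1" using \<open>x \<in> P1\<close> unfolding nonunits_def by (auto intro!: P1.a_closed P1.I_l_closed)
    then show False using P1m by simp
  qed
  have "P0 \<subseteq> {\<zero>}"
  proof (rule nakayama_ideal[OF P0.is_ideal zeroideal])
    fix v assume v: "v \<in> P0"
    then obtain c where c: "c \<in> carrier S" "v = c \<otimes> x" using P0x unfolding cgenideal_def by auto
    then have "c \<in> P0" using P0.I_prime[OF c(1) x] v xP0 by auto
    moreover have "v = \<zero> \<oplus> x \<otimes> c" using c x by (simp add: m_comm)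
    ultimately show "\<exists>l\<in>{\<zero>}. \<exists>r\<in>nonunits. \<exists>w\<in>P0. v = l \<oplus> r \<otimes> w" using gens_in_nonunits(1) by blast
  qed
  then show ?thesis using P0.zero_closed by auto
qed

end

lemma krull_dim_chain_le:
  assumes "krull_dim R = enat d" "\<And>i. i \<le> n \<Longrightarrow> primeideal (P i) R" "\<And>i. i < n \<Longrightarrow> P i \<subset> P (Suc i)"
  shows "n \<le> d"
proof -
  have "enat n \<le> krull_dim R" unfolding krull_dim_def by (rule Sup_upper) (use assms(2,3) in blast)
  then show ?thesis using assms(1) by simp
qed

lemma krull_dim_chain_ex:
  assumes "krull_dim R = enat (Suc d)"
  obtains n P where "n \<ge> Suc d" "\<And>i. i \<le> n \<Longrightarrow> primeideal (P i) R" "\<And>i. i < n \<Longrightarrow> P i \<subset> P (Suc i)"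
proof -
  have "\<exists>n P. n \<ge> Suc d \<and> (\<forall>i\<le>n. primeideal (P i) R) \<and> (\<forall>i<n. P i \<subset> P (Suc i))"
  proof (rule ccontr)
    assume "\<not> ?thesis"
    then have "n \<le> d" if "\<forall>i\<le>n. primeideal (P i) R" "\<forall>i<n. P i \<subset> P (Suc i)" for n and P :: "nat \<Rightarrow> 'a set"
      using that by (meson not_less_eq_eq)
    then have "krull_dim R \<le> enat d" unfolding krull_dim_def by (intro Sup_least) auto
    then show False using assms by simp
  qed
  then show ?thesis using that by blast
qed

text \<open>The definition of the dimension provides a chain \<open>P 0 \<subset> P 1 \<subset> P 2\<close> of primes, and \<open>P 1\<close> is smaller
  than the maximal ideal. So \<open>prime_chain_bottom_zero\<close> applies and gives \<open>P 0 = {0}\<close>.\<close>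

lemma regular_local_ring_dim_2:
  fixes S (structure)
  assumes reg: "regular_local_ring S" and dim: "krull_dim S = 2"
  obtains x y where "two_generated_local S x y" "domain S"
    "two_generated_local.nonunits S x y = max_ideal S"
    "\<And>i::nat. y [^] i \<notin> PIdl x" "\<And>i::nat. x [^] i \<notin> PIdl y"
proof -
  have S: "noetherian_ring S" "local_ring S" "embedding_dim S = 2"
    using reg dim by (auto simp: regular_local_ring_def numeral_eq_enat)
  interpret S: cring S using S(2) by (simp add: local_ring_def)
  interpret noetherian_ring S by fact
  note mx = local_ring_units(1)[OF S(1,2)] and un = local_ring_units(2)[OF S(1,2)]
  interpret mx: maximalideal "max_ideal S" S by (rule mx)
  let ?P = "\<lambda>n. \<exists>A \<subseteq> carrier S. finite A \<and> card A = n \<and> Idl A = max_ideal S"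
  have "\<exists>n. ?P n" using finetely_gen[OF mx.is_ideal] by metis
  then have "?P (embedding_dim S)" unfolding embedding_dim_def by (rule LeastI_ex)
  then obtain x y where xy: "x \<in> carrier S" "y \<in> carrier S" "Idl {x, y} = max_ideal S"
    unfolding S(3) by (auto simp: card_2_iff)
  let ?m = "{a \<otimes> x \<oplus> b \<otimes> y | a b. a \<in> carrier S \<and> b \<in> carrier S}"
  have m1: "?m = PIdl x <+>\<^bsub>S\<^esub> PIdl y" unfolding cgenideal_def set_add_def' by blast
  have mi: "ideal ?m S" unfolding m1 by (intro S.add_ideals S.cgenideal_ideal xy)
  have "x = \<one> \<otimes> x \<oplus> \<zero> \<otimes> y" "y = \<zero> \<otimes> x \<oplus> \<one> \<otimes> y" using xy by auto
  then have "{x, y} \<subseteq> ?m" by blast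
  then have mx_m: "max_ideal S \<subseteq> ?m" unfolding xy(3)[symmetric] by (rule S.genideal_minimal[OF mi])
  have xym: "x \<in> max_ideal S" "y \<in> max_ideal S" using S.genideal_self[of "{x,y}"] xy by auto
  have "?m \<subseteq> max_ideal S"
  proof
    fix r assume "r \<in> ?m"
    then obtain a b where ab: "a \<in> carrier S" "b \<in> carrier S" "r = a \<otimes> x \<oplus> b \<otimes> y" by blast
    show "r \<in> max_ideal S" unfolding ab(3)
      by (intro mx.a_closed mx.I_l_closed xym ab)
  qed
  then have m: "?m = max_ideal S" by (intro equalityI mx_m)
  have one: "\<one> \<notin> max_ideal S" using mx.one_imp_carrier mx.I_notcarr by auto
  have tg: "two_generated_local S x y"
  proof (intro two_generated_local.intro two_generated_local_axioms.intro)
    show "r \<in> Units S \<or> (\<exists>a\<in>carrier S. \<exists>b\<in>carrier S. r = a \<otimes> x \<oplus> b \<otimes> y)" if "r \<in> carrier S" for r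
    proof (cases "r \<in> max_ideal S")
      case True
      then show ?thesis unfolding m[symmetric] by auto
    qed (use un[OF that] in auto)
    show "a \<otimes> x \<oplus> b \<otimes> y \<noteq> \<one>" if "a \<in> carrier S" "b \<in> carrier S" for a b
    proof -
      have "a \<otimes> x \<oplus> b \<otimes> y \<in> max_ideal S" unfolding m[symmetric] using that by auto
      then show ?thesis using one by auto
    qed
  qed (use S.is_cring S(1) xy in auto)
  interpret xy: two_generated_local S x y by (rule tg)
  interpret yx: two_generated_local S y x by (rule xy.swap)
  have mm: "xy.nonunits = max_ideal S" using m unfolding xy.nonunits_def .
  have mm': "yx.nonunits = max_ideal S"
    using xy unfolding mm[symmetric] xy.nonunits_def yx.nonunits_def by (metis (lifting) S.a_comm S.m_closed)
  have "krull_dim S = enat (Suc 1)" using dim by (simp add: numeral_eq_enat numeral_2_eq_2)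
  then obtain n P where nP: "n \<ge> Suc 1" "\<And>i. i \<le> n \<Longrightarrow> primeideal (P i) S" "\<And>i. i < n \<Longrightarrow> P i \<subset> P (Suc i)"
    using krull_dim_chain_ex[of S 1] by blast
  have P: "primeideal (P 0) S" "primeideal (P 1) S" "primeideal (P 2) S" "P 0 \<subset> P 1" "P 1 \<subset> P 2"
    using nP(2)[of 0] nP(2)[of 1] nP(2)[of 2] nP(3)[of 0] nP(3)[of 1] nP(1) by (auto simp: numeral_2_eq_2)
  interpret P2: primeideal "P 2" S by (rule P)
  have "P 2 \<subseteq> max_ideal S"
  proof
    fix r assume r: "r \<in> P 2"
    show "r \<in> max_ideal S"
    proof (rule ccontr)
      assume "r \<notin> max_ideal S"
      then have u: "r \<in> Units S" using un r by auto
      have "inv r \<otimes> r \<in> P 2" by (rule P2.I_l_closed[OF r]) (use u in simp)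
      then show False using u P2.one_imp_carrier P2.I_notcarr by auto
    qed
  qed
  then have P1m: "\<not> max_ideal S \<subseteq> P 1" using P(5) by auto
  have P0: "P 0 = {\<zero>}" by (rule xy.prime_chain_bottom_zero[OF P(1,2,4)]) (use P1m mm in simp)
  have dom: "domain S" using S.zeroprimeideal_domainI P(1) P0 by simp
  have "y [^] i \<notin> PIdl x" for i :: nat
  proof -
    have "PIdl x \<subseteq> PIdl x <+>\<^bsub>S\<^esub> P 0"
      unfolding P0 set_add_def' using ideal.Icarr[OF S.cgenideal_ideal[OF xy(1)]] by force
    then show ?thesis using xy.powers_of_y_not_in_x[OF P(1,2,4), of i] P1m mm by auto
  qed
  moreover have "x [^] i \<notin> PIdl y" for i :: nat
  proof -
    have "PIdl y \<subseteq> PIdl y <+>\<^bsub>S\<^esub> P 0"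
      unfolding P0 set_add_def' using ideal.Icarr[OF S.cgenideal_ideal[OF xy(2)]] by force
    then show ?thesis using yx.powers_of_y_not_in_x[OF P(1,2,4), of i] P1m mm' by auto
  qed
  ultimately show ?thesis using that tg dom mm by blast
qed

text \<open>Otherwise some ideal contains \<open>f\<close> and \<open>r\<close> but no power of \<open>s\<close>, and a maximal such ideal \<open>P\<close> is
  prime. Then \<open>{0} \<subset> (f) \<subset> P \<subset> m\<close> is a chain of primes of length three.\<close>

lemma power_in_height_two_ideal:
  fixes S (structure)
  assumes dom: "domain S" and noeth: "noetherian_ring S" and dim: "krull_dim S = 2"
    and m: "maximalideal m S" and un: "\<And>r. r \<in> carrier S \<Longrightarrow> r \<notin> m \<Longrightarrow> r \<in> Units S"
    and f: "f \<in> carrier S" "f \<noteq> \<zero>" "primeideal (PIdl f) S"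
    and r: "r \<in> carrier S" "r \<notin> PIdl f" and s: "s \<in> m"
  obtains k :: nat and a b where "a \<in> carrier S" "b \<in> carrier S" "s [^] k = a \<otimes> f \<oplus> b \<otimes> r"
proof -
  interpret domain S by fact
  interpret m: maximalideal m S by fact
  interpret F: primeideal "PIdl f" S by fact
  have sS: "s \<in> carrier S" using s by auto
  have "\<exists>k::nat. s [^] k \<in> PIdl f <+>\<^bsub>S\<^esub> PIdl r"
  proof (rule ccontr)
    define \<A> where "\<A> = {J. ideal J S \<and> PIdl f <+>\<^bsub>S\<^esub> PIdl r \<subseteq> J \<and> (\<forall>k::nat. s [^] k \<notin> J)}"
    assume "\<not> ?thesis"
    then have "PIdl f <+>\<^bsub>S\<^esub> PIdl r \<in> \<A>" by (auto simp: \<A>_def intro!: add_ideals cgenideal_ideal f r)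
    moreover have \<A>_ideal: "\<And>J. J \<in> \<A> \<Longrightarrow> ideal J S" unfolding \<A>_def by blast
    ultimately obtain P where P: "P \<in> \<A>" "\<And>J. J \<in> \<A> \<Longrightarrow> P \<subseteq> J \<Longrightarrow> J = P"
      using noetherian_maximal[OF noeth, of \<A>] \<A>_ideal by blast
    have P1: "ideal P S" "PIdl f <+>\<^bsub>S\<^esub> PIdl r \<subseteq> P" "\<And>k::nat. s [^] k \<notin> P" using P(1) unfolding \<A>_def by blast+
    interpret P: ideal P S by (rule P1)
    have grow: "\<exists>k::nat. \<exists>p\<in>P. \<exists>c\<in>carrier S. s [^] k = p \<oplus> c \<otimes> a" if a: "a \<in> carrier S" "a \<notin> P" for a
    proof -
      have id: "ideal (P <+>\<^bsub>S\<^esub> PIdl a) S" by (intro add_ideals P.is_ideal cgenideal_ideal a)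
      have "p \<in> P <+>\<^bsub>S\<^esub> PIdl a" if "p \<in> P" for p
      proof -
        have "p = p \<oplus> \<zero> \<otimes> a" using that a by simp
        then show ?thesis using that unfolding set_add_def' cgenideal_def by blast
      qed
      then have sub: "P \<subseteq> P <+>\<^bsub>S\<^esub> PIdl a" by auto
      have "a = \<zero> \<oplus> \<one> \<otimes> a" using a by simp
      then have "a \<in> P <+>\<^bsub>S\<^esub> PIdl a" using P.zero_closed unfolding set_add_def' cgenideal_def by blast
      then have "P <+>\<^bsub>S\<^esub> PIdl a \<notin> \<A>" using P(2)[OF _ sub] a(2) by auto
      then obtain k :: nat where "s [^] k \<in> P <+>\<^bsub>S\<^esub> PIdl a" using id sub P1(2) unfolding \<A>_def by blast
      then show ?thesis unfolding set_add_def' cgenideal_def by blast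
    qed
    have one: "\<one> \<notin> P" using P1(3)[of 0] by simp
    have prime: "primeideal P S"
    proof (rule primeidealI[OF P.is_ideal is_cring])
      show "carrier S \<noteq> P" using one by auto
      fix a b assume ab: "a \<in> carrier S" "b \<in> carrier S" "a \<otimes> b \<in> P"
      show "a \<in> P \<or> b \<in> P"
      proof (rule ccontr)
        assume "\<not> ?thesis"
        then obtain i j p q c d where *: "p \<in> P" "c \<in> carrier S" "s [^] (i::nat) = p \<oplus> c \<otimes> a"
          "q \<in> P" "d \<in> carrier S" "s [^] (j::nat) = q \<oplus> d \<otimes> b" using grow[OF ab(1)] grow[OF ab(2)] by blast
        have c: "p \<in> carrier S" "q \<in> carrier S" using * by auto
        have "s [^] (i + j) = (p \<oplus> c \<otimes> a) \<otimes> (q \<oplus> d \<otimes> b)" using sS *(3,6) by (simp add: nat_pow_mult[symmetric])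
        also have "\<dots> = ((q \<oplus> d \<otimes> b) \<otimes> p \<oplus> (c \<otimes> a) \<otimes> q) \<oplus> (c \<otimes> d) \<otimes> (a \<otimes> b)"
          using c *(2,5) ab(1,2) by algebra
        also have "\<dots> \<in> P" using * c ab by (auto intro!: P.a_closed P.I_l_closed)
        finally show False using P1(3) by simp
      qed
    qed
    have fP: "PIdl f \<subset> P"
    proof
      have "f \<in> PIdl f" "r \<in> PIdl r" by (auto intro: cgenideal_self f r)
      then have *: "f = f \<oplus> \<zero> \<otimes> r" "r = \<zero> \<otimes> f \<oplus> r" using f r by auto
      have "f \<oplus> \<zero> \<otimes> r \<in> PIdl f <+>\<^bsub>S\<^esub> PIdl r"
        using \<open>f \<in> PIdl f\<close> zero_closed unfolding set_add_def' cgenideal_def[of _ r] by blast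
      moreover have "\<zero> \<otimes> f \<oplus> r \<in> PIdl f <+>\<^bsub>S\<^esub> PIdl r"
        using \<open>r \<in> PIdl r\<close> zero_closed unfolding set_add_def' cgenideal_def[of _ f] by blast
      ultimately have "f \<in> PIdl f <+>\<^bsub>S\<^esub> PIdl r" "r \<in> PIdl f <+>\<^bsub>S\<^esub> PIdl r" using * by auto
      then have "f \<in> P" "r \<in> P" using P1(2) by auto
      then show "PIdl f \<subseteq> P" "PIdl f \<noteq> P" using cgenideal_minimal[OF P.is_ideal] r by auto
    qed
    have "P \<subseteq> m"
    proof
      fix r assume r: "r \<in> P"
      show "r \<in> m"
      proof (rule ccontr)
        assume "r \<notin> m"
        then have u: "r \<in> Units S" using un r by auto
        have "inv r \<otimes> r \<in> P" by (rule P.I_l_closed[OF r]) (use u in simp)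
        then show False using u one by simp
      qed
    qed
    moreover have "s \<notin> P" using P1(3)[of 1] sS by simp
    ultimately have Pm: "P \<subset> m" using s by auto
    have mp: "primeideal m S" by (rule maximalideal_prime[OF m])
    have zf: "{\<zero>} \<subset> PIdl f" using F.zero_closed cgenideal_self[OF f(1)] f(2) by auto
    let ?c = "\<lambda>i::nat. if i = 0 then {\<zero>} else if i = 1 then PIdl f else if i = 2 then P else m"
    have "3 \<le> (2::nat)"
    proof (rule krull_dim_chain_le[of S _ _ ?c])
      show "krull_dim S = enat 2" using dim by (simp add: numeral_eq_enat)
      show "primeideal (?c i) S" for i using zeroprimeideal f(3) prime mp by auto
      fix i :: nat assume "i < 3"
      then consider "i = 0" | "i = 1" | "i = 2" by linarith
      then show "?c i \<subset> ?c (Suc i)" using zf fP Pm by cases auto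
    qed
    then show False by simp
  qed
  then show ?thesis using that unfolding set_add_def' cgenideal_def by blast
qed

section \<open>Matrix factorizations\<close>

text \<open>A regular local ring of dimension two with a system of parameters. The quotient by \<open>x\<close> is a discrete
  valuation ring with uniformizer \<open>y\<close>: modulo \<open>x\<close>, every nonzero element is a unit times a power of \<open>y\<close>
  by \<open>valuation_mod_x\<close>, and no power of \<open>y\<close> vanishes.\<close>

locale regular_pair = two_generated_local S x y + dom: domain S for S (structure) and x y +
  assumes x_nonzero: "x \<noteq> \<zero>" and y_power: "y [^] (i::nat) \<notin> PIdl x"
begin

lemma mem_PIdl: "r \<in> PIdl a \<longleftrightarrow> (\<exists>c\<in>carrier S. r = c \<otimes> a)"
  by (auto simp: cgenideal_def)

lemma PIdl_x: "ideal (PIdl x) S"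
  by (rule cgenideal_ideal[OF x])

lemma unit_cancel_mem:
  assumes J: "ideal J S" and u: "u \<in> Units S" and r: "r \<in> carrier S" and ur: "u \<otimes> r \<in> J"
  shows "r \<in> J"
proof -
  have "inv u \<otimes> (u \<otimes> r) \<in> J" by (rule ideal.I_l_closed[OF J ur]) (use u in simp)
  moreover have "inv u \<otimes> (u \<otimes> r) = r" using u Units_closed[OF u] r by (simp add: m_assoc[symmetric])
  ultimately show ?thesis by simp
qed

lemma y_power_cancel:
  assumes c: "c \<in> carrier S" and "c \<otimes> y [^] (e::nat) \<in> PIdl x"
  shows "c \<in> PIdl x"
proof (rule ccontr)
  interpret J: ideal "PIdl x" S by (rule PIdl_x)
  assume "c \<notin> PIdl x"
  then obtain u d and i :: nat where u: "u \<in> Units S" "d \<in> carrier S" "c = u \<otimes> y [^] i \<oplus> d \<otimes> x"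
    using valuation_mod_x[OF c] by blast
  have cl: "u \<in> carrier S" "y [^] i \<in> carrier S" "y [^] e \<in> carrier S" using u y by auto
  have dx: "((\<ominus> d) \<otimes> y [^] e) \<otimes> x \<in> PIdl x" using u(2) cl mem_PIdl by blast
  have "c \<otimes> y [^] e \<oplus> ((\<ominus> d) \<otimes> y [^] e) \<otimes> x \<in> PIdl x" by (rule J.a_closed[OF assms(2) dx])
  moreover have "c \<otimes> y [^] e \<oplus> ((\<ominus> d) \<otimes> y [^] e) \<otimes> x = u \<otimes> (y [^] i \<otimes> y [^] e)"
    unfolding u(3) using cl u(2) x by algebra
  ultimately have "u \<otimes> y [^] (i + e) \<in> PIdl x" using y by (simp add: nat_pow_mult)
  then have "y [^] (i + e) \<in> PIdl x" using unit_cancel_mem[OF PIdl_x u(1)] y by simp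
  then show False using y_power by simp
qed

lemma ideal_above_x:
  assumes J: "ideal J S" and xJ: "x \<in> J" and f: "f \<in> J" "f \<notin> PIdl x"
  obtains e :: nat where "y [^] e \<in> J"
    "\<And>r. r \<in> J \<Longrightarrow> \<exists>a\<in>carrier S. \<exists>b\<in>carrier S. r = a \<otimes> y [^] e \<oplus> b \<otimes> x"
proof -
  interpret J: ideal J S by fact
  have *: "\<exists>u\<in>Units S. \<exists>d\<in>carrier S. \<exists>i::nat. r = u \<otimes> y [^] i \<oplus> d \<otimes> x \<and> y [^] i \<in> J"
    if r: "r \<in> J" "r \<notin> PIdl x" for r
  proof -
    obtain u d and i :: nat where u: "u \<in> Units S" "d \<in> carrier S" "r = u \<otimes> y [^] i \<oplus> d \<otimes> x"
      using valuation_mod_x[of r] r J.Icarr by blast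
    have cl: "u \<in> carrier S" "y [^] i \<in> carrier S" using u y by auto
    have "(\<ominus> d) \<otimes> x \<in> J" by (rule J.I_l_closed[OF xJ]) (use u in simp)
    then have "r \<oplus> (\<ominus> d) \<otimes> x \<in> J" by (rule J.a_closed[OF r(1)])
    moreover have "r \<oplus> (\<ominus> d) \<otimes> x = u \<otimes> y [^] i" unfolding u(3) using cl u(2) x by algebra
    ultimately have "u \<otimes> y [^] i \<in> J" by simp
    then have "y [^] i \<in> J" by (rule unit_cancel_mem[OF J u(1) cl(2)])
    then show ?thesis using u by blast
  qed
  define e where "e = (LEAST i. y [^] (i::nat) \<in> J)"
  have "\<exists>i. y [^] (i::nat) \<in> J" using *[OF f] by blast
  then have e: "y [^] e \<in> J" unfolding e_def by (rule LeastI_ex)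
  show ?thesis
  proof (rule that[OF e])
    fix r assume r: "r \<in> J"
    show "\<exists>a\<in>carrier S. \<exists>b\<in>carrier S. r = a \<otimes> y [^] e \<oplus> b \<otimes> x"
    proof (cases "r \<in> PIdl x")
      case True
      then obtain c where c: "c \<in> carrier S" "r = c \<otimes> x" by (auto simp: mem_PIdl)
      then have "r = \<zero> \<otimes> y [^] e \<oplus> c \<otimes> x" using x y by simp
      then show ?thesis using c by blast
    next
      case False
      from *[OF r this] obtain u d and i :: nat where u: "u \<in> Units S" "d \<in> carrier S" "r = u \<otimes> y [^] i \<oplus> d \<otimes> x" "y [^] i \<in> J"
        by blast
      have "e \<le> i" unfolding e_def by (rule Least_le) (rule u)
      then have "y [^] i = y [^] (i - e) \<otimes> y [^] e" using y by (simp add: nat_pow_mult)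
      then have "r = (u \<otimes> y [^] (i - e)) \<otimes> y [^] e \<oplus> d \<otimes> x" using u y Units_closed[OF u(1)] by (simp add: m_assoc)
      moreover have "u \<otimes> y [^] (i - e) \<in> carrier S" using Units_closed[OF u(1)] y by simp
      ultimately show ?thesis using u(2) by blast
    qed
  qed
qed

lemma linear_map_drop_coordinate:
  assumes "j \<notin> I"
  shows "linear_map S (free_on S (insert j I)) (free_on S I) (\<lambda>u. u(j := \<zero>))"
proof -
  have "finite {xa. xa \<noteq> j \<and> (xa \<noteq> j \<longrightarrow> g xa \<noteq> \<zero>)}" if "finite {xa. g xa \<noteq> \<zero>}" for g :: "'c \<Rightarrow> 'a"
    by (rule finite_subset[OF _ that]) auto
  then show ?thesis unfolding linear_map_def
    by (auto simp: free_on_carrier fun_eq_iff)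
qed

text \<open>The Hermite normal form of \<open>K\<close> over the discrete valuation ring \<open>S/(x)\<close>. The \<open>j\<close>-th coordinates of
  elements of \<open>K\<close> generate, together with \<open>x\<close>, an ideal \<open>(x, y^e)\<close>. It is larger than \<open>(x)\<close> because \<open>K\<close>
  contains \<open>f\<close> times the \<open>j\<close>-th basis vector. An element of \<open>K\<close> with \<open>j\<close>-th coordinate \<open>y^e\<close> modulo \<open>x\<close>
  serves as the \<open>j\<close>-th generator. The elements whose \<open>j\<close>-th coordinate vanishes modulo \<open>x\<close> are treated by
  induction. So there are exactly as many generators as coordinates.\<close>

lemma triangular_generators:
  fixes I :: "'i set"
  assumes "finite I" "submodule K S (free_on S I)" and f: "f \<in> carrier S" "f \<notin> PIdl x"
    and "\<forall>v\<in>carrier (free_on S I). f \<odot>\<^bsub>free_on S I\<^esub> v \<in> K"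
  shows "\<exists>k. k \<in> I \<rightarrow> K \<and>
    (\<forall>v\<in>K. \<exists>c\<in>carrier (free_on S I). \<exists>w\<in>carrier (free_on S I).
        v = (\<lambda>i. lin_ext S (free_on S I) k c i \<oplus> x \<otimes> w i)) \<and>
    (\<forall>c\<in>carrier (free_on S I). (\<forall>i. lin_ext S (free_on S I) k c i \<in> PIdl x) \<longrightarrow> (\<forall>i. c i \<in> PIdl x))"
  using assms(1,2,5)
proof (induction I arbitrary: K)
  case empty
  interpret F: module S "free_on S ({}::'i set)" by (rule free_on_module) (rule is_cring)
  have c0: "carrier (free_on S {}) = {\<lambda>i::'i. \<zero>}" by (auto simp: free_on_carrier fun_eq_iff)
  have K: "K \<subseteq> {\<lambda>i. \<zero>}" using F.submoduleD(1)[OF empty(1)] c0 by auto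
  have "lin_ext S (free_on S ({}::'i set)) k (\<lambda>i. \<zero>) = (\<lambda>i. \<zero>)" for k :: "'i \<Rightarrow> 'i \<Rightarrow> 'a"
    by (simp add: lin_ext_def)
  then show ?case using K ideal.axioms(1)[OF PIdl_x, THEN additive_subgroup.zero_closed] x unfolding c0 by auto
next
  case (insert j I)
  let ?F = "free_on S (insert j I)" and ?F' = "free_on S I"
  have F: "module S ?F" and F': "module S ?F'" and M: "module S (ring_module S)"
    by (auto intro: free_on_module ring_module_module is_cring)
  interpret F: module S ?F by (rule F)
  interpret F': module S ?F' by (rule F')
  interpret M: module S "ring_module S" by (rule M)
  interpret J: ideal "PIdl x" S by (rule PIdl_x)
  note K = F.submoduleD[OF insert.prems(1)]
  let ?\<rho> = "\<lambda>u::'i \<Rightarrow> 'a. u(j := \<zero>)"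
  have \<rho>: "linear_map S ?F ?F' ?\<rho>" by (rule linear_map_drop_coordinate) (rule insert.hyps(2))
  have FF: "carrier ?F' \<subseteq> carrier ?F" by (rule free_on_mono) auto
  have Px: "submodule (PIdl x) S (ring_module S)" using submodule_ring_module_iff[OF is_cring] PIdl_x by simp
  \<comment> \<open>the pivot: an element of \<open>K\<close> whose \<open>j\<close>-th coordinate generates all others modulo \<open>x\<close>\<close>
  let ?J = "(\<lambda>v. v j) ` K <+>\<^bsub>S\<^esub> PIdl x"
  have "submodule ((\<lambda>v. v j) ` K) S (ring_module S)"
    by (rule linear_map_image[OF F M linear_map_coordinate[OF is_cring] insert.prems(1)])
  then have J1: "ideal ((\<lambda>v. v j) ` K) S" using submodule_ring_module_iff[OF is_cring] by simp
  interpret J1: ideal "(\<lambda>v. v j) ` K" S by (rule J1)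
  have J: "ideal ?J S" by (intro add_ideals J1 PIdl_x)
  have xJ: "x \<in> ?J"
    using set_add_memI[OF J1.zero_closed cgenideal_self[OF x], of S] x by simp
  have fJ: "f \<in> ?J"
  proof -
    have "f \<odot>\<^bsub>?F\<^esub> basis_vec S j \<in> K" by (intro insert.prems(2)[rule_format] basis_vec_closed is_cring) auto
    then have "f \<in> (\<lambda>v. v j) ` K" using f(1) by (auto simp: basis_vec_def intro!: image_eqI[rotated])
    then show ?thesis using set_add_memI[OF _ J.zero_closed, of f _ S] f(1) by simp
  qed
  obtain e :: nat where e: "y [^] e \<in> ?J" "\<And>r. r \<in> ?J \<Longrightarrow> \<exists>a\<in>carrier S. \<exists>b\<in>carrier S. r = a \<otimes> y [^] e \<oplus> b \<otimes> x"
    by (rule ideal_above_x[OF J xJ fJ f(2)]) (rule that)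
  have ye: "y [^] e \<in> carrier S" using y by simp
  obtain kj d where kj: "kj \<in> K" "d \<in> carrier S" "y [^] e = kj j \<oplus> d \<otimes> x"
    using e(1) unfolding set_add_def' cgenideal_def by blast
  have kjF: "kj \<in> carrier ?F" by (rule K(1)[OF kj(1)])
  have kjj: "kj j \<in> carrier S" by (rule free_onD(1)[OF kjF])
  \<comment> \<open>to apply the induction hypothesis, the \<open>j\<close>-th coordinate, a multiple of \<open>x\<close>, is replaced by \<open>0\<close>\<close>
  let ?K0 = "{u \<in> K. u j \<in> PIdl x}"
  let ?K' = "?\<rho> ` ?K0"
  have K0: "submodule ?K0 S ?F"
    by (rule linear_map_preimage[OF F M linear_map_coordinate[OF is_cring] Px insert.prems(1)])
  note K0' = F.submoduleD[OF K0]
  have K': "submodule ?K' S ?F'" by (rule linear_map_image[OF F F' \<rho> K0])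
  have fK': "\<forall>v\<in>carrier ?F'. f \<odot>\<^bsub>?F'\<^esub> v \<in> ?K'"
  proof (rule ballI, rule image_eqI)
    fix v assume v: "v \<in> carrier ?F'"
    have vj: "v j = \<zero>" using free_onD(2)[OF v insert.hyps(2)] .
    show "f \<odot>\<^bsub>?F'\<^esub> v = ?\<rho> (f \<odot>\<^bsub>?F\<^esub> v)" using vj f(1) by (auto simp: fun_eq_iff)
    show "f \<odot>\<^bsub>?F\<^esub> v \<in> ?K0" using insert.prems(2)[rule_format, of v] v FF vj f(1) J.zero_closed by auto
  qed
  from insert.IH[OF K' fK'] obtain k' where k'0: "k' \<in> I \<rightarrow> ?K' \<and>
    (\<forall>v\<in>?K'. \<exists>c\<in>carrier ?F'. \<exists>w\<in>carrier ?F'. v = (\<lambda>i. lin_ext S ?F' k' c i \<oplus> x \<otimes> w i)) \<and>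
    (\<forall>c\<in>carrier ?F'. (\<forall>i. lin_ext S ?F' k' c i \<in> PIdl x) \<longrightarrow> (\<forall>i. c i \<in> PIdl x))" by (rule exE)
  note k' = k'0[THEN conjunct1] k'0[THEN conjunct2, THEN conjunct1] k'0[THEN conjunct2, THEN conjunct2]
  have "\<forall>i\<in>I. \<exists>u. u \<in> ?K0 \<and> k' i = ?\<rho> u"
  proof
    fix i assume "i \<in> I"
    then have "k' i \<in> ?K'" by (rule Pi_mem[OF k'(1)])
    then show "\<exists>u. u \<in> ?K0 \<and> k' i = ?\<rho> u" by (auto simp only: image_iff)
  qed
  from bchoice[OF this] obtain k0 where k0: "\<forall>i\<in>I. k0 i \<in> ?K0 \<and> k' i = ?\<rho> (k0 i)" by (rule exE)
  define k where "k = k0(j := kj)"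
  have kI: "k i \<in> ?K0" "k' i = ?\<rho> (k i)" if "i \<in> I" for i
    using that bspec[OF k0 that] insert.hyps(2) by (auto simp: k_def)
  have kK: "k \<in> insert j I \<rightarrow> K" using kI kj by (auto simp: k_def)
  then have kF: "k \<in> insert j I \<rightarrow> carrier ?F" using K(1) by auto
  have k'F: "k' \<in> I \<rightarrow> carrier ?F'" using k'(1) F'.submoduleD(1)[OF K'] by auto
  let ?A = "lin_ext S ?F k" and ?A' = "lin_ext S ?F' k'"
  have A: "linear_map S ?F ?F ?A" by (rule linear_lin_ext[OF F kF])
  have A': "linear_map S ?F' ?F' ?A'" by (rule linear_lin_ext[OF F' k'F])
  have AI: "linear_map S ?F' ?F ?A" using kF by (intro linear_lin_ext[OF F]) auto
  have b: "?A (basis_vec S i) = k i" if "i \<in> insert j I" for i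
    using kF that by (intro lin_ext_basis_vec[OF F]) auto
  have A0: "?A c \<in> ?K0" if "c \<in> carrier ?F'" for c
    by (rule free_linear_map_into[OF is_cring F AI K0 _ that]) (use b kI in auto)
  have \<rho>A: "?\<rho> (?A c) = ?A' c" if "c \<in> carrier ?F'" for c
  proof (rule free_linear_map_eq[OF is_cring F' linear_map_comp[OF AI \<rho>] A' _ that])
    fix i assume i: "i \<in> I"
    then have "?A' (basis_vec S i) = k' i" using k'F by (intro lin_ext_basis_vec[OF F']) auto
    then show "?\<rho> (?A (basis_vec S i)) = ?A' (basis_vec S i)" using b kI i by auto
  qed
  have split: "?A c = (\<lambda>i. c j \<otimes> kj i \<oplus> ?A (?\<rho> c) i)" if c: "c \<in> carrier ?F" for c
  proof -
    have bj: "basis_vec S j \<in> carrier ?F" by (intro basis_vec_closed is_cring) auto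
    have \<rho>c: "?\<rho> c \<in> carrier ?F" using linear_mapD(1)[OF \<rho> c] FF by auto
    have cj: "c j \<in> carrier S" by (rule free_onD(1)[OF c])
    have "c = c j \<odot>\<^bsub>?F\<^esub> basis_vec S j \<oplus>\<^bsub>?F\<^esub> ?\<rho> c"
      using cj free_onD(1)[OF c] by (auto simp: basis_vec_def fun_eq_iff)
    then have "?A c = ?A (c j \<odot>\<^bsub>?F\<^esub> basis_vec S j \<oplus>\<^bsub>?F\<^esub> ?\<rho> c)" by (rule arg_cong)
    also have "\<dots> = ?A (c j \<odot>\<^bsub>?F\<^esub> basis_vec S j) \<oplus>\<^bsub>?F\<^esub> ?A (?\<rho> c)"
      by (rule linear_mapD(2)[OF A F.smult_closed[OF cj bj] \<rho>c])
    also have "?A (c j \<odot>\<^bsub>?F\<^esub> basis_vec S j) = c j \<odot>\<^bsub>?F\<^esub> kj"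
      using linear_mapD(3)[OF A cj bj] b[of j] by (simp add: k_def)
    finally show ?thesis by (simp only: free_on_simps)
  qed
  show ?case
  proof (intro exI[of _ k] conjI ballI impI)
    show "k \<in> insert j I \<rightarrow> K" by (rule kK)
  next
    fix v assume v: "v \<in> K"
    have vF: "v \<in> carrier ?F" by (rule K(1)[OF v])
    note vS = free_onD(1)[OF vF]
    have "v j \<in> ?J" using set_add_memI[OF imageI[OF v, of "\<lambda>v. v j"] J.zero_closed, of S] vS by simp
    then obtain a s where as: "a \<in> carrier S" "s \<in> carrier S" "v j = a \<otimes> y [^] e \<oplus> s \<otimes> x" using e(2) by blast
    define u where "u = v \<oplus>\<^bsub>?F\<^esub> (\<ominus> a) \<odot>\<^bsub>?F\<^esub> kj"
    have uK: "u \<in> K" unfolding u_def by (intro K(3,4) v kj) (use as in simp)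
    have uF: "u \<in> carrier ?F" by (rule K(1)[OF uK])
    note uS = free_onD(1)[OF uF]
    have "u j = (a \<otimes> d \<oplus> s) \<otimes> x"
      unfolding u_def using as(1,2) kj(2) kjj x ye by (simp add: as(3) kj(3)) algebra
    then have uj: "u j \<in> PIdl x" using as kj(2) by (auto simp: mem_PIdl)
    then have "?\<rho> u \<in> ?K'" using uK by auto
    then obtain c w where c: "c \<in> carrier ?F'" and w: "w \<in> carrier ?F'"
      and cw: "?\<rho> u = (\<lambda>i. ?A' c i \<oplus> x \<otimes> w i)" using bspec[OF k'(2)] by blast
    note cS = free_onD(1)[OF c] and wS = free_onD(1)[OF w]
    have Ac: "?A c \<in> carrier ?F" using A0[OF c] K0'(1) by auto
    note AcS = free_onD(1)[OF Ac]
    have "u j \<oplus> (\<ominus> \<one>) \<otimes> ?A c j \<in> PIdl x" using uj A0[OF c] by (intro J.a_closed J.I_l_closed) auto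
    then obtain t where t: "t \<in> carrier S" "u j \<oplus> (\<ominus> \<one>) \<otimes> ?A c j = t \<otimes> x" by (auto simp: mem_PIdl)
    define c1 w1 where "c1 = c(j := a)" and "w1 = w(j := t)"
    have fI: "finite (insert j I)" using insert.hyps by simp
    have c1F: "c1 \<in> carrier ?F" using cS as(1) free_onD(2)[OF c] by (intro free_on_finiteI[OF fI]) (auto simp: c1_def)
    have w1F: "w1 \<in> carrier ?F" using wS t(1) free_onD(2)[OF w] by (intro free_on_finiteI[OF fI]) (auto simp: w1_def)
    have c1: "?\<rho> c1 = c" using free_onD(2)[OF c insert.hyps(2)] by (auto simp: c1_def fun_eq_iff)
    have "v i = ?A c1 i \<oplus> x \<otimes> w1 i" for i
    proof -
      have kji: "kj i \<in> carrier S" by (rule free_onD(1)[OF kjF])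
      have "u i = ?A c i \<oplus> x \<otimes> w1 i"
      proof (cases "i = j")
        case True
        have "u j = (u j \<oplus> (\<ominus> \<one>) \<otimes> ?A c j) \<oplus> ?A c j" using uS[of j] AcS[of j] by algebra
        also have "\<dots> = t \<otimes> x \<oplus> ?A c j" by (simp only: t(2))
        finally show ?thesis using True t(1) AcS[of j] x by (simp add: w1_def m_comm a_comm)
      next
        case False
        have "u i = ?A' c i \<oplus> x \<otimes> w i" using fun_cong[OF cw, of i] False by simp
        moreover have "?A' c i = ?A c i" using fun_cong[OF \<rho>A[OF c], of i] False by simp
        ultimately show ?thesis using False by (simp add: w1_def)
      qed
      moreover have "v i = a \<otimes> kj i \<oplus> u i" unfolding u_def using vS[of i] as(1) kji by (simp, algebra)
      ultimately have "v i = a \<otimes> kj i \<oplus> (?A c i \<oplus> x \<otimes> w1 i)" by simp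
      also have "\<dots> = (a \<otimes> kj i \<oplus> ?A c i) \<oplus> x \<otimes> w1 i"
        using as(1) kji AcS[of i] x free_onD(1)[OF w1F, of i] by (simp add: a_assoc)
      finally show ?thesis using fun_cong[OF split[OF c1F], of i] unfolding c1 by (simp add: c1_def)
    qed
    then show "\<exists>c\<in>carrier ?F. \<exists>w\<in>carrier ?F. v = (\<lambda>i. ?A c i \<oplus> x \<otimes> w i)" using c1F w1F by blast
  next
    fix c assume c: "c \<in> carrier ?F" and Ac: "\<forall>i. ?A c i \<in> PIdl x"
    note cS = free_onD(1)[OF c]
    have \<rho>c: "?\<rho> c \<in> carrier ?F'" by (rule linear_mapD(1)[OF \<rho> c])
    have A\<rho>: "?A (?\<rho> c) \<in> ?K0" by (rule A0[OF \<rho>c])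
    note A\<rho>S = free_onD(1)[OF K0'(1)[OF A\<rho>]]
    have 0: "c j \<otimes> kj j \<oplus> ?A (?\<rho> c) j \<in> PIdl x" using Ac split[OF c] by simp
    have 1: "(\<ominus> \<one>) \<otimes> ?A (?\<rho> c) j \<in> PIdl x" using A\<rho> by (intro J.I_l_closed) auto
    have 2: "(c j \<otimes> d) \<otimes> x \<in> PIdl x" by (intro J.I_l_closed cgenideal_self[OF x] m_closed cS kj(2))
    have "(c j \<otimes> kj j \<oplus> ?A (?\<rho> c) j) \<oplus> (\<ominus> \<one>) \<otimes> ?A (?\<rho> c) j \<oplus> (c j \<otimes> d) \<otimes> x \<in> PIdl x"
      by (rule J.a_closed[OF J.a_closed[OF 0 1] 2])
    moreover have "(c j \<otimes> kj j \<oplus> ?A (?\<rho> c) j) \<oplus> (\<ominus> \<one>) \<otimes> ?A (?\<rho> c) j \<oplus> (c j \<otimes> d) \<otimes> x = c j \<otimes> y [^] e"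
      unfolding kj(3) using cS[of j] kjj A\<rho>S[of j] kj(2) x by algebra
    ultimately have cj: "c j \<in> PIdl x" using y_power_cancel[OF cS] by simp
    have "?A' (?\<rho> c) i' \<in> PIdl x" for i'
    proof (cases "i' = j")
      case True
      then have "?A' (?\<rho> c) i' = \<zero>" using fun_cong[OF \<rho>A[OF \<rho>c], of j] by simp
      then show ?thesis by simp
    next
      case False
      have kji: "kj i' \<in> carrier S" by (rule free_onD(1)[OF kjF])
      have 0: "c j \<otimes> kj i' \<oplus> ?A (?\<rho> c) i' \<in> PIdl x" using Ac split[OF c] by simp
      have "(c j \<otimes> kj i' \<oplus> ?A (?\<rho> c) i') \<oplus> (\<ominus> (kj i')) \<otimes> c j \<in> PIdl x"
        by (rule J.a_closed[OF 0 J.I_l_closed[OF cj a_inv_closed[OF kji]]])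
      moreover have "(c j \<otimes> kj i' \<oplus> ?A (?\<rho> c) i') \<oplus> (\<ominus> (kj i')) \<otimes> c j = ?A (?\<rho> c) i'"
        using cS[of j] kji A\<rho>S[of i'] by algebra
      moreover have "?A' (?\<rho> c) i' = ?A (?\<rho> c) i'" using fun_cong[OF \<rho>A[OF \<rho>c], of i'] False by simp
      ultimately show ?thesis by simp
    qed
    then have "\<forall>i. ?\<rho> c i \<in> PIdl x" using bspec[OF k'(3) \<rho>c] by blast
    then show "\<forall>i. c i \<in> PIdl x" using cj by (metis fun_upd_apply)
  qed
qed

text \<open>The generators from \<open>triangular_generators\<close> generate \<open>K\<close> and are independent modulo \<open>x\<close>. By
  Nakayama's lemma the same holds without reduction modulo \<open>x\<close>: since \<open>x\<close> acts injectively modulo \<open>K\<close>,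
  an element of \<open>K\<close> is a combination of generators plus \<open>x\<close> times an element of \<open>K\<close>; and a relation
  between the generators is \<open>x\<close> times another relation.\<close>

lemma square_presentation:
  fixes I :: "'i set"
  assumes I: "finite I" and K: "submodule K S (free_on S I)" and f: "f \<in> carrier S" "f \<notin> PIdl x"
    and fK: "\<And>v. v \<in> carrier (free_on S I) \<Longrightarrow> f \<odot>\<^bsub>free_on S I\<^esub> v \<in> K"
    and sat: "\<And>v. v \<in> carrier (free_on S I) \<Longrightarrow> x \<odot>\<^bsub>free_on S I\<^esub> v \<in> K \<Longrightarrow> v \<in> K"
  obtains A where "linear_map S (free_on S I) (free_on S I) A" "inj_on A (carrier (free_on S I))"
    "A ` carrier (free_on S I) = K"
proof -
  let ?F = "free_on S I"
  have F: "module S ?F" by (rule free_on_module) (rule is_cring)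
  interpret F: module S ?F by (rule F)
  note K' = F.submoduleD[OF K]
  have "\<forall>v\<in>carrier ?F. f \<odot>\<^bsub>?F\<^esub> v \<in> K" using fK by blast
  from triangular_generators[OF I K f this] obtain k where k0: "k \<in> I \<rightarrow> K \<and>
    (\<forall>v\<in>K. \<exists>c\<in>carrier ?F. \<exists>w\<in>carrier ?F. v = (\<lambda>i. lin_ext S ?F k c i \<oplus> x \<otimes> w i)) \<and>
    (\<forall>c\<in>carrier ?F. (\<forall>i. lin_ext S ?F k c i \<in> PIdl x) \<longrightarrow> (\<forall>i. c i \<in> PIdl x))" by (rule exE)
  note k = k0[THEN conjunct1] k0[THEN conjunct2, THEN conjunct1] k0[THEN conjunct2, THEN conjunct2]
  let ?A = "lin_ext S ?F k"
  have kF: "k \<in> I \<rightarrow> carrier ?F" using k(1) K'(1) by auto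
  have A: "linear_map S ?F ?F ?A" by (rule linear_lin_ext[OF F kF])
  have AK: "?A c \<in> K" if "c \<in> carrier ?F" for c
  proof (rule free_linear_map_into[OF is_cring F A K _ that])
    fix i assume i: "i \<in> I"
    have "?A (basis_vec S i) = k i" by (rule lin_ext_basis_vec[OF F]) (use i kF in auto)
    then show "?A (basis_vec S i) \<in> K" using i k(1) by auto
  qed
  have im: "submodule (?A ` carrier ?F) S ?F" by (rule linear_map_image[OF F F A F.carrier_is_submodule])
  obtain T where T: "T \<subseteq> K" "finite T" "span S ?F T = K"
    using submodule_of_free_finitely_generated[OF is_cring noeth I K] by auto
  have "K \<subseteq> ?A ` carrier ?F"
  proof (rule nakayama_span[OF F nonunits_ideal one_minus_nonunit im T(2) _ T(3)])
    show "T \<subseteq> carrier ?F" using T(1) K'(1) by auto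
    fix v assume v: "v \<in> K"
    obtain c w where c: "c \<in> carrier ?F" and w: "w \<in> carrier ?F" and vcw: "v = (\<lambda>i. ?A c i \<oplus> x \<otimes> w i)"
      using bspec[OF k(2) v] by blast
    have vF: "v = ?A c \<oplus>\<^bsub>?F\<^esub> x \<odot>\<^bsub>?F\<^esub> w" using vcw by simp
    have xw: "x \<odot>\<^bsub>?F\<^esub> w \<in> carrier ?F" by (rule F.smult_closed[OF x w])
    have "x \<odot>\<^bsub>?F\<^esub> w \<oplus>\<^bsub>?F\<^esub> ?A c \<in> K"
      using v vF F.M.a_comm[OF linear_mapD(1)[OF A c] xw] by (simp only:)
    then have "x \<odot>\<^bsub>?F\<^esub> w \<in> K" by (rule F.submodule_add_cancel[OF K xw AK[OF c]])
    then have "w \<in> K" by (rule sat[OF w])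
    then have "x \<odot>\<^bsub>?F\<^esub> w \<in> ideal_smult S ?F nonunits K" by (rule ideal_smultI[OF gens_in_nonunits(1)])
    then show "\<exists>l\<in>?A ` carrier ?F. \<exists>w\<in>ideal_smult S ?F nonunits K. v = l \<oplus>\<^bsub>?F\<^esub> w" using vF c by blast
  qed
  then have AFK: "?A ` carrier ?F = K" using AK by auto
  let ?Z = "{c \<in> carrier ?F. ?A c \<in> {\<zero>\<^bsub>?F\<^esub>}}"
  have Z: "submodule ?Z S ?F" by (rule linear_map_preimage[OF F F A F.submodule_zero F.carrier_is_submodule])
  note Z' = F.submoduleD[OF Z]
  obtain T' where T': "T' \<subseteq> ?Z" "finite T'" "span S ?F T' = ?Z"
    using submodule_of_free_finitely_generated[OF is_cring noeth I Z] by auto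
  have "?Z \<subseteq> {\<zero>\<^bsub>?F\<^esub>}"
  proof (rule nakayama_span[OF F nonunits_ideal one_minus_nonunit F.submodule_zero T'(2) _ T'(3)])
    show "T' \<subseteq> carrier ?F" using T'(1) by auto
    fix c assume "c \<in> ?Z"
    then have c: "c \<in> carrier ?F" "?A c = \<zero>\<^bsub>?F\<^esub>" by auto
    have "\<forall>i. ?A c i \<in> PIdl x"
      using c(2) additive_subgroup.zero_closed[OF ideal.axioms(1)[OF PIdl_x]] by simp
    then have "\<forall>i. c i \<in> PIdl x" using bspec[OF k(3) c(1)] by blast
    then have "\<forall>i. \<exists>t\<in>carrier S. c i = t \<otimes> x" by (simp add: mem_PIdl)
    then obtain t where t: "\<And>i. t i \<in> carrier S" "\<And>i. c i = t i \<otimes> x" by metis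
    have ti: "t i = \<zero>" if "i \<notin> I" for i
      using free_onD(2)[OF c(1) that] t dom.integral[of "t i" x] x x_nonzero by auto
    have tF: "t \<in> carrier ?F" by (rule free_on_finiteI[OF I t(1) ti])
    have ct: "c = x \<odot>\<^bsub>?F\<^esub> t" using t x by (auto simp: fun_eq_iff m_comm)
    have At: "?A t \<in> carrier ?F" by (rule linear_mapD(1)[OF A tF])
    have "x \<odot>\<^bsub>?F\<^esub> ?A t = \<zero>\<^bsub>?F\<^esub>" using linear_mapD(3)[OF A x tF] c(2) ct by simp
    then have "x \<otimes> ?A t i = \<zero>" for i by (simp add: fun_eq_iff)
    then have "?A t i = \<zero>" for i using dom.integral[of x "?A t i"] x x_nonzero free_onD(1)[OF At, of i] by auto
    then have "t \<in> ?Z" using tF by (auto simp: fun_eq_iff)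
    then have "x \<odot>\<^bsub>?F\<^esub> t \<in> ideal_smult S ?F nonunits ?Z" by (rule ideal_smultI[OF gens_in_nonunits(1)])
    moreover have "c = \<zero>\<^bsub>?F\<^esub> \<oplus>\<^bsub>?F\<^esub> x \<odot>\<^bsub>?F\<^esub> t"
      using ct F.smult_closed[OF x tF] by (simp del: free_on_simps)
    ultimately show "\<exists>l\<in>{\<zero>\<^bsub>?F\<^esub>}. \<exists>w\<in>ideal_smult S ?F nonunits ?Z. c = l \<oplus>\<^bsub>?F\<^esub> w" by blast
  qed
  have "inj_on ?A (carrier ?F)"
  proof (rule inj_onI)
    fix c d assume c: "c \<in> carrier ?F" "d \<in> carrier ?F" "?A c = ?A d"
    have "?A (c \<ominus>\<^bsub>?F\<^esub> d) = \<zero>\<^bsub>?F\<^esub>"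
      using linear_map_minus(2)[OF F F A c(1,2)] c(3) linear_mapD(1)[OF A c(2)] by (simp only: a_minus_def F.M.r_neg)
    then have "c \<ominus>\<^bsub>?F\<^esub> d \<in> ?Z" using c by (simp del: free_on_simps)
    then have "c \<ominus>\<^bsub>?F\<^esub> d = \<zero>\<^bsub>?F\<^esub>" using \<open>?Z \<subseteq> {\<zero>\<^bsub>?F\<^esub>}\<close> by blast
    then have "(c \<ominus>\<^bsub>?F\<^esub> d) \<oplus>\<^bsub>?F\<^esub> d = \<zero>\<^bsub>?F\<^esub> \<oplus>\<^bsub>?F\<^esub> d" by (rule arg_cong)
    then show "c = d" using c F.minus_add_cancel[OF c(1,2)] by (simp del: free_on_simps)
  qed
  then show ?thesis using that A AFK by blast
qed

text \<open>The columns of \<open>A\<close> form a basis of \<open>K\<close>, and \<open>B v\<close> is the coordinate vector of the element \<open>f v\<close> of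
  \<open>K\<close> in this basis.\<close>

lemma matrix_factorization:
  fixes I :: "'i set"
  assumes I: "finite I" and K: "submodule K S (free_on S I)" and f: "f \<in> carrier S" "f \<notin> PIdl x"
    and fK: "\<And>v. v \<in> carrier (free_on S I) \<Longrightarrow> f \<odot>\<^bsub>free_on S I\<^esub> v \<in> K"
    and sat: "\<And>v. v \<in> carrier (free_on S I) \<Longrightarrow> x \<odot>\<^bsub>free_on S I\<^esub> v \<in> K \<Longrightarrow> v \<in> K"
  obtains A B where "linear_map S (free_on S I) (free_on S I) A" "linear_map S (free_on S I) (free_on S I) B"
    "A ` carrier (free_on S I) = K"
    "\<And>v. v \<in> carrier (free_on S I) \<Longrightarrow> A (B v) = f \<odot>\<^bsub>free_on S I\<^esub> v"
    "\<And>v. v \<in> carrier (free_on S I) \<Longrightarrow> B (A v) = f \<odot>\<^bsub>free_on S I\<^esub> v"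
proof -
  let ?F = "free_on S I"
  have F: "module S ?F" by (rule free_on_module) (rule is_cring)
  interpret F: module S ?F by (rule F)
  obtain A where A: "linear_map S ?F ?F A" and inj: "inj_on A (carrier ?F)" and AK: "A ` carrier ?F = K"
    by (rule square_presentation[OF I K f fK sat])
  note A' = linear_mapD[OF A]
  define B where "B v = inv_into (carrier ?F) A (f \<odot>\<^bsub>?F\<^esub> v)" for v
  have BF: "B v \<in> carrier ?F" and AB: "A (B v) = f \<odot>\<^bsub>?F\<^esub> v" if "v \<in> carrier ?F" for v
  proof -
    have *: "f \<odot>\<^bsub>?F\<^esub> v \<in> A ` carrier ?F" unfolding AK by (rule fK[OF that])
    show "B v \<in> carrier ?F" "A (B v) = f \<odot>\<^bsub>?F\<^esub> v"
      unfolding B_def by (rule inv_into_into[OF *]) (rule f_inv_into_f[OF *])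
  qed
  have eq: "v = w" if "v \<in> carrier ?F" "w \<in> carrier ?F" "A v = A w" for v w using inj that by (auto dest: inj_onD)
  have B: "linear_map S ?F ?F B" unfolding linear_map_def
  proof (intro conjI ballI)
    show "B \<in> carrier ?F \<rightarrow> carrier ?F" using BF by auto
  next
    fix v w assume v: "v \<in> carrier ?F" and w: "w \<in> carrier ?F"
    show "B (v \<oplus>\<^bsub>?F\<^esub> w) = B v \<oplus>\<^bsub>?F\<^esub> B w"
      by (rule eq) (use v w f BF A' AB in \<open>simp_all add: F.smult_r_distr del: free_on_simps\<close>)
  next
    fix r v assume v: "v \<in> carrier ?F" and r: "r \<in> carrier S"
    show "B (r \<odot>\<^bsub>?F\<^esub> v) = r \<odot>\<^bsub>?F\<^esub> B v"
      by (rule eq) (use v r f BF A' AB in \<open>simp_all add: F.smult_assoc1[symmetric] m_comm del: free_on_simps\<close>)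
  qed
  have "B (A v) = f \<odot>\<^bsub>?F\<^esub> v" if v: "v \<in> carrier ?F" for v
    by (rule eq) (use v f BF A' AB in \<open>simp_all del: free_on_simps\<close>)
  then show ?thesis using that A B AK AB by blast
qed

end

section \<open>Vanishing of Ext\<close>

lemma linear_map_add:
  assumes "module R M" "module R N" "linear_map R M N h" "linear_map R M N k"
  shows "linear_map R M N (\<lambda>x. h x \<oplus>\<^bsub>N\<^esub> k x)"
proof -
  interpret N: module R N by fact
  interpret M: module R M by fact
  show ?thesis using linear_mapD[OF assms(3)] linear_mapD[OF assms(4)]
    unfolding linear_map_def by (auto simp: N.M.a_ac N.smult_r_distr)
qed

lemma linear_map_smult:
  assumes "module R M" "module R N" "linear_map R M N h" "s \<in> carrier R"
  shows "linear_map R M N (\<lambda>x. s \<odot>\<^bsub>N\<^esub> h x)"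
proof -
  interpret N: module R N by fact
  interpret M: module R M by fact
  show ?thesis using linear_mapD[OF assms(3)] assms(4)
    unfolding linear_map_def by (auto simp: N.smult_r_distr N.smult_assoc1[symmetric] N.R.m_comm)
qed

lemma linear_map_diff:
  assumes "module R M" "module R N" "linear_map R M N h" "linear_map R M N k"
  shows "linear_map R M N (\<lambda>x. h x \<ominus>\<^bsub>N\<^esub> k x)"
proof -
  interpret N: module R N by fact
  interpret M: module R M by fact
  have "linear_map R M N (\<lambda>x. h x \<oplus>\<^bsub>N\<^esub> (\<ominus>\<^bsub>R\<^esub> \<one>\<^bsub>R\<^esub>) \<odot>\<^bsub>N\<^esub> k x)"
    by (intro linear_map_add linear_map_smult assms) auto
  then show ?thesis
    by (rule linear_map_cong[OF assms(1)])
      (simp add: a_minus_def N.minus_eq_smult linear_mapD(1)[OF assms(4)])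
qed

lemma linear_map_zero_map: "module R M \<Longrightarrow> module R N \<Longrightarrow> linear_map R M N (\<lambda>x. \<zero>\<^bsub>N\<^esub>)"
proof -
  assume "module R M" and N: "module R N"
  interpret N: module R N by (rule N)
  show ?thesis by (auto simp: linear_map_def)
qed

lemma linear_map_id: "linear_map R M M (\<lambda>x. x)"
  by (auto simp: linear_map_def)

lemma linear_map_free_on_mono:
  "linear_map R (free_on R A) N h \<Longrightarrow> B \<subseteq> A \<Longrightarrow> linear_map R (free_on R B) N h"
  using free_on_mono[of B A R] unfolding linear_map_def by (auto simp: subset_iff Pi_iff)

lemma relations_submodule:
  assumes "module R M" "B \<subseteq> carrier M"
  shows "submodule (relations R M B) R (free_on R B)"
proof -
  interpret module R M by fact
  have F: "module R (free_on R B)" by (rule free_on_module) (rule R.is_cring)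
  interpret F: module R "free_on R B" by (rule F)
  have "relations R M B = {g \<in> carrier (free_on R B). lincomb R M g \<in> {\<zero>\<^bsub>M\<^esub>}}" by (auto simp: relations_def)
  then show ?thesis
    using linear_map_preimage[OF F assms(1) linear_lincomb[OF assms] submodule_zero F.carrier_is_submodule] by simp
qed

lemma Ext1_trivial_iff_cocycles:
  assumes "module R M" "module R N"
  shows "trivial_group (Ext1 R M N) \<longleftrightarrow> Ext1_cocycles R M N \<subseteq> Ext1_coboundaries R M N"
proof -
  define G where "G = \<lparr>carrier = Ext1_cocycles R M N,
      monoid.mult = (\<lambda>h k. \<lambda>z \<in> carrier (res1 R M). h z \<oplus>\<^bsub>N\<^esub> k z),
      one = (\<lambda>z \<in> carrier (res1 R M). \<zero>\<^bsub>N\<^esub>)\<rparr>"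
  let ?H = "Ext1_coboundaries R M N"
  have G: "comm_group G" and H: "subgroup ?H G" unfolding G_def by (rule Ext1_group[OF assms])+
  interpret G: comm_group G by (rule G)
  interpret H: subgroup ?H G by (rule H)
  have E: "Ext1 R M N = G Mod ?H" by (simp add: Ext1_def G_def)
  have grp: "group (G Mod ?H)" using G.abelian_FactGroup[OF H] by (simp add: comm_group.axioms(2))
  have c: "carrier G = Ext1_cocycles R M N" by (simp add: G_def)
  show ?thesis
  proof
    assume "trivial_group (Ext1 R M N)"
    then have t: "rcosets\<^bsub>G\<^esub> ?H = {?H}" unfolding E trivial_group_def by (simp add: FactGroup_def)
    show "Ext1_cocycles R M N \<subseteq> ?H"
    proof
      fix h assume h: "h \<in> Ext1_cocycles R M N"
      then have hG: "h \<in> carrier G" by (simp add: c)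
      have "?H #>\<^bsub>G\<^esub> h \<in> rcosets\<^bsub>G\<^esub> ?H" using hG by (auto simp: RCOSETS_def)
      then have "?H #>\<^bsub>G\<^esub> h = ?H" using t by simp
      moreover have "h \<in> ?H #>\<^bsub>G\<^esub> h" by (rule G.rcos_self[OF hG H])
      ultimately show "h \<in> ?H" by simp
    qed
  next
    assume "Ext1_cocycles R M N \<subseteq> ?H"
    then have "carrier G \<subseteq> ?H" by (simp add: c)
    then have "?H #>\<^bsub>G\<^esub> h = ?H" if "h \<in> carrier G" for h using G.coset_join2[OF that H] that by auto
    then have "rcosets\<^bsub>G\<^esub> ?H = {?H}" using G.one_closed by (auto simp: RCOSETS_def)
    then show "trivial_group (Ext1 R M N)" unfolding E trivial_group_def using grp by (simp add: FactGroup_def)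
  qed
qed

text \<open>The canonical resolution uses all elements of \<open>M\<close> as generators, and for it the criterion is the
  definition of Ext. The canonical free module retracts onto the free module on \<open>B\<close> by a map \<open>\<rho>\<close> that is
  compatible with the maps to \<open>M\<close>. Hence \<open>v\<close> and \<open>\<rho> v\<close> differ by a relation, which is how an extension
  from the relations on \<open>B\<close> yields one from all relations.\<close>

lemma Ext1_trivial_iff:
  fixes M :: "('a, 'm) module" and N :: "('a, 'n) module"
  assumes M: "module R M" and N: "module R N" and B: "B \<subseteq> carrier M" and gen: "span R M B = carrier M"
  shows "trivial_group (Ext1 R M N) \<longleftrightarrow>
    (\<forall>\<phi>. linear_map R (free_on R B\<lparr>carrier := relations R M B\<rparr>) N \<phi> \<longrightarrow>
      (\<exists>k. linear_map R (free_on R B) N k \<and> (\<forall>v\<in>relations R M B. k v = \<phi> v)))"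
proof -
  interpret M: module R M by fact
  interpret N: module R N by fact
  have R: "cring R" by (rule M.R.is_cring)
  let ?G = "free_on R B" and ?F0 = "res0 R M" and ?F1 = "res1 R M" and ?F2 = "res2 R M"
  let ?K = "relations R M (carrier M)" and ?N0 = "relations R M B"
  have G: "module R ?G" by (rule free_on_module[OF R])
  have F0: "module R ?F0" unfolding res0_def by (rule free_on_module[OF R])
  have F1: "module R ?F1" unfolding res1_def by (rule free_on_module[OF R])
  have F2: "module R ?F2" unfolding res2_def by (rule free_on_module[OF R])
  interpret G: module R ?G by (rule G)
  interpret F0: module R ?F0 by (rule F0)
  interpret F1: module R ?F1 by (rule F1)
  let ?p = "lincomb R M" and ?d1 = "lincomb R ?F0" and ?d2 = "lincomb R ?F1"
  have p: "linear_map R ?F0 M ?p" unfolding res0_def by (rule linear_lincomb[OF M]) simp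
  have pG: "linear_map R ?G M ?p" by (rule linear_lincomb[OF M B])
  have K: "submodule ?K R ?F0" unfolding res0_def by (rule relations_submodule[OF M]) simp
  note K' = F0.submoduleD[OF K]
  have KF0: "?K \<subseteq> carrier ?F0" using K'(1) by auto
  have KM: "module R (?F0\<lparr>carrier := ?K\<rparr>)" by (rule submodule.submodule_is_module[OF K F0])
  have d1: "linear_map R ?F1 ?F0 ?d1" unfolding res1_def by (rule linear_lincomb[OF F0 KF0])
  have d1e: "?d1 (basis_vec R v) = v" and ev: "basis_vec R v \<in> carrier ?F1" if "v \<in> ?K" for v
    using that KF0 unfolding res1_def by (auto intro!: lincomb_basis_vec[OF F0] basis_vec_closed[OF R])
  have d1K: "?d1 z \<in> ?K" if "z \<in> carrier ?F1" for z
    by (rule free_linear_map_into[OF R F0 d1[unfolded res1_def] K _ that[unfolded res1_def]]) (simp add: d1e)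
  let ?K1 = "relations R ?F0 ?K"
  have K1: "?K1 \<subseteq> carrier ?F1" by (auto simp: relations_def res1_def)
  have d2: "linear_map R ?F2 ?F1 ?d2" unfolding res2_def by (rule linear_lincomb[OF F1 K1])
  have d2e: "?d2 (basis_vec R w) = w" and ew: "basis_vec R w \<in> carrier ?F2" if "w \<in> ?K1" for w
    using that K1 unfolding res2_def by (auto intro!: lincomb_basis_vec[OF F1] basis_vec_closed[OF R])
  have d1d2: "?d1 (?d2 z) = \<zero>\<^bsub>?F0\<^esub>" if "z \<in> carrier ?F2" for z
  proof -
    have z: "z \<in> carrier (free_on R ?K1)" using that by (simp add: res2_def)
    show ?thesis
    proof (rule free_linear_map_eq[OF R F0 linear_map_comp[OF d2 d1, unfolded res2_def] linear_map_zero_map[OF free_on_module[OF R] F0] _ z])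
      fix w assume w: "w \<in> ?K1"
      then show "?d1 (?d2 (basis_vec R w)) = \<zero>\<^bsub>?F0\<^esub>" using d2e by (auto simp: relations_def)
    qed
  qed
  \<comment> \<open>\<open>s\<close> expresses every element in the generators \<open>B\<close>; it sends \<open>B\<close> to basis vectors, so \<open>\<rho>\<close> below is a retraction\<close>
  have "\<forall>m\<in>carrier M. \<exists>g. g \<in> carrier ?G \<and> ?p g = m \<and> (m \<in> B \<longrightarrow> g = basis_vec R m)"
  proof
    fix m assume m: "m \<in> carrier M"
    show "\<exists>g. g \<in> carrier ?G \<and> ?p g = m \<and> (m \<in> B \<longrightarrow> g = basis_vec R m)"
    proof (cases "m \<in> B")
      case True
      have "basis_vec R m \<in> carrier ?G" by (rule basis_vec_closed[OF R True])
      then show ?thesis using lincomb_basis_vec[OF M m] by (intro exI[of _ "basis_vec R m"]) simp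
    next
      case False
      have "m \<in> ?p ` carrier ?G" using lincomb_image[OF M B] gen m by simp
      then obtain g where "m = ?p g" "g \<in> carrier ?G" by (rule imageE)
      then show ?thesis using False by (intro exI[of _ g]) simp
    qed
  qed
  from bchoice[OF this] obtain s where
    s0: "\<forall>m\<in>carrier M. s m \<in> carrier ?G \<and> ?p (s m) = m \<and> (m \<in> B \<longrightarrow> s m = basis_vec R m)" by (rule exE)
  have s: "\<And>m. m \<in> carrier M \<Longrightarrow> s m \<in> carrier ?G" "\<And>m. m \<in> carrier M \<Longrightarrow> ?p (s m) = m"
      "\<And>m. m \<in> B \<Longrightarrow> s m = basis_vec R m" using B by (simp_all add: bspec[OF s0] subset_iff)
  let ?\<rho> = "lin_ext R ?G s"
  have \<rho>: "linear_map R ?F0 ?G ?\<rho>" unfolding res0_def by (rule linear_lin_ext[OF G]) (use s in auto)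
  have \<rho>e: "?\<rho> (basis_vec R m) = s m" if "m \<in> carrier M" for m by (rule lin_ext_basis_vec[OF G]) (rule s(1)[OF that])
  have p\<rho>: "?p (?\<rho> v) = ?p v" if "v \<in> carrier ?F0" for v
  proof (rule free_linear_map_eq[OF R M linear_map_comp[OF \<rho> pG, unfolded res0_def] p[unfolded res0_def] _ that[unfolded res0_def]])
    fix m assume "m \<in> carrier M"
    then show "?p (?\<rho> (basis_vec R m)) = ?p (basis_vec R m)" using \<rho>e s lincomb_basis_vec[OF M] by simp
  qed
  have \<rho>id: "?\<rho> v = v" if "v \<in> carrier ?G" for v
  proof (rule free_linear_map_eq[OF R G _ linear_map_id _ that])
    show "linear_map R ?G ?G ?\<rho>" using \<rho> B unfolding res0_def by (rule linear_map_free_on_mono)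
    show "?\<rho> (basis_vec R b) = basis_vec R b" if "b \<in> B" for b using \<rho>e s(3)[OF that] that B by auto
  qed
  have GF0: "carrier ?G \<subseteq> carrier ?F0" unfolding res0_def by (rule free_on_mono[OF B])
  have N0K: "?N0 \<subseteq> ?K" using GF0 by (auto simp: relations_def res0_def)
  have \<rho>N0: "?\<rho> v \<in> ?N0" if "v \<in> ?K" for v
    using that p\<rho> KF0 linear_mapD(1)[OF \<rho>] by (auto simp: relations_def)
  have N0G: "?N0 \<subseteq> carrier ?G" by (auto simp: relations_def)
  show ?thesis unfolding Ext1_trivial_iff_cocycles[OF M N]
  proof (intro iffI allI impI)
    fix \<phi> assume sub: "Ext1_cocycles R M N \<subseteq> Ext1_coboundaries R M N"
      and \<phi>: "linear_map R (?G\<lparr>carrier := ?N0\<rparr>) N \<phi>"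
    have "linear_map R ?F1 (?G\<lparr>carrier := ?N0\<rparr>) (\<lambda>z. ?\<rho> (?d1 z))"
      by (rule linear_map_into[OF linear_map_comp[OF d1 \<rho>]]) (use \<rho>N0 d1K in auto)
    then have h: "linear_map R ?F1 N (\<lambda>z. \<phi> (?\<rho> (?d1 z)))" by (rule linear_map_comp[OF _ \<phi>])
    let ?h = "restrict (\<lambda>z. \<phi> (?\<rho> (?d1 z))) (carrier ?F1)"
    have "\<phi> (?\<rho> (?d1 (?d2 z))) = \<zero>\<^bsub>N\<^esub>" if "z \<in> carrier ?F2" for z
    proof -
      have "?\<rho> \<zero>\<^bsub>?F0\<^esub> = \<zero>\<^bsub>?G\<^esub>" by (rule linear_map_zero[OF F0 G \<rho>])
      moreover have "\<phi> \<zero>\<^bsub>?G\<^esub> = \<zero>\<^bsub>N\<^esub>"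
        using linear_map_zero[OF submodule.submodule_is_module[OF relations_submodule[OF M B] G] N \<phi>] by simp
      ultimately show ?thesis using d1d2[OF that] by simp
    qed
    then have "?h \<in> Ext1_cocycles R M N"
      using restrict_module_hom[OF F1 h] linear_mapD(1)[OF d2] by (auto simp: Ext1_cocycles_def)
    then have "?h \<in> Ext1_coboundaries R M N" using sub by auto
    then obtain k where k: "k \<in> module_hom R ?F0 N" "?h = restrict (\<lambda>z. k (?d1 z)) (carrier ?F1)"
      by (auto simp: Ext1_coboundaries_def)
    have "k v = \<phi> v" if v: "v \<in> ?N0" for v
    proof -
      have vK: "v \<in> ?K" using v N0K by auto
      have "?h (basis_vec R v) = k (?d1 (basis_vec R v))" using ev[OF vK] k(2) by simp
      then show ?thesis using ev[OF vK] d1e[OF vK] \<rho>id v N0G by auto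
    qed
    moreover have "linear_map R ?G N k"
      using k(1) B unfolding module_hom_iff res0_def by (auto intro: linear_map_free_on_mono)
    ultimately show "\<exists>k. linear_map R ?G N k \<and> (\<forall>v\<in>?N0. k v = \<phi> v)" by blast
  next
    assume ext: "\<forall>\<phi>. linear_map R (?G\<lparr>carrier := ?N0\<rparr>) N \<phi> \<longrightarrow>
        (\<exists>k. linear_map R ?G N k \<and> (\<forall>v\<in>?N0. k v = \<phi> v))"
    show "Ext1_cocycles R M N \<subseteq> Ext1_coboundaries R M N"
    proof
      fix h assume h: "h \<in> Ext1_cocycles R M N"
      then have hl: "linear_map R ?F1 N h" and he: "h \<in> extensional (carrier ?F1)"
        and h0: "\<And>z. z \<in> carrier ?F2 \<Longrightarrow> h (?d2 z) = \<zero>\<^bsub>N\<^esub>" by (auto simp: Ext1_cocycles_def module_hom_iff)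
      note h' = linear_mapD[OF hl]
      have hd: "h z = h z'" if "z \<in> carrier ?F1" "z' \<in> carrier ?F1" "?d1 z = ?d1 z'" for z z'
      proof -
        let ?w = "z \<ominus>\<^bsub>?F1\<^esub> z'"
        have wF1: "?w \<in> carrier ?F1" using that by simp
        have "?d1 ?w = \<zero>\<^bsub>?F0\<^esub>"
          using linear_map_minus(2)[OF F1 F0 d1 that(1,2)] that(3) linear_mapD(1)[OF d1 that(2)]
          by (simp only: a_minus_def F0.M.r_neg)
        then have w: "?w \<in> ?K1" using wF1 by (simp add: relations_def res1_def)
        have "h ?w = \<zero>\<^bsub>N\<^esub>" using h0[OF ew[OF w]] d2e[OF w] by simp
        moreover have "h ?w = h z \<ominus>\<^bsub>N\<^esub> h z'" by (rule linear_map_minus(2)[OF F1 N hl that(1,2)])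
        ultimately have "h z \<ominus>\<^bsub>N\<^esub> h z' = \<zero>\<^bsub>N\<^esub>" by simp
        then have "(h z \<ominus>\<^bsub>N\<^esub> h z') \<oplus>\<^bsub>N\<^esub> h z' = \<zero>\<^bsub>N\<^esub> \<oplus>\<^bsub>N\<^esub> h z'" by simp
        then show ?thesis using N.minus_add_cancel[OF h'(1)[OF that(1)] h'(1)[OF that(2)]] h'(1)[OF that(2)] by simp
      qed
      let ?\<phi> = "\<lambda>v. h (basis_vec R v)"
      have \<phi>d: "h z = ?\<phi> (?d1 z)" if "z \<in> carrier ?F1" for z
        by (rule hd[OF that ev[OF d1K[OF that]]]) (rule d1e[OF d1K[OF that], symmetric])
      have \<phi>: "linear_map R (?F0\<lparr>carrier := ?K\<rparr>) N ?\<phi>" unfolding linear_map_def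
      proof (intro conjI ballI)
        show "?\<phi> \<in> carrier (?F0\<lparr>carrier := ?K\<rparr>) \<rightarrow> carrier N" using ev h'(1) by auto
      next
        fix v w assume "v \<in> carrier (?F0\<lparr>carrier := ?K\<rparr>)" "w \<in> carrier (?F0\<lparr>carrier := ?K\<rparr>)"
        then have vw: "v \<in> ?K" "w \<in> ?K" by auto
        have "h (basis_vec R v \<oplus>\<^bsub>?F1\<^esub> basis_vec R w) = ?\<phi> (?d1 (basis_vec R v \<oplus>\<^bsub>?F1\<^esub> basis_vec R w))"
          by (rule \<phi>d) (use ev vw in blast)
        also have "?d1 (basis_vec R v \<oplus>\<^bsub>?F1\<^esub> basis_vec R w) = v \<oplus>\<^bsub>?F0\<^esub> w"
          using linear_mapD(2)[OF d1 ev[OF vw(1)] ev[OF vw(2)]] d1e vw by simp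
        finally show "?\<phi> (v \<oplus>\<^bsub>?F0\<lparr>carrier := ?K\<rparr>\<^esub> w) = ?\<phi> v \<oplus>\<^bsub>N\<^esub> ?\<phi> w"
          using h'(2)[OF ev[OF vw(1)] ev[OF vw(2)]] by simp
      next
        fix r v assume r: "r \<in> carrier R" and "v \<in> carrier (?F0\<lparr>carrier := ?K\<rparr>)"
        then have v: "v \<in> ?K" by auto
        have "h (r \<odot>\<^bsub>?F1\<^esub> basis_vec R v) = ?\<phi> (?d1 (r \<odot>\<^bsub>?F1\<^esub> basis_vec R v))"
          by (rule \<phi>d) (use ev v r in blast)
        also have "?d1 (r \<odot>\<^bsub>?F1\<^esub> basis_vec R v) = r \<odot>\<^bsub>?F0\<^esub> v"
          using linear_mapD(3)[OF d1 r ev[OF v]] d1e v by simp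
        finally show "?\<phi> (r \<odot>\<^bsub>?F0\<lparr>carrier := ?K\<rparr>\<^esub> v) = r \<odot>\<^bsub>N\<^esub> ?\<phi> v"
          using h'(3)[OF r ev[OF v]] by simp
      qed
      have "linear_map R (?G\<lparr>carrier := ?N0\<rparr>) N ?\<phi>"
        using \<phi> N0K unfolding linear_map_def by (auto simp: res0_def subset_iff Pi_iff)
      then obtain k where k: "linear_map R ?G N k" "\<And>v. v \<in> ?N0 \<Longrightarrow> k v = ?\<phi> v" using ext by blast
      have \<rho>0: "linear_map R ?F0 ?F0 ?\<rho>" using \<rho> GF0 by (auto simp: linear_map_def Pi_iff res0_def)
      have "linear_map R ?F0 ?F0 (\<lambda>v. v \<ominus>\<^bsub>?F0\<^esub> ?\<rho> v)" by (rule linear_map_diff[OF F0 F0 linear_map_id \<rho>0])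
      moreover have "v \<ominus>\<^bsub>?F0\<^esub> ?\<rho> v \<in> ?K" if v: "v \<in> carrier ?F0" for v
      proof -
        have c: "?\<rho> v \<in> carrier ?F0" by (rule linear_mapD(1)[OF \<rho>0 v])
        have "?p (v \<ominus>\<^bsub>?F0\<^esub> ?\<rho> v) = \<zero>\<^bsub>M\<^esub>"
          using linear_map_minus(2)[OF F0 M p v c] p\<rho>[OF v] linear_mapD(1)[OF p v]
          by (simp only: a_minus_def M.M.r_neg)
        moreover have "v \<ominus>\<^bsub>?F0\<^esub> ?\<rho> v \<in> carrier ?F0" by (rule F0.M.minus_closed[OF v c])
        ultimately show ?thesis unfolding relations_def res0_def[symmetric] by blast
      qed
      ultimately have "linear_map R ?F0 (?F0\<lparr>carrier := ?K\<rparr>) (\<lambda>v. v \<ominus>\<^bsub>?F0\<^esub> ?\<rho> v)"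
        by (intro linear_map_into) auto
      then have k': "linear_map R ?F0 N (\<lambda>v. k (?\<rho> v) \<oplus>\<^bsub>N\<^esub> ?\<phi> (v \<ominus>\<^bsub>?F0\<^esub> ?\<rho> v))" (is "linear_map R ?F0 N ?k")
        by (intro linear_map_add[OF F0 N] linear_map_comp[OF \<rho> k(1)] linear_map_comp[OF _ \<phi>])
      have kK: "?k v = ?\<phi> v" if v: "v \<in> ?K" for v
      proof -
        have r: "?\<rho> v \<in> ?N0" by (rule \<rho>N0[OF v])
        then have rK: "?\<rho> v \<in> ?K" using N0K by auto
        have dK: "v \<ominus>\<^bsub>?F0\<^esub> ?\<rho> v \<in> ?K" by (rule K'(6)[OF v rK])
        have c: "v \<in> carrier ?F0" "?\<rho> v \<in> carrier ?F0" using v rK KF0 by auto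
        have "?k v = ?\<phi> (?\<rho> v) \<oplus>\<^bsub>N\<^esub> ?\<phi> (v \<ominus>\<^bsub>?F0\<^esub> ?\<rho> v)" using k(2)[OF r] by simp
        also have "\<dots> = ?\<phi> (v \<ominus>\<^bsub>?F0\<^esub> ?\<rho> v) \<oplus>\<^bsub>N\<^esub> ?\<phi> (?\<rho> v)" 
          by (rule N.M.a_comm) (use ev[OF rK] ev[OF dK] h'(1) in auto)
        also have "\<dots> = ?\<phi> ((v \<ominus>\<^bsub>?F0\<^esub> ?\<rho> v) \<oplus>\<^bsub>?F0\<^esub> ?\<rho> v)" using linear_mapD(2)[OF \<phi>, of "v \<ominus>\<^bsub>?F0\<^esub> ?\<rho> v" "?\<rho> v"] dK rK by simp
        also have "(v \<ominus>\<^bsub>?F0\<^esub> ?\<rho> v) \<oplus>\<^bsub>?F0\<^esub> ?\<rho> v = v" by (rule F0.minus_add_cancel[OF c])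
        finally show ?thesis .
      qed
      let ?k' = "restrict ?k (carrier ?F0)"
      have "h = restrict (\<lambda>z. ?k' (?d1 z)) (carrier ?F1)"
      proof
        fix z
        show "h z = restrict (\<lambda>z. ?k' (?d1 z)) (carrier ?F1) z"
        proof (cases "z \<in> carrier ?F1")
          case True
          then show ?thesis using \<phi>d[OF True] kK[OF d1K[OF True]] linear_mapD(1)[OF d1 True] by simp
        next
          case False
          then show ?thesis using he by (simp add: extensional_def)
        qed
      qed
      moreover have "?k' \<in> module_hom R ?F0 N" by (rule restrict_module_hom[OF F0 k'])
      ultimately show "h \<in> Ext1_coboundaries R M N" unfolding Ext1_coboundaries_def by blast
    qed
  qed
qed

section \<open>Modules of homomorphisms\<close>

definition hom_module ::
    "('a, 'b) ring_scheme \<Rightarrow> ('a, 'm) module \<Rightarrow> ('a, 'n) module \<Rightarrow> ('a, 'm \<Rightarrow> 'n) module" where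
  "hom_module R M N = \<lparr>carrier = module_hom R M N, monoid.mult = undefined, one = undefined,
     zero = (\<lambda>x \<in> carrier M. \<zero>\<^bsub>N\<^esub>), add = (\<lambda>h k. \<lambda>x \<in> carrier M. h x \<oplus>\<^bsub>N\<^esub> k x),
     smult = (\<lambda>r h. \<lambda>x \<in> carrier M. r \<odot>\<^bsub>N\<^esub> h x)\<rparr>"

lemma hom_module_simps [simp]:
  "carrier (hom_module R M N) = module_hom R M N"
  "\<zero>\<^bsub>hom_module R M N\<^esub> = (\<lambda>x \<in> carrier M. \<zero>\<^bsub>N\<^esub>)"
  "h \<oplus>\<^bsub>hom_module R M N\<^esub> k = (\<lambda>x \<in> carrier M. h x \<oplus>\<^bsub>N\<^esub> k x)"
  "r \<odot>\<^bsub>hom_module R M N\<^esub> h = (\<lambda>x \<in> carrier M. r \<odot>\<^bsub>N\<^esub> h x)"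
  by (simp_all add: hom_module_def)

lemma module_hom_eqI:
  "h \<in> module_hom R M N \<Longrightarrow> k \<in> module_hom R M N \<Longrightarrow> (\<And>x. x \<in> carrier M \<Longrightarrow> h x = k x) \<Longrightarrow> h = k"
  by (auto simp: module_hom_def intro: extensionalityI)

lemma module_homD:
  assumes "h \<in> module_hom R M N"
  shows "linear_map R M N h" "x \<in> carrier M \<Longrightarrow> h x \<in> carrier N"
  using assms by (auto simp: module_hom_iff linear_map_def)

lemma hom_module_module:
  assumes M: "module R M" and N: "module R N"
  shows "module R (hom_module R M N)"
proof -
  interpret M: module R M by fact
  interpret N: module R N by fact
  have add: "(\<lambda>x \<in> carrier M. h x \<oplus>\<^bsub>N\<^esub> k x) \<in> module_hom R M N"
    if "h \<in> module_hom R M N" "k \<in> module_hom R M N" for h k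
    by (rule restrict_module_hom[OF M linear_map_add[OF M N]]) (use that in \<open>auto simp: module_hom_iff\<close>)
  have sm: "(\<lambda>x \<in> carrier M. r \<odot>\<^bsub>N\<^esub> h x) \<in> module_hom R M N"
    if "h \<in> module_hom R M N" "r \<in> carrier R" for h r
    by (rule restrict_module_hom[OF M linear_map_smult[OF M N]]) (use that in \<open>auto simp: module_hom_iff\<close>)
  have z: "(\<lambda>x \<in> carrier M. \<zero>\<^bsub>N\<^esub>) \<in> module_hom R M N"
    by (rule restrict_module_hom[OF M linear_map_zero_map[OF M N]])
  have c: "h x \<in> carrier N" if "h \<in> module_hom R M N" "x \<in> carrier M" for h x using module_homD(2)[OF that] .
  note D = module_homD(2)
  show ?thesis
  proof (intro moduleI abelian_groupI)
    fix h assume h: "h \<in> carrier (hom_module R M N)"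
    show "\<exists>k\<in>carrier (hom_module R M N). k \<oplus>\<^bsub>hom_module R M N\<^esub> h = \<zero>\<^bsub>hom_module R M N\<^esub>"
    proof (rule bexI[of _ "\<lambda>x \<in> carrier M. (\<ominus>\<^bsub>R\<^esub> \<one>\<^bsub>R\<^esub>) \<odot>\<^bsub>N\<^esub> h x"])
      show "(\<lambda>x \<in> carrier M. (\<ominus>\<^bsub>R\<^esub> \<one>\<^bsub>R\<^esub>) \<odot>\<^bsub>N\<^esub> h x) \<in> carrier (hom_module R M N)" using sm h by auto
    qed (use h c in \<open>auto simp: fun_eq_iff N.smult_l_minus N.M.l_neg\<close>)
  next
    fix h assume h: "h \<in> carrier (hom_module R M N)"
    then have "h \<in> extensional (carrier M)" by (simp add: module_hom_iff)
    then show "\<zero>\<^bsub>hom_module R M N\<^esub> \<oplus>\<^bsub>hom_module R M N\<^esub> h = h" "\<one>\<^bsub>R\<^esub> \<odot>\<^bsub>hom_module R M N\<^esub> h = h"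
      using h c by (auto simp: fun_eq_iff extensional_def)
  qed (use add sm z c in \<open>auto simp: fun_eq_iff N.M.a_ac N.smult_l_distr N.smult_r_distr N.smult_assoc1 M.R.is_cring\<close>)
qed

section \<open>Two-periodic resolutions\<close>

lemma linear_map_factor:
  fixes X :: "('a, 'x) module"
  assumes F: "module R F" and N: "module R N" and X: "module R X"
    and C: "linear_map R F N C" "C ` carrier F = carrier N" and h: "linear_map R F X h"
    and ker: "\<And>z. z \<in> carrier F \<Longrightarrow> C z = \<zero>\<^bsub>N\<^esub> \<Longrightarrow> h z = \<zero>\<^bsub>X\<^esub>"
  obtains \<phi> where "linear_map R N X \<phi>" "\<And>z. z \<in> carrier F \<Longrightarrow> \<phi> (C z) = h z"
proof -
  interpret F: module R F by (rule F)
  interpret N: module R N by (rule N)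
  interpret X: module R X by (rule X)
  note C' = linear_mapD[OF C(1)] and h' = linear_mapD[OF h]
  have wd: "h z = h z'" if "z \<in> carrier F" "z' \<in> carrier F" "C z = C z'" for z z'
  proof -
    have "C (z \<ominus>\<^bsub>F\<^esub> z') = \<zero>\<^bsub>N\<^esub>"
      using linear_map_minus(2)[OF F N C(1) that(1,2)] that C'(1) by (simp add: a_minus_def N.M.r_neg)
    then have "h (z \<ominus>\<^bsub>F\<^esub> z') = \<zero>\<^bsub>X\<^esub>" using ker[of "z \<ominus>\<^bsub>F\<^esub> z'"] that F.M.minus_closed by blast
    then have "h z \<ominus>\<^bsub>X\<^esub> h z' = \<zero>\<^bsub>X\<^esub>" using linear_map_minus(2)[OF F X h that(1,2)] by simp
    then have "(h z \<ominus>\<^bsub>X\<^esub> h z') \<oplus>\<^bsub>X\<^esub> h z' = \<zero>\<^bsub>X\<^esub> \<oplus>\<^bsub>X\<^esub> h z'" by simp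
    then show ?thesis using X.minus_add_cancel h'(1) that by simp
  qed
  define \<phi> where "\<phi> v = h (SOME z. z \<in> carrier F \<and> C z = v)" for v
  have \<phi>C: "\<phi> (C z) = h z" if "z \<in> carrier F" for z
  proof -
    have "\<exists>z'. z' \<in> carrier F \<and> C z' = C z" using that by blast
    from someI_ex[OF this] show ?thesis unfolding \<phi>_def using wd that by blast
  qed
  have ex: "\<exists>z\<in>carrier F. v = C z" if "v \<in> carrier N" for v using that C(2) by blast
  have "linear_map R N X \<phi>" unfolding linear_map_def
  proof (intro conjI ballI)
    show "\<phi> \<in> carrier N \<rightarrow> carrier X" using ex \<phi>C h'(1) by fastforce
  next
    fix v w assume "v \<in> carrier N" "w \<in> carrier N"
    then obtain z z' where z: "z \<in> carrier F" "v = C z" "z' \<in> carrier F" "w = C z'" using ex by meson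
    then have "\<phi> (v \<oplus>\<^bsub>N\<^esub> w) = \<phi> (C (z \<oplus>\<^bsub>F\<^esub> z'))" using C'(2) by simp
    also have "\<dots> = h (z \<oplus>\<^bsub>F\<^esub> z')" by (rule \<phi>C) (rule F.M.a_closed[OF z(1,3)])
    finally show "\<phi> (v \<oplus>\<^bsub>N\<^esub> w) = \<phi> v \<oplus>\<^bsub>X\<^esub> \<phi> w" using z h'(2) \<phi>C by simp
  next
    fix r v assume r: "r \<in> carrier R" and "v \<in> carrier N"
    then obtain z where z: "z \<in> carrier F" "v = C z" using ex by meson
    then have "\<phi> (r \<odot>\<^bsub>N\<^esub> v) = \<phi> (C (r \<odot>\<^bsub>F\<^esub> z))" using C'(3) r by simp
    also have "\<dots> = h (r \<odot>\<^bsub>F\<^esub> z)" by (rule \<phi>C) (rule F.smult_closed[OF r z(1)])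
    finally show "\<phi> (r \<odot>\<^bsub>N\<^esub> v) = r \<odot>\<^bsub>X\<^esub> \<phi> v" using z r h'(3) \<phi>C by simp
  qed
  then show ?thesis using that \<phi>C by blast
qed

lemma lin_ext_in_submodule:
  fixes M :: "('a, 'm) module"
  assumes M: "module R M" and H: "submodule H R M" and s: "s \<in> A \<rightarrow> carrier M"
    and v: "v \<in> carrier (free_on R A)" and vs: "\<And>a. a \<in> A \<Longrightarrow> v a \<odot>\<^bsub>M\<^esub> s a \<in> H"
  shows "lin_ext R M s v \<in> H"
proof -
  interpret module R M by (rule M)
  note H' = submoduleD[OF H]
  have "(\<Oplus>\<^bsub>M\<^esub>x\<in>T. v x \<odot>\<^bsub>M\<^esub> s x) \<in> H" if "finite T" "T \<subseteq> A" for T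
    using that
  proof (induction T)
    case empty
    then show ?case using H'(2) by simp
  next
    case (insert a T)
    have "(\<Oplus>\<^bsub>M\<^esub>x\<in>insert a T. v x \<odot>\<^bsub>M\<^esub> s x) = v a \<odot>\<^bsub>M\<^esub> s a \<oplus>\<^bsub>M\<^esub> (\<Oplus>\<^bsub>M\<^esub>x\<in>T. v x \<odot>\<^bsub>M\<^esub> s x)"
      by (rule M.finsum_insert) (use insert s free_onD(1)[OF v] in auto)
    then show ?case using insert H'(3) vs by auto
  qed
  moreover have "finite {x. v x \<noteq> \<zero>\<^bsub>R\<^esub>}" "{x. v x \<noteq> \<zero>\<^bsub>R\<^esub>} \<subseteq> A" using free_onD[OF v] by auto
  ultimately show ?thesis by (simp add: lin_ext_def)
qed

lemma linear_map_eq_lin_ext: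
  assumes R: "cring R" and M: "module R M" and h: "linear_map R (free_on R A) M h" and v: "v \<in> carrier (free_on R A)"
  shows "h v = lin_ext R M (\<lambda>a. h (basis_vec R a)) v"
proof -
  have s: "(\<lambda>a. h (basis_vec R a)) \<in> A \<rightarrow> carrier M" using linear_mapD(1)[OF h] basis_vec_closed[OF R, of _ A] by blast
  show ?thesis
  proof (rule free_linear_map_eq[OF R M h linear_lin_ext[OF M s] _ v])
    fix a assume "a \<in> A"
    then have "h (basis_vec R a) \<in> carrier M" using s by auto
    then show "h (basis_vec R a) = lin_ext R M (\<lambda>a. h (basis_vec R a)) (basis_vec R a)"
      by (subst lin_ext_basis_vec[OF M]) auto
  qed
qed

lemma ideal_smult_linear_map:
  assumes M: "module R M" and N: "module R N" and h: "linear_map R M N h" and I: "I \<subseteq> carrier R"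
    and K: "K \<subseteq> carrier M" "h ` K \<subseteq> L" "L \<subseteq> carrier N" and v: "v \<in> ideal_smult R M I K"
  shows "h v \<in> ideal_smult R N I L"
proof (rule linear_map_span_into[OF M N h _ _ _ v[unfolded ideal_smult_def]])
  interpret M: module R M by (rule M)
  show "submodule (ideal_smult R N I L) R N" by (rule ideal_smult_submodule[OF N I K(3)])
  show "{r \<odot>\<^bsub>M\<^esub> k |r k. r \<in> I \<and> k \<in> K} \<subseteq> carrier M" using I K(1) by auto
  fix t assume "t \<in> {r \<odot>\<^bsub>M\<^esub> k |r k. r \<in> I \<and> k \<in> K}"
  then obtain r k where rk: "r \<in> I" "k \<in> K" "t = r \<odot>\<^bsub>M\<^esub> k" by auto
  have "h t = r \<odot>\<^bsub>N\<^esub> h k" unfolding rk(3) by (rule linear_mapD(3)[OF h]) (use rk I K in auto)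
  then show "h t \<in> ideal_smult R N I L" using ideal_smultI[OF rk(1), of "h k" L N R] rk K(2) by auto
qed

text \<open>Evaluation at the basis vectors, one after the other, filters the homomorphisms to \<open>W\<close>, and each
  step contributes at most the length of \<open>W\<close> over \<open>Y\<close>.\<close>

lemma hom_length_finite:
  fixes W :: "('a, 'w) module" and I :: "'i set"
  assumes R: "cring R" and W: "module R W" and Y: "submodule Y R W" and n: "length_le R W Y (carrier W) n"
    and I: "finite I"
  shows "\<exists>m. length_le R (hom_module R (free_on R I) W)
    {q \<in> module_hom R (free_on R I) W. \<forall>z\<in>carrier (free_on R I). q z \<in> Y} (module_hom R (free_on R I) W) m"
proof -
  let ?F = "free_on R I"
  let ?V = "hom_module R ?F W"
  let ?Y = "{q \<in> module_hom R ?F W. \<forall>z\<in>carrier ?F. q z \<in> Y}"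
  let ?Z = "\<lambda>J. {q \<in> module_hom R ?F W. \<forall>i\<in>I - J. q (basis_vec R i) = \<zero>\<^bsub>W\<^esub>}"
  have F: "module R ?F" by (rule free_on_module[OF R])
  have V: "module R ?V" by (rule hom_module_module[OF F W])
  interpret F: module R ?F by (rule F)
  interpret W: module R W by (rule W)
  interpret V: module R ?V by (rule V)
  note Y' = W.submoduleD[OF Y]
  have e: "basis_vec R i \<in> carrier ?F" if "i \<in> I" for i using basis_vec_closed[OF R that] .
  have ev: "linear_map R ?V W (\<lambda>q. q (basis_vec R i))" if "i \<in> I" for i
    unfolding linear_map_def using e[OF that] by (auto intro: module_homD(2)[OF _ e[OF that]])
  have YV: "submodule ?Y R ?V"
  proof -
    note c = V.submoduleD[OF V.carrier_is_submodule]
    show ?thesis unfolding V.submodule_iff using c(2-4) Y' by (auto simp del: free_on_simps)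
  qed
  have ZV: "submodule (?Z J) R ?V" for J
  proof -
    note c = V.submoduleD[OF V.carrier_is_submodule]
    show ?thesis unfolding V.submodule_iff using c(2-4) e by (auto simp del: free_on_simps)
  qed
  have "\<exists>m. length_le R ?V (?Y \<inter> ?Z J) (?Z J) m" if "finite J" "J \<subseteq> I" for J
    using that
  proof (induction J)
    case empty
    have "?Z {} \<subseteq> ?Y"
    proof
      fix q assume q: "q \<in> ?Z {}"
      then have ql: "linear_map R ?F W q" and q0: "\<And>i. i \<in> I \<Longrightarrow> q (basis_vec R i) = \<zero>\<^bsub>W\<^esub>"
        by (simp_all add: module_hom_iff)
      have "q z = \<zero>\<^bsub>W\<^esub>" if "z \<in> carrier ?F" for z
        by (rule free_linear_map_eq[OF R W ql linear_map_zero_map[OF F W] q0 that])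
      then show "q \<in> ?Y" using q Y'(2) by simp
    qed
    then have eq: "?Y \<inter> ?Z {} = ?Z {}" by (rule Int_absorb1)
    show ?case unfolding eq by (intro exI[of _ 0] length_le_refl)
  next
    case (insert j J)
    have j: "j \<in> I" "J \<subseteq> I" using insert.prems by auto
    obtain m where m: "length_le R ?V (?Y \<inter> ?Z J) (?Z J) m" using insert.IH j by auto
    let ?h = "\<lambda>q. q (basis_vec R j)"
    let ?Zj = "?Z (insert j J)"
    have ker: "?Zj \<inter> {q. ?h q = \<zero>\<^bsub>W\<^esub>} = ?Z J" using insert.hyps j by auto
    have "Y \<subseteq> ?h ` (?Y \<inter> ?Zj)"
    proof
      fix w assume w: "w \<in> Y"
      let ?s = "\<lambda>i. if i = j then w else \<zero>\<^bsub>W\<^esub>"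
      have s: "?s \<in> I \<rightarrow> carrier W" using Y'(1)[OF w] by auto
      have l: "linear_map R ?F W (lin_ext R W ?s)" by (rule linear_lin_ext[OF W s])
      have le: "lin_ext R W ?s (basis_vec R i) = ?s i" for i by (rule lin_ext_basis_vec[OF W]) (use Y'(1)[OF w] in auto)
      have lY: "lin_ext R W ?s z \<in> Y" if "z \<in> carrier ?F" for z
        by (rule free_linear_map_into[OF R W l Y _ that]) (use le w Y'(2) in auto)
      let ?q = "restrict (lin_ext R W ?s) (carrier ?F)"
      have "?q \<in> module_hom R ?F W" by (rule restrict_module_hom[OF F l])
      then have "?q \<in> ?Y \<inter> ?Zj" using lY le e by auto
      moreover have "?h ?q = w" using le[of j] e[OF j(1)] by simp
      ultimately show "w \<in> ?h ` (?Y \<inter> ?Zj)" by (intro image_eqI[of _ _ ?q]) simp_all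
    qed
    moreover have "?h ` ?Zj \<subseteq> carrier W" by (auto intro: module_homD(2)[OF _ e[OF j(1)]])
    ultimately have im: "length_le R W (?h ` (?Y \<inter> ?Zj)) (?h ` ?Zj) n" by (rule length_le_mono[OF n])
    have kery: "(?Y \<inter> ?Zj) \<inter> {q. ?h q = \<zero>\<^bsub>W\<^esub>} = ?Y \<inter> ?Z J" using ker by blast
    have "length_le R ?V (?Y \<inter> ?Zj) ?Zj (m + n)"
      by (rule length_le_linear_map[OF V W ev[OF j(1)] V.submodule_Int[OF YV ZV] _ im])
        (simp only: ker kery m)
    then show ?case by blast
  qed
  from this[OF I order_refl] obtain m where "length_le R ?V (?Y \<inter> ?Z I) (?Z I) m" by blast
  moreover have "?Y \<inter> ?Z I = ?Y" "?Z I = module_hom R ?F W" by auto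
  ultimately have "length_le R ?V ?Y (module_hom R ?F W) m" by (simp only:)
  then show ?thesis by (rule exI)
qed

text \<open>If \<open>f\<close> kills \<open>L\<close>, this says that \<open>f\<close> is regular on \<open>L'\<close> and that \<open>pr\<close> identifies \<open>L'/f L'\<close> with \<open>L\<close>.\<close>

definition is_reduction_mod ::
    "('a, 'b) ring_scheme \<Rightarrow> 'a \<Rightarrow> ('a, 'k) module \<Rightarrow> ('a, 'l) module \<Rightarrow> ('k \<Rightarrow> 'l) \<Rightarrow> bool" where
  "is_reduction_mod R f L' L pr \<longleftrightarrow> module R L' \<and> linear_map R L' L pr \<and> pr ` carrier L' = carrier L \<and>
     (\<forall>v\<in>carrier L'. pr v = \<zero>\<^bsub>L\<^esub> \<longrightarrow> (\<exists>w\<in>carrier L'. v = f \<odot>\<^bsub>L'\<^esub> w)) \<and>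
     (\<forall>v\<in>carrier L'. \<forall>w\<in>carrier L'. f \<odot>\<^bsub>L'\<^esub> v = f \<odot>\<^bsub>L'\<^esub> w \<longrightarrow> v = w)"

text \<open>Modulo \<open>f\<close>, a matrix factorization \<open>A\<close>, \<open>B\<close> becomes a two-periodic exact sequence of free modules, which
  remains exact under homomorphisms to \<open>L = L'/f L'\<close>. To see this, lift \<open>q\<close> to a map \<open>q'\<close> to
  \<open>L'\<close>. The hypothesis says \<open>q' B = f s\<close> for some \<open>s\<close>. Composing with \<open>A\<close> gives \<open>f q' = f s A\<close>, and \<open>f\<close>
  cancels.\<close>

lemma factorization_row_exact:
  fixes L' :: "('a, 'k) module" and L :: "('a, 'l) module" and I :: "'i set"
  assumes R: "cring R" and L: "module R L" and f: "f \<in> carrier R" and red: "is_reduction_mod R f L' L pr"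
    and A: "linear_map R (free_on R I) (free_on R I) A" and B: "linear_map R (free_on R I) (free_on R I) B"
    and BA: "\<And>v. v \<in> carrier (free_on R I) \<Longrightarrow> B (A v) = f \<odot>\<^bsub>free_on R I\<^esub> v"
    and q: "linear_map R (free_on R I) L q" "\<And>v. v \<in> carrier (free_on R I) \<Longrightarrow> q (B v) = \<zero>\<^bsub>L\<^esub>"
  obtains \<psi> where "linear_map R (free_on R I) L \<psi>" "\<And>v. v \<in> carrier (free_on R I) \<Longrightarrow> q v = \<psi> (A v)"
proof -
  let ?F = "free_on R I"
  have L': "module R L'" and pr: "linear_map R L' L pr" "pr ` carrier L' = carrier L"
    using red by (simp_all add: is_reduction_mod_def)
  have ker: "\<exists>w\<in>carrier L'. v = f \<odot>\<^bsub>L'\<^esub> w" if "v \<in> carrier L'" "pr v = \<zero>\<^bsub>L\<^esub>" for v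
    using red that by (simp add: is_reduction_mod_def)
  have inj: "v = w" if "v \<in> carrier L'" "w \<in> carrier L'" "f \<odot>\<^bsub>L'\<^esub> v = f \<odot>\<^bsub>L'\<^esub> w" for v w
    using red that by (simp add: is_reduction_mod_def)
  have F: "module R ?F" by (rule free_on_module[OF R])
  interpret F: module R ?F by (rule F)
  interpret L': module R L' by (rule L')
  interpret L: module R L by (rule L)
  note B' = linear_mapD[OF B] and A' = linear_mapD[OF A]
  have e: "basis_vec R i \<in> carrier ?F" if "i \<in> I" for i using basis_vec_closed[OF R that] .
  have "\<forall>i\<in>I. \<exists>t. t \<in> carrier L' \<and> pr t = q (basis_vec R i)"
  proof
    fix i assume "i \<in> I"
    then have "q (basis_vec R i) \<in> pr ` carrier L'" using pr(2) linear_mapD(1)[OF q(1)] e by auto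
    then obtain t where "q (basis_vec R i) = pr t" "t \<in> carrier L'" by (rule imageE)
    then show "\<exists>t. t \<in> carrier L' \<and> pr t = q (basis_vec R i)" by (intro exI[of _ t]) simp
  qed
  from bchoice[OF this] obtain t where t: "\<forall>i\<in>I. t i \<in> carrier L' \<and> pr (t i) = q (basis_vec R i)" by (rule exE)
  have tL: "t \<in> I \<rightarrow> carrier L'" using t by auto
  let ?q = "lin_ext R L' t"
  have q': "linear_map R ?F L' ?q" by (rule linear_lin_ext[OF L' tL])
  note q'D = linear_mapD[OF q']
  have prq: "pr (?q v) = q v" if "v \<in> carrier ?F" for v
  proof (rule free_linear_map_eq[OF R L linear_map_comp[OF q' pr(1)] q(1) _ that])
    fix i assume i: "i \<in> I"
    have "?q (basis_vec R i) = t i" by (rule lin_ext_basis_vec[OF L']) (use t i in auto)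
    then show "pr (?q (basis_vec R i)) = q (basis_vec R i)" using t i by simp
  qed
  have "\<forall>v\<in>carrier ?F. \<exists>w. w \<in> carrier L' \<and> ?q (B v) = f \<odot>\<^bsub>L'\<^esub> w"
  proof
    fix v assume v: "v \<in> carrier ?F"
    have "pr (?q (B v)) = \<zero>\<^bsub>L\<^esub>" using prq[OF B'(1)[OF v]] q(2)[OF v] by simp
    from ker[OF q'D(1)[OF B'(1)[OF v]] this] show "\<exists>w. w \<in> carrier L' \<and> ?q (B v) = f \<odot>\<^bsub>L'\<^esub> w"
      unfolding Bex_def .
  qed
  from bchoice[OF this] obtain s where s0: "\<forall>v\<in>carrier ?F. s v \<in> carrier L' \<and> ?q (B v) = f \<odot>\<^bsub>L'\<^esub> s v" by (rule exE)
  have s: "s v \<in> carrier L'" "?q (B v) = f \<odot>\<^bsub>L'\<^esub> s v" if "v \<in> carrier ?F" for v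
    using bspec[OF s0 that] by auto
  have sl: "linear_map R ?F L' s" unfolding linear_map_def
  proof (intro conjI ballI)
    show "s \<in> carrier ?F \<rightarrow> carrier L'" using s by auto
  next
    fix v w assume v: "v \<in> carrier ?F" and w: "w \<in> carrier ?F"
    have vw: "v \<oplus>\<^bsub>?F\<^esub> w \<in> carrier ?F" by (rule F.M.a_closed[OF v w])
    have "f \<odot>\<^bsub>L'\<^esub> s (v \<oplus>\<^bsub>?F\<^esub> w) = ?q (B (v \<oplus>\<^bsub>?F\<^esub> w))" using s(2)[OF vw] by simp
    also have "\<dots> = ?q (B v) \<oplus>\<^bsub>L'\<^esub> ?q (B w)" using B'(1,2) q'D(2) v w by (simp del: free_on_simps)
    also have "\<dots> = f \<odot>\<^bsub>L'\<^esub> (s v \<oplus>\<^bsub>L'\<^esub> s w)" using s[OF v] s[OF w] f by (simp add: L'.smult_r_distr)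
    finally show "s (v \<oplus>\<^bsub>?F\<^esub> w) = s v \<oplus>\<^bsub>L'\<^esub> s w" 
      by (rule inj[OF s(1)[OF vw] L'.M.a_closed[OF s(1)[OF v] s(1)[OF w]]])
  next
    fix r v assume r: "r \<in> carrier R" and v: "v \<in> carrier ?F"
    have rv: "r \<odot>\<^bsub>?F\<^esub> v \<in> carrier ?F" by (rule F.smult_closed[OF r v])
    have "f \<odot>\<^bsub>L'\<^esub> s (r \<odot>\<^bsub>?F\<^esub> v) = ?q (B (r \<odot>\<^bsub>?F\<^esub> v))" using s(2)[OF rv] by simp
    also have "\<dots> = r \<odot>\<^bsub>L'\<^esub> ?q (B v)" using B'(1,3) q'D(3) v r by (simp del: free_on_simps)
    also have "\<dots> = f \<odot>\<^bsub>L'\<^esub> (r \<odot>\<^bsub>L'\<^esub> s v)" using s[OF v] f r by (simp add: L'.smult_assoc1[symmetric] F.R.m_comm)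
    finally show "s (r \<odot>\<^bsub>?F\<^esub> v) = r \<odot>\<^bsub>L'\<^esub> s v" 
      by (rule inj[OF s(1)[OF rv] L'.smult_closed[OF r s(1)[OF v]]])
  qed
  have "q v = pr (s (A v))" if v: "v \<in> carrier ?F" for v
  proof -
    have "f \<odot>\<^bsub>L'\<^esub> ?q v = ?q (f \<odot>\<^bsub>?F\<^esub> v)" using q'D(3)[OF f v] by simp
    also have "\<dots> = ?q (B (A v))" using BA[OF v] by simp
    also have "\<dots> = f \<odot>\<^bsub>L'\<^esub> s (A v)" by (rule s(2)[OF A'(1)[OF v]])
    finally have "?q v = s (A v)" by (rule inj[OF q'D(1)[OF v] s(1)[OF A'(1)[OF v]]])
    then show ?thesis using prq[OF v] by simp
  qed
  then show ?thesis using that linear_map_comp[OF sl pr(1)] by blast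
qed

section \<open>Relations of a rigid module\<close>

lemma length_le_submodule:
  assumes "module R G" "submodule N R G" "length_le R G Y X n"
  shows "length_le R (G\<lparr>carrier := N\<rparr>) Y X n"
proof -
  interpret module R G by fact
  have "submodule_chain R G Y X C" if "submodule_chain R (G\<lparr>carrier := N\<rparr>) Y X C" for C
    using that submodule_restrict_iff[OF assms(2)] unfolding submodule_chain_def by auto
  then show ?thesis using assms(3) by (auto simp: length_le_def)
qed

lemma linear_map_precompose:
  assumes F: "module R F" and N: "module R N" and A: "linear_map R F F A"
  shows "linear_map R (hom_module R F N) (hom_module R F N) (\<lambda>q. \<lambda>z\<in>carrier F. q (A z))"
proof -
  interpret F: module R F by (rule F)
  have "(\<lambda>z\<in>carrier F. q (A z)) \<in> module_hom R F N" if "q \<in> module_hom R F N" for q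
    by (rule restrict_module_hom[OF F linear_map_comp[OF A module_homD(1)[OF that]]])
  then show ?thesis unfolding linear_map_def using linear_mapD(1)[OF A] by (auto simp: fun_eq_iff)
qed

text \<open>The heart of the argument. \<open>G\<close> covers the rigid module \<open>M\<close> minimally, and \<open>N\<close> is the module of
  relations. It has a two-periodic resolution by \<open>F/f F\<close>, whose maps \<open>A\<close> and \<open>B\<close> form a matrix
  factorization, so the groups \<open>Ext(N, N)\<close> are the homology of \<open>Hom(F, N)\<close> under composition with \<open>A\<close>
  and with \<open>B\<close>. Rigidity of \<open>M\<close> makes the first Ext group of \<open>N\<close> vanish. The submodule \<open>N'\<close> has
  no homology at all and finite colength, so \<open>two_periodic_exactness\<close> makes the second one vanish too. Then
  \<open>C\<close> factors through \<open>B\<close>, that is, \<open>N\<close> is a direct summand of \<open>F/f F\<close>. If \<open>N\<close> were not zero, it would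
  therefore have a linear form with a unit value, hence a homomorphism to \<open>M\<close> that takes a value outside
  \<open>nonunits M\<close>. This homomorphism extends to \<open>G\<close>, whereas \<open>N\<close> lies in \<open>nonunits G\<close>.\<close>

lemma (in regular_pair) relations_vanish:
  fixes G :: "('a, 'g) module" and M :: "('a, 'm) module" and L1 :: "('a, 'k) module" and L2 :: "('a, 'l) module"
  assumes G: "module S G" and M: "module S M" and p: "linear_map S G M p" and p_surj: "p ` carrier G = carrier M"
    and f: "f \<in> carrier S" "f \<notin> PIdl x"
    and fG: "\<And>v. v \<in> carrier G \<Longrightarrow> f \<odot>\<^bsub>G\<^esub> v = \<zero>\<^bsub>G\<^esub>"
    and xG: "\<And>v. v \<in> carrier G \<Longrightarrow> x \<odot>\<^bsub>G\<^esub> v = \<zero>\<^bsub>G\<^esub> \<Longrightarrow> v = \<zero>\<^bsub>G\<^esub>"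
    and N: "N = {v \<in> carrier G. p v = \<zero>\<^bsub>M\<^esub>}"
    and I: "finite I" "I \<subseteq> N" "span S G I = N"
    and redG: "is_reduction_mod S f L1 G pr1"
    and N': "submodule N' S G" "N' \<subseteq> N" and redN': "is_reduction_mod S f L2 (G\<lparr>carrier := N'\<rparr>) pr2"
    and fin: "length_le S G N' N n"
    and ext: "\<And>\<phi>. linear_map S (G\<lparr>carrier := N\<rparr>) M \<phi> \<Longrightarrow> \<exists>\<theta>. linear_map S G G \<theta> \<and> (\<forall>v\<in>N. p (\<theta> v) = \<phi> v)"
    and minimal: "N \<subseteq> ideal_smult S G nonunits (carrier G)"
    and g: "g \<in> carrier M" "g \<notin> ideal_smult S M nonunits (carrier M)"
  shows "N = {\<zero>\<^bsub>G\<^esub>}"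
proof (rule ccontr)
  assume N0: "N \<noteq> {\<zero>\<^bsub>G\<^esub>}"
  interpret G: module S G by (rule G)
  interpret M: module S M by (rule M)
  note p' = linear_mapD[OF p]
  have NG: "submodule N S G"
    using linear_map_preimage[OF G M p M.submodule_zero G.carrier_is_submodule] by (simp add: N)
  note NG' = G.submoduleD[OF NG]
  have NsubG: "N \<subseteq> carrier G" by (auto simp: N)
  let ?NM = "G\<lparr>carrier := N\<rparr>"
  have NM: "module S ?NM" by (rule submodule.submodule_is_module[OF NG G])
  interpret NM: module S ?NM by (rule NM)
  have IG: "I \<subseteq> carrier G" using I(2) NsubG by auto
  let ?F = "free_on S I"
  have F: "module S ?F" by (rule free_on_module[OF is_cring])
  interpret F: module S ?F by (rule F)
  let ?C = "lincomb S G"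
  have C: "linear_map S ?F G ?C" by (rule linear_lincomb[OF G IG])
  have CN: "?C ` carrier ?F = N" using lincomb_image[OF G IG] I(3) by simp
  have CNM: "linear_map S ?F ?NM ?C" by (rule linear_map_into[OF C]) (simp add: CN)
  note C' = linear_mapD[OF C]
  let ?K = "{z \<in> carrier ?F. ?C z \<in> {\<zero>\<^bsub>G\<^esub>}}"
  have K: "submodule ?K S ?F" by (rule linear_map_preimage[OF F G C G.submodule_zero F.carrier_is_submodule])
  have fK: "f \<odot>\<^bsub>?F\<^esub> v \<in> ?K" if v: "v \<in> carrier ?F" for v
    using F.smult_closed[OF f(1) v] C'(3)[OF f(1) v] fG[OF C'(1)[OF v]] by simp
  have sat: "v \<in> ?K" if v: "v \<in> carrier ?F" and xv: "x \<odot>\<^bsub>?F\<^esub> v \<in> ?K" for v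
    using xG[OF C'(1)[OF v]] C'(3)[OF x v] xv v by simp
  obtain A B where A: "linear_map S ?F ?F A" and B: "linear_map S ?F ?F B" and AK: "A ` carrier ?F = ?K"
    and AB: "\<And>v. v \<in> carrier ?F \<Longrightarrow> A (B v) = f \<odot>\<^bsub>?F\<^esub> v"
    and BA: "\<And>v. v \<in> carrier ?F \<Longrightarrow> B (A v) = f \<odot>\<^bsub>?F\<^esub> v"
    by (rule matrix_factorization[OF I(1) K f fK sat]) (assumption | rule that)+
  note A' = linear_mapD[OF A] and B' = linear_mapD[OF B]
  have CA: "?C (A z) = \<zero>\<^bsub>G\<^esub>" if "z \<in> carrier ?F" for z using AK that by auto
  have f_kill: "q (f \<odot>\<^bsub>?F\<^esub> z) = \<zero>\<^bsub>G\<^esub>" if "linear_map S ?F G q" "z \<in> carrier ?F" for q z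
    using linear_mapD(3)[OF that(1) f(1) that(2)] fG linear_mapD(1)[OF that] by simp
  \<comment> \<open>\<open>V = Hom(F, N)\<close> contains \<open>Y = Hom(F, N')\<close>; \<open>a\<close> and \<open>b\<close> are composition with \<open>A\<close> and \<open>B\<close>\<close>
  let ?V = "hom_module S ?F ?NM"
  let ?a = "\<lambda>q. \<lambda>z\<in>carrier ?F. q (A z)" and ?b = "\<lambda>q. \<lambda>z\<in>carrier ?F. q (B z)"
  let ?Y = "{q \<in> module_hom S ?F ?NM. \<forall>z\<in>carrier ?F. q z \<in> N'}"
  have V: "module S ?V" by (rule hom_module_module[OF F NM])
  interpret V: module S ?V by (rule V)
  have a: "linear_map S ?V ?V ?a" and b: "linear_map S ?V ?V ?b"
    using linear_map_precompose[OF F NM] A B by blast+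
  have VG: "linear_map S ?F G q" if "q \<in> module_hom S ?F ?NM" for q
    by (rule linear_map_from[OF module_homD(1)[OF that] NsubG])
  have Va: "?a q \<in> module_hom S ?F ?NM" and Vb: "?b q \<in> module_hom S ?F ?NM" if "q \<in> module_hom S ?F ?NM" for q
    using linear_mapD(1)[OF a, of q] linear_mapD(1)[OF b, of q] that by simp_all
  have a0: "?a q = \<zero>\<^bsub>?V\<^esub> \<longleftrightarrow> (\<forall>z\<in>carrier ?F. q (A z) = \<zero>\<^bsub>G\<^esub>)" for q by (auto simp: fun_eq_iff)
  have b0: "?b q = \<zero>\<^bsub>?V\<^esub> \<longleftrightarrow> (\<forall>z\<in>carrier ?F. q (B z) = \<zero>\<^bsub>G\<^esub>)" for q by (auto simp: fun_eq_iff)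
  have ba: "?b (?a q) = \<zero>\<^bsub>?V\<^esub>" if q: "q \<in> module_hom S ?F ?NM" for q
    unfolding b0 using AB B'(1) f_kill[OF VG[OF q]] by simp
  have ab: "?a (?b q) = \<zero>\<^bsub>?V\<^esub>" if q: "q \<in> module_hom S ?F ?NM" for q
    unfolding a0 using BA A'(1) f_kill[OF VG[OF q]] by simp
  have N'N: "submodule N' S ?NM" using G.submodule_restrict_iff[OF NG] N' by simp
  obtain m where m: "length_le S ?V ?Y (module_hom S ?F ?NM) m"
    using hom_length_finite[OF is_cring NM N'N _ I(1), of n] length_le_submodule[OF G NG fin] by auto
  have Y: "submodule ?Y S ?V"
  proof -
    note c = V.submoduleD[OF V.carrier_is_submodule]
    show ?thesis unfolding V.submodule_iff using c(2-4) G.submoduleD[OF N'(1)] by (auto simp del: free_on_simps)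
  qed
  \<comment> \<open>a cocycle \<open>q\<close> is \<open>\<psi> A\<close> with \<open>\<psi>\<close> into \<open>G\<close>; modulo \<open>N\<close>, \<open>\<psi>\<close> induces a map \<open>N \<rightarrow> M\<close>, and subtracting a lift
     \<open>\<theta>\<close> of its extension to \<open>G\<close> moves \<open>\<psi>\<close> into \<open>N\<close>\<close>
  have kerb: "\<exists>\<psi>\<in>module_hom S ?F ?NM. q = ?a \<psi>" if q: "q \<in> module_hom S ?F ?NM" and qB: "?b q = \<zero>\<^bsub>?V\<^esub>" for q
  proof -
    have qG: "linear_map S ?F G q" by (rule VG[OF q])
    have qB': "q (B z) = \<zero>\<^bsub>G\<^esub>" if "z \<in> carrier ?F" for z using qB that unfolding b0 by blast
    obtain \<psi> where \<psi>: "linear_map S ?F G \<psi>" and q\<psi>: "\<And>z. z \<in> carrier ?F \<Longrightarrow> q z = \<psi> (A z)"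
      by (rule factorization_row_exact[OF is_cring G f(1) redG A B BA qG qB']) (assumption | rule that)+
    note \<psi>' = linear_mapD[OF \<psi>]
    have "p (\<psi> z) = \<zero>\<^bsub>M\<^esub>" if z: "z \<in> carrier ?F" and Cz: "?C z = \<zero>\<^bsub>?NM\<^esub>" for z
    proof -
      have "z \<in> A ` carrier ?F" using z Cz AK by simp
      then obtain t where t: "z = A t" "t \<in> carrier ?F" by (rule imageE)
      then have "\<psi> z = q t" using q\<psi> by simp
      moreover have "q t \<in> N" using module_homD(2)[OF q t(2)] by simp
      ultimately show ?thesis by (simp add: N)
    qed
    then obtain \<phi> where \<phi>: "linear_map S ?NM M \<phi>" and \<phi>C: "\<And>z. z \<in> carrier ?F \<Longrightarrow> \<phi> (?C z) = p (\<psi> z)"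
      using linear_map_factor[OF F NM M CNM _ linear_map_comp[OF \<psi> p]] CN by auto
    obtain \<theta> where \<theta>: "linear_map S G G \<theta>" "\<And>v. v \<in> N \<Longrightarrow> p (\<theta> v) = \<phi> v" using ext[OF \<phi>] by blast
    let ?\<psi> = "\<lambda>z. \<psi> z \<ominus>\<^bsub>G\<^esub> \<theta> (?C z)"
    have \<theta>C: "linear_map S ?F G (\<lambda>z. \<theta> (?C z))" by (rule linear_map_comp[OF C \<theta>(1)])
    have l: "linear_map S ?F G ?\<psi>" by (rule linear_map_diff[OF F G \<psi> \<theta>C])
    have "?\<psi> z \<in> N" if z: "z \<in> carrier ?F" for z
    proof -
      have c: "\<psi> z \<in> carrier G" "\<theta> (?C z) \<in> carrier G" using \<psi>'(1)[OF z] linear_mapD(1)[OF \<theta>C z] by auto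
      have "p (?\<psi> z) = p (\<psi> z) \<ominus>\<^bsub>M\<^esub> p (\<theta> (?C z))" by (rule linear_map_minus(2)[OF G M p c])
      moreover have "p (\<theta> (?C z)) = p (\<psi> z)" using \<theta>(2)[of "?C z"] \<phi>C[OF z] CN z by auto
      ultimately have "p (?\<psi> z) = \<zero>\<^bsub>M\<^esub>" using p'(1)[OF c(1)] by (simp add: a_minus_def M.M.r_neg)
      then show ?thesis using linear_mapD(1)[OF l z] by (simp add: N)
    qed
    then have lN: "linear_map S ?F ?NM ?\<psi>" by (intro linear_map_into[OF l]) auto
    let ?r = "restrict ?\<psi> (carrier ?F)"
    have r: "?r \<in> module_hom S ?F ?NM" by (rule restrict_module_hom[OF F lN])
    have "q = ?a ?r"
    proof (rule module_hom_eqI[OF q Va[OF r]])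
      fix z assume z: "z \<in> carrier ?F"
      have "\<theta> (?C (A z)) = \<zero>\<^bsub>G\<^esub>" using CA[OF z] linear_map_zero[OF G G \<theta>(1)] by simp
      then show "q z = ?a ?r z" using q\<psi>[OF z] A'(1)[OF z] z \<psi>'(1)[OF A'(1)[OF z]] by (simp add: a_minus_def)
    qed
    then show ?thesis using r by blast
  qed
  \<comment> \<open>\<open>A0\<close> and \<open>B0\<close> stand for \<open>A\<close> and \<open>B\<close> in either order\<close>
  have N'M: "module S (G\<lparr>carrier := N'\<rparr>)" by (rule submodule.submodule_is_module[OF N'(1) G])
  have exN': "\<exists>\<psi>\<in>?Y. \<forall>z\<in>carrier ?F. q z = \<psi> (A0 z)"
    if A0: "linear_map S ?F ?F A0" and B0: "linear_map S ?F ?F B0"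
      and BA0: "\<And>v. v \<in> carrier ?F \<Longrightarrow> B0 (A0 v) = f \<odot>\<^bsub>?F\<^esub> v"
      and q: "q \<in> ?Y" and qB0: "\<And>z. z \<in> carrier ?F \<Longrightarrow> q (B0 z) = \<zero>\<^bsub>G\<^esub>" for q A0 B0
  proof -
    have qV: "q \<in> module_hom S ?F ?NM" and qN': "q ` carrier ?F \<subseteq> N'" using q by auto
    have ql: "linear_map S ?F (G\<lparr>carrier := N'\<rparr>) q" by (rule linear_map_into[OF VG[OF qV] qN'])
    have qB0': "q (B0 z) = \<zero>\<^bsub>G\<lparr>carrier := N'\<rparr>\<^esub>" if "z \<in> carrier ?F" for z using qB0[OF that] by simp
    obtain \<psi> where \<psi>: "linear_map S ?F (G\<lparr>carrier := N'\<rparr>) \<psi>" and q\<psi>: "\<And>z. z \<in> carrier ?F \<Longrightarrow> q z = \<psi> (A0 z)"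
      by (rule factorization_row_exact[OF is_cring N'M f(1) redN' A0 B0 BA0 ql qB0']) (assumption | rule that)+
    have \<psi>N': "\<psi> z \<in> N'" if "z \<in> carrier ?F" for z using linear_mapD(1)[OF \<psi> that] by simp
    have "linear_map S ?F G \<psi>" by (rule linear_map_from[OF \<psi>]) (use N'(2) NsubG in auto)
    then have "linear_map S ?F ?NM \<psi>" by (rule linear_map_into) (use \<psi>N' N'(2) in auto)
    then have "restrict \<psi> (carrier ?F) \<in> module_hom S ?F ?NM" by (rule restrict_module_hom[OF F])
    then have "restrict \<psi> (carrier ?F) \<in> ?Y" using \<psi>N' by simp
    moreover have "\<forall>z\<in>carrier ?F. q z = restrict \<psi> (carrier ?F) (A0 z)" using q\<psi> linear_mapD(1)[OF A0] by simp
    ultimately show ?thesis by (intro bexI[of _ "restrict \<psi> (carrier ?F)"])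
  qed
  have Yab: "?a q \<in> ?Y" "?b q \<in> ?Y" if "q \<in> ?Y" for q
    using Va[of q] Vb[of q] that A'(1) B'(1) by auto
  have "?b ` carrier ?V = carrier ?V \<inter> {v. ?a v = \<zero>\<^bsub>?V\<^esub>}"
  proof (rule two_periodic_exactness[OF V a b Y])
    show "length_le S ?V ?Y (carrier ?V) m" using m by simp
    show "?a ` carrier ?V = carrier ?V \<inter> {v. ?b v = \<zero>\<^bsub>?V\<^esub>}"
    proof (intro equalityI subsetI)
      fix q assume "q \<in> ?a ` carrier ?V"
      then obtain r where "q = ?a r" "r \<in> module_hom S ?F ?NM" by auto
      then show "q \<in> carrier ?V \<inter> {v. ?b v = \<zero>\<^bsub>?V\<^esub>}" using Va ba by simp
    next
      fix q assume "q \<in> carrier ?V \<inter> {v. ?b v = \<zero>\<^bsub>?V\<^esub>}"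
      then have "q \<in> module_hom S ?F ?NM" "?b q = \<zero>\<^bsub>?V\<^esub>" by simp_all
      from kerb[OF this] show "q \<in> ?a ` carrier ?V" unfolding hom_module_simps(1) by blast
    qed
    show "?b ` carrier ?V \<subseteq> {v. ?a v = \<zero>\<^bsub>?V\<^esub>}"
    proof
      fix q assume "q \<in> ?b ` carrier ?V"
      then obtain r where "q = ?b r" "r \<in> module_hom S ?F ?NM" by auto
      then show "q \<in> {v. ?a v = \<zero>\<^bsub>?V\<^esub>}" using ab by simp
    qed
    show "?a ` ?Y = ?Y \<inter> {v. ?b v = \<zero>\<^bsub>?V\<^esub>}"
    proof (intro equalityI subsetI)
      fix q assume "q \<in> ?a ` ?Y"
      then obtain r where r: "q = ?a r" "r \<in> ?Y" by (rule imageE)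
      then show "q \<in> ?Y \<inter> {v. ?b v = \<zero>\<^bsub>?V\<^esub>}" using Yab(1)[OF r(2)] ba by simp
    next
      fix q assume "q \<in> ?Y \<inter> {v. ?b v = \<zero>\<^bsub>?V\<^esub>}"
      then have q: "q \<in> ?Y" and qB: "?b q = \<zero>\<^bsub>?V\<^esub>" by blast+
      have qB': "q (B z) = \<zero>\<^bsub>G\<^esub>" if "z \<in> carrier ?F" for z using qB that unfolding b0 by blast
      obtain \<psi> where \<psi>: "\<psi> \<in> ?Y" "\<forall>z\<in>carrier ?F. q z = \<psi> (A z)" using exN'[OF A B BA q qB'] by (rule bexE)
      have "q = ?a \<psi>" by (rule module_hom_eqI[of _ S ?F ?NM]) (use q \<psi> Yab(1)[OF \<psi>(1)] in auto)
      then show "q \<in> ?a ` ?Y" using \<psi>(1) by (rule image_eqI)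
    qed
    show "?b ` ?Y = ?Y \<inter> {v. ?a v = \<zero>\<^bsub>?V\<^esub>}"
    proof (intro equalityI subsetI)
      fix q assume "q \<in> ?b ` ?Y"
      then obtain r where r: "q = ?b r" "r \<in> ?Y" by (rule imageE)
      then show "q \<in> ?Y \<inter> {v. ?a v = \<zero>\<^bsub>?V\<^esub>}" using Yab(2)[OF r(2)] ab by simp
    next
      fix q assume "q \<in> ?Y \<inter> {v. ?a v = \<zero>\<^bsub>?V\<^esub>}"
      then have q: "q \<in> ?Y" and qA: "?a q = \<zero>\<^bsub>?V\<^esub>" by blast+
      have qA': "q (A z) = \<zero>\<^bsub>G\<^esub>" if "z \<in> carrier ?F" for z using qA that unfolding a0 by blast
      obtain \<psi> where \<psi>: "\<psi> \<in> ?Y" "\<forall>z\<in>carrier ?F. q z = \<psi> (B z)" using exN'[OF B A AB q qA'] by (rule bexE)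
      have "q = ?b \<psi>" by (rule module_hom_eqI[of _ S ?F ?NM]) (use q \<psi> Yab(2)[OF \<psi>(1)] in auto)
      then show "q \<in> ?b ` ?Y" using \<psi>(1) by (rule image_eqI)
    qed
  qed
  moreover have "restrict ?C (carrier ?F) \<in> carrier ?V \<inter> {v. ?a v = \<zero>\<^bsub>?V\<^esub>}"
    using restrict_module_hom[OF F CNM] CA A'(1) by (simp add: fun_eq_iff)
  ultimately have "restrict ?C (carrier ?F) \<in> ?b ` carrier ?V" by (simp only:)
  then obtain w where w: "restrict ?C (carrier ?F) = ?b w" "w \<in> carrier ?V" by (rule imageE)
  have Cw: "?C z = w (B z)" if "z \<in> carrier ?F" for z using fun_cong[OF w(1), of z] that by simp
  have wl: "linear_map S ?F ?NM w" using w(2) module_homD(1) by simp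
  \<comment> \<open>by Nakayama, some value of \<open>C = w B\<close> is outside \<open>nonunits N\<close>, so \<open>B z\<close> has a unit coordinate\<close>
  have "\<exists>v\<in>N. v \<notin> ideal_smult S G nonunits N"
  proof (rule ccontr)
    assume "\<not> ?thesis"
    then have sub: "v \<in> ideal_smult S G nonunits N" if "v \<in> N" for v using that by blast
    have "N \<subseteq> {\<zero>\<^bsub>G\<^esub>}"
    proof (rule nakayama_span[OF G nonunits_ideal one_minus_nonunit G.submodule_zero I(1) IG I(3)])
      fix v assume v: "v \<in> N"
      then have "v = \<zero>\<^bsub>G\<^esub> \<oplus>\<^bsub>G\<^esub> v" using NsubG by auto
      then show "\<exists>l\<in>{\<zero>\<^bsub>G\<^esub>}. \<exists>w\<in>ideal_smult S G nonunits N. v = l \<oplus>\<^bsub>G\<^esub> w" using sub[OF v] by blast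
    qed
    then show False using N0 NG'(2) by blast
  qed
  then obtain v where v: "v \<in> N" "v \<notin> ideal_smult S G nonunits N" by blast
  have "v \<in> ?C ` carrier ?F" using v(1) CN by simp
  then obtain z where z: "v = ?C z" "z \<in> carrier ?F" by (rule imageE)
  have Bz: "B z \<in> carrier ?F" by (rule B'(1)[OF z(2)])
  have maxS: "nonunits \<subseteq> carrier S" using ideal.Icarr[OF nonunits_ideal] by auto
  have e: "basis_vec S i \<in> carrier ?F" if "i \<in> I" for i by (rule basis_vec_closed[OF is_cring that])
  have "\<exists>j\<in>I. B z j \<notin> nonunits"
  proof (rule ccontr)
    assume "\<not> ?thesis"
    then have in_max: "B z j \<in> nonunits" if "j \<in> I" for j using that by blast
    have wG: "linear_map S ?F G w" by (rule linear_map_from[OF wl NsubG])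
    have wN: "w (basis_vec S i) \<in> N" if "i \<in> I" for i using linear_mapD(1)[OF wl e[OF that]] by simp
    have "w (B z) = lin_ext S G (\<lambda>i. w (basis_vec S i)) (B z)" by (rule linear_map_eq_lin_ext[OF is_cring G wG Bz])
    also have "\<dots> \<in> ideal_smult S G nonunits N"
      by (rule lin_ext_in_submodule[OF G ideal_smult_submodule[OF G maxS NsubG] _ Bz])
        (use wN NsubG in_max in \<open>auto intro: ideal_smultI\<close>)
    finally show False using v(2) z Cw by simp
  qed
  then obtain j where j: "j \<in> I" "B z j \<notin> nonunits" by blast
  have Bzj: "B z j \<in> carrier S" by (rule free_onD(1)[OF Bz])
  then have u: "B z j \<in> Units S" using j(2) mem_nonunits_iff by blast
  \<comment> \<open>the \<open>j\<close>-th coordinate of \<open>B\<close> factors through \<open>C\<close> because \<open>f\<close> kills \<open>M\<close>\<close>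
  let ?h = "\<lambda>y. B y j \<odot>\<^bsub>M\<^esub> g"
  have hl: "linear_map S ?F M ?h" unfolding linear_map_def
  proof (intro conjI ballI)
    show "?h \<in> carrier ?F \<rightarrow> carrier M"
    proof
      fix y assume "y \<in> carrier ?F"
      from free_onD(1)[OF B'(1)[OF this]] show "?h y \<in> carrier M" using g(1) by simp
    qed
  next
    fix y y' assume y: "y \<in> carrier ?F" "y' \<in> carrier ?F"
    show "?h (y \<oplus>\<^bsub>?F\<^esub> y') = ?h y \<oplus>\<^bsub>M\<^esub> ?h y'"
      unfolding B'(2)[OF y] using free_onD(1)[OF B'(1)[OF y(1)]] free_onD(1)[OF B'(1)[OF y(2)]] g(1)
      by (simp add: M.smult_l_distr)
  next
    fix r y assume r: "r \<in> carrier S" and y: "y \<in> carrier ?F"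
    show "?h (r \<odot>\<^bsub>?F\<^esub> y) = r \<odot>\<^bsub>M\<^esub> ?h y"
      unfolding B'(3)[OF r y] using free_onD(1)[OF B'(1)[OF y]] g(1) r by (simp add: M.smult_assoc1)
  qed
  have fM: "f \<odot>\<^bsub>M\<^esub> v = \<zero>\<^bsub>M\<^esub>" if "v \<in> carrier M" for v
  proof -
    have "v \<in> p ` carrier G" using that p_surj by simp
    then obtain u where "v = p u" "u \<in> carrier G" by (rule imageE)
    then show ?thesis using p'(3)[OF f(1), of u] fG[of u] linear_map_zero[OF G M p] by simp
  qed
  have hker: "?h y = \<zero>\<^bsub>M\<^esub>" if y: "y \<in> carrier ?F" and Cy: "?C y = \<zero>\<^bsub>?NM\<^esub>" for y
  proof -
    have "y \<in> A ` carrier ?F" using y Cy AK by simp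
    then obtain t where t: "y = A t" "t \<in> carrier ?F" by (rule imageE)
    have tj: "t j \<in> carrier S" by (rule free_onD(1)[OF t(2)])
    have "B y j = t j \<otimes> f" using BA[OF t(2)] t(1) f(1) tj by (simp add: m_comm)
    then have "?h y = t j \<odot>\<^bsub>M\<^esub> (f \<odot>\<^bsub>M\<^esub> g)" using tj f(1) g(1) by (simp add: M.smult_assoc1)
    then show ?thesis using fM[OF g(1)] tj by simp
  qed
  obtain \<phi> where \<phi>: "linear_map S ?NM M \<phi>" and \<phi>C: "\<And>y. y \<in> carrier ?F \<Longrightarrow> \<phi> (?C y) = ?h y"
    using linear_map_factor[OF F NM M CNM _ hl hker] CN by auto
  obtain \<theta> where \<theta>: "linear_map S G G \<theta>" "\<And>v. v \<in> N \<Longrightarrow> p (\<theta> v) = \<phi> v" using ext[OF \<phi>] by blast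
  have "p (\<theta> v) \<in> ideal_smult S M nonunits (carrier M)"
    by (rule ideal_smult_linear_map[OF G M linear_map_comp[OF \<theta>(1) p] maxS order_refl])
      (use linear_mapD(1)[OF linear_map_comp[OF \<theta>(1) p]] minimal v(1) in auto)
  then have ug: "B z j \<odot>\<^bsub>M\<^esub> g \<in> ideal_smult S M nonunits (carrier M)" using \<theta>(2)[OF v(1)] \<phi>C[OF z(2)] z(1) by simp
  have "inv (B z j) \<odot>\<^bsub>M\<^esub> (B z j \<odot>\<^bsub>M\<^esub> g) \<in> ideal_smult S M nonunits (carrier M)"
    by (rule M.submoduleD(4)[OF ideal_smult_submodule[OF M maxS order_refl] _ ug]) (use u in simp)
  moreover have "inv (B z j) \<odot>\<^bsub>M\<^esub> (B z j \<odot>\<^bsub>M\<^esub> g) = g" using u Bzj g(1) by (simp add: M.smult_assoc1[symmetric])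
  ultimately show False using g(2) by simp
qed

section \<open>Change of rings\<close>

definition restrict_scalars :: "('s \<Rightarrow> 'a) \<Rightarrow> ('a, 'm) module \<Rightarrow> ('s, 'm) module" where
  "restrict_scalars pr M = \<lparr>carrier = carrier M, monoid.mult = monoid.mult M, one = one M,
     zero = zero M, add = add M, smult = (\<lambda>s m. pr s \<odot>\<^bsub>M\<^esub> m)\<rparr>"

lemma restrict_scalars_simps [simp]:
  "carrier (restrict_scalars pr M) = carrier M" "\<zero>\<^bsub>restrict_scalars pr M\<^esub> = \<zero>\<^bsub>M\<^esub>"
  "v \<oplus>\<^bsub>restrict_scalars pr M\<^esub> w = v \<oplus>\<^bsub>M\<^esub> w" "s \<odot>\<^bsub>restrict_scalars pr M\<^esub> v = pr s \<odot>\<^bsub>M\<^esub> v"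
  "restrict_scalars pr (M\<lparr>carrier := H\<rparr>) = (restrict_scalars pr M)\<lparr>carrier := H\<rparr>"
  by (simp_all add: restrict_scalars_def)

locale ring_surjection = S: cring S + R: cring R for S :: "('s, 't) ring_scheme" and R :: "('a, 'b) ring_scheme" +
  fixes pr :: "'s \<Rightarrow> 'a"
  assumes pr: "pr \<in> ring_hom S R" and pr_surj: "pr ` carrier S = carrier R"
begin

lemma pr_simps [simp]:
  "s \<in> carrier S \<Longrightarrow> pr s \<in> carrier R"
  "s \<in> carrier S \<Longrightarrow> t \<in> carrier S \<Longrightarrow> pr (s \<otimes>\<^bsub>S\<^esub> t) = pr s \<otimes>\<^bsub>R\<^esub> pr t"
  "s \<in> carrier S \<Longrightarrow> t \<in> carrier S \<Longrightarrow> pr (s \<oplus>\<^bsub>S\<^esub> t) = pr s \<oplus>\<^bsub>R\<^esub> pr t"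
  "pr \<one>\<^bsub>S\<^esub> = \<one>\<^bsub>R\<^esub>"
  by (simp_all add: ring_hom_closed[OF pr] ring_hom_mult[OF pr] ring_hom_add[OF pr] ring_hom_one[OF pr])

lemma pr_zero [simp]: "pr \<zero>\<^bsub>S\<^esub> = \<zero>\<^bsub>R\<^esub>"
  using ring_hom_zero[OF pr S.ring_axioms R.ring_axioms] .

lemma pr_obtain: assumes "r \<in> carrier R" obtains s where "s \<in> carrier S" "pr s = r"
proof -
  have "r \<in> pr ` carrier S" using assms pr_surj by simp
  then show ?thesis using that by (auto elim: imageE)
qed

lemma module_restrict_scalars:
  assumes "module R M" shows "module S (restrict_scalars pr M)"
proof -
  interpret M: module R M by fact
  show ?thesis
  proof (intro moduleI abelian_groupI)
    fix v assume "v \<in> carrier (restrict_scalars pr M)"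
    then show "\<exists>w\<in>carrier (restrict_scalars pr M). w \<oplus>\<^bsub>restrict_scalars pr M\<^esub> v = \<zero>\<^bsub>restrict_scalars pr M\<^esub>"
      by (auto intro!: bexI[of _ "\<ominus>\<^bsub>M\<^esub> v"] simp: M.M.l_neg)
  qed (auto simp: M.M.a_ac M.smult_l_distr M.smult_r_distr M.smult_assoc1 S.is_cring)
qed

lemma linear_map_restrict_scalars_iff:
  "linear_map S (restrict_scalars pr M) (restrict_scalars pr N) h \<longleftrightarrow> linear_map R M N h"
proof -
  have "(\<forall>s\<in>carrier S. P (pr s)) \<longleftrightarrow> (\<forall>r\<in>carrier R. P r)" for P
    unfolding pr_surj[symmetric] by simp
  from this[of "\<lambda>r. \<forall>x\<in>carrier M. h (r \<odot>\<^bsub>M\<^esub> x) = r \<odot>\<^bsub>N\<^esub> h x"] show ?thesis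
    unfolding linear_map_def by simp
qed

lemma submodule_restrict_scalars_iff:
  assumes "module R M" shows "submodule H S (restrict_scalars pr M) \<longleftrightarrow> submodule H R M"
proof -
  have *: "(\<forall>s\<in>carrier S. P (pr s)) \<longleftrightarrow> (\<forall>r\<in>carrier R. P r)" for P
    unfolding pr_surj[symmetric] by simp
  show ?thesis
    using module.submodule_iff[OF module_restrict_scalars[OF assms], of H] module.submodule_iff[OF assms, of H]
      *[of "\<lambda>r. \<forall>x\<in>H. r \<odot>\<^bsub>M\<^esub> x \<in> H"] by simp
qed

lemma span_restrict_scalars:
  assumes "module R M" shows "span S (restrict_scalars pr M) T = span R M T"
  unfolding span_def submodule_restrict_scalars_iff[OF assms] ..

lemma free_on_reduction:
  assumes B: "finite B" and dom: "domain S" and f: "f \<in> carrier S" "f \<noteq> \<zero>\<^bsub>S\<^esub>"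
    and ker: "\<And>s. s \<in> carrier S \<Longrightarrow> pr s = \<zero>\<^bsub>R\<^esub> \<Longrightarrow> s \<in> PIdl\<^bsub>S\<^esub> f"
  shows "is_reduction_mod S f (free_on S B) (restrict_scalars pr (free_on R B)) (\<lambda>v b. pr (v b))"
  unfolding is_reduction_mod_def
proof (intro conjI ballI impI)
  interpret dom: domain S by (rule dom)
  show "module S (free_on S B)" by (rule free_on_module) (rule S.is_cring)
  have sub: "(\<lambda>b. pr (v b)) \<in> carrier (free_on R B)" if "v \<in> carrier (free_on S B)" for v
    using free_onD[OF that] by (intro free_on_finiteI[OF B]) auto
  show "linear_map S (free_on S B) (restrict_scalars pr (free_on R B)) (\<lambda>v b. pr (v b))"
    unfolding linear_map_def
  proof (intro conjI ballI)
    fix v w assume v: "v \<in> carrier (free_on S B)" and w: "w \<in> carrier (free_on S B)"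
    show "(\<lambda>b. pr ((v \<oplus>\<^bsub>free_on S B\<^esub> w) b)) = (\<lambda>b. pr (v b)) \<oplus>\<^bsub>restrict_scalars pr (free_on R B)\<^esub> (\<lambda>b. pr (w b))"
      using free_onD(1)[OF v] free_onD(1)[OF w] by simp
  next
    fix r v assume r: "r \<in> carrier S" and v: "v \<in> carrier (free_on S B)"
    show "(\<lambda>b. pr ((r \<odot>\<^bsub>free_on S B\<^esub> v) b)) = r \<odot>\<^bsub>restrict_scalars pr (free_on R B)\<^esub> (\<lambda>b. pr (v b))"
      using free_onD(1)[OF v] r by simp
  qed (use sub in auto)
  show "(\<lambda>v b. pr (v b)) ` carrier (free_on S B) = carrier (restrict_scalars pr (free_on R B))"
  proof (intro equalityI subsetI)
    fix g assume "g \<in> carrier (restrict_scalars pr (free_on R B))"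
    then have g: "g \<in> carrier (free_on R B)" by simp
    have "\<forall>b. \<exists>s. s \<in> carrier S \<and> pr s = g b" using free_onD(1)[OF g] pr_obtain by metis
    then obtain s where s: "\<And>b. s b \<in> carrier S" "\<And>b. pr (s b) = g b" by metis
    let ?v = "\<lambda>b. if b \<in> B then s b else \<zero>\<^bsub>S\<^esub>"
    show "g \<in> (\<lambda>v b. pr (v b)) ` carrier (free_on S B)"
    proof (rule image_eqI[of _ _ ?v])
      show "?v \<in> carrier (free_on S B)" by (rule free_on_finiteI[OF B]) (use s in auto)
      show "g = (\<lambda>b. pr (?v b))" using s free_onD(2)[OF g] by (auto simp: fun_eq_iff)
    qed
  qed (use sub in auto)
next
  fix v assume v: "v \<in> carrier (free_on S B)" and "(\<lambda>b. pr (v b)) = \<zero>\<^bsub>restrict_scalars pr (free_on R B)\<^esub>"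
  then have "pr (v b) = \<zero>\<^bsub>R\<^esub>" for b by (simp add: fun_eq_iff)
  then have "\<forall>b. \<exists>t. t \<in> carrier S \<and> v b = t \<otimes>\<^bsub>S\<^esub> f"
    using ker[OF free_onD(1)[OF v]] unfolding cgenideal_def by blast
  then obtain t where t: "\<And>b. t b \<in> carrier S" "\<And>b. v b = t b \<otimes>\<^bsub>S\<^esub> f" by metis
  let ?w = "\<lambda>b. if b \<in> B then t b else \<zero>\<^bsub>S\<^esub>"
  have "?w \<in> carrier (free_on S B)" by (rule free_on_finiteI[OF B]) (use t in auto)
  moreover have "v = f \<odot>\<^bsub>free_on S B\<^esub> ?w"
  proof
    fix b show "v b = (f \<odot>\<^bsub>free_on S B\<^esub> ?w) b"
    proof (cases "b \<in> B")
      case True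
      then show ?thesis using t(1)[of b] t(2)[of b] f(1) by (simp add: S.m_comm)
    next
      case False
      then show ?thesis using free_onD(2)[OF v False] f(1) by simp
    qed
  qed
  ultimately show "\<exists>w\<in>carrier (free_on S B). v = f \<odot>\<^bsub>free_on S B\<^esub> w" by (intro bexI[of _ ?w])
next
  interpret dom: domain S by (rule dom)
  fix v w assume v: "v \<in> carrier (free_on S B)" and w: "w \<in> carrier (free_on S B)"
    and "f \<odot>\<^bsub>free_on S B\<^esub> v = f \<odot>\<^bsub>free_on S B\<^esub> w"
  then have "f \<otimes>\<^bsub>S\<^esub> v b = f \<otimes>\<^bsub>S\<^esub> w b" for b by (simp add: fun_eq_iff)
  then have "v b = w b" for b using dom.m_lcancel[OF f(2,1)] free_onD(1)[OF v] free_onD(1)[OF w] by blast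
  then show "v = w" by auto
qed

end

lemma is_reduction_mod_comp:
  assumes red: "is_reduction_mod R f L' L pr" and L: "module R L" and X: "module R X"
    and h: "linear_map R L X h" "bij_betw h (carrier L) (carrier X)"
  shows "is_reduction_mod R f L' X (\<lambda>v. h (pr v))"
proof -
  have pr: "linear_map R L' L pr" "pr ` carrier L' = carrier L" using red by (auto simp: is_reduction_mod_def)
  have "pr v = \<zero>\<^bsub>L\<^esub>" if "v \<in> carrier L'" "h (pr v) = \<zero>\<^bsub>X\<^esub>" for v
  proof -
    interpret L: module R L by (rule L)
    have "h (pr v) = h \<zero>\<^bsub>L\<^esub>" using that(2) linear_map_zero[OF L X h(1)] by simp
    then show ?thesis using h(2) linear_mapD(1)[OF pr(1) that(1)] by (auto simp: bij_betw_def dest: inj_onD)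
  qed
  moreover have "(\<lambda>v. h (pr v)) ` carrier L' = carrier X"
    using pr(2) h(2) by (simp add: image_image[symmetric, of h pr] bij_betw_def)
  ultimately show ?thesis using red linear_map_comp[OF pr(1) h(1)] by (simp add: is_reduction_mod_def)
qed

lemma linear_map_span_image:
  assumes V: "module R V" and W: "module R W" and h: "linear_map R V W h" and T: "T \<subseteq> carrier V"
  shows "h ` span R V T = span R W (h ` T)"
proof -
  interpret W: module R W by (rule W)
  have hT: "h ` T \<subseteq> carrier W" using T linear_mapD(1)[OF h] by auto
  show ?thesis
  proof
    show "h ` span R V T \<subseteq> span R W (h ` T)"
      using linear_map_span_into[OF V W h span_submodule[OF W hT] T] span_superset[of "h ` T" R W] by blast
    show "span R W (h ` T) \<subseteq> h ` span R V T"
      by (rule span_minimal[OF linear_map_image[OF V W h span_submodule[OF V T]]])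
        (rule image_mono[OF span_superset])
  qed
qed

lemma lincomb_insert:
  assumes M: "module R M" and D: "insert t D \<subseteq> carrier M" and e: "e \<in> carrier (free_on R (insert t D))"
  shows "e(t := \<zero>\<^bsub>R\<^esub>) \<in> carrier (free_on R D)"
    "lincomb R M e = e t \<odot>\<^bsub>M\<^esub> t \<oplus>\<^bsub>M\<^esub> lincomb R M (e(t := \<zero>\<^bsub>R\<^esub>))"
proof -
  interpret M: module R M by (rule M)
  let ?F = "free_on R (insert t D)" and ?e = "e(t := \<zero>\<^bsub>R\<^esub>)"
  interpret F: module R ?F by (rule free_on_module) (rule M.R.is_cring)
  have "finite {a. a \<noteq> t \<and> e a \<noteq> \<zero>\<^bsub>R\<^esub>}" by (rule finite_subset[OF _ free_onD(3)[OF e]]) auto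
  moreover have "{a. ?e a \<noteq> \<zero>\<^bsub>R\<^esub>} = {a. a \<noteq> t \<and> e a \<noteq> \<zero>\<^bsub>R\<^esub>}" by auto
  ultimately have "finite {a. ?e a \<noteq> \<zero>\<^bsub>R\<^esub>}" by simp
  then show eD: "?e \<in> carrier (free_on R D)" using free_onD(1,2)[OF e] unfolding free_on_carrier by auto
  have eF: "?e \<in> carrier ?F" using eD free_on_mono[of D "insert t D" R] by auto
  have b: "basis_vec R t \<in> carrier ?F" by (rule basis_vec_closed[OF M.R.is_cring]) simp
  have et: "e t \<in> carrier R" by (rule free_onD(1)[OF e])
  note l = linear_mapD[OF linear_lincomb[OF M D]]
  have "e = e t \<odot>\<^bsub>?F\<^esub> basis_vec R t \<oplus>\<^bsub>?F\<^esub> ?e" using free_onD(1)[OF e] by (auto simp: basis_vec_def fun_eq_iff)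
  then have "lincomb R M e = lincomb R M (e t \<odot>\<^bsub>?F\<^esub> basis_vec R t \<oplus>\<^bsub>?F\<^esub> ?e)" by (rule arg_cong)
  also have "\<dots> = e t \<odot>\<^bsub>M\<^esub> lincomb R M (basis_vec R t) \<oplus>\<^bsub>M\<^esub> lincomb R M ?e"
    using l(2)[OF F.smult_closed[OF et b] eF] l(3)[OF et b] by simp
  finally show "lincomb R M e = e t \<odot>\<^bsub>M\<^esub> t \<oplus>\<^bsub>M\<^esub> lincomb R M ?e" using lincomb_basis_vec[OF M] D by simp
qed

lemma inj_on_lincomb_iff:
  assumes M: "module R M" and D: "D \<subseteq> carrier M"
  shows "inj_on (lincomb R M) (carrier (free_on R D)) \<longleftrightarrow>
    (\<forall>e\<in>carrier (free_on R D). lincomb R M e = \<zero>\<^bsub>M\<^esub> \<longrightarrow> e = (\<lambda>a. \<zero>\<^bsub>R\<^esub>))"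
proof -
  interpret M: module R M by (rule M)
  let ?F = "free_on R D"
  have F: "module R ?F" by (rule free_on_module) (rule M.R.is_cring)
  interpret F: module R ?F by (rule F)
  note l = linear_lincomb[OF M D]
  have l0: "lincomb R M (\<lambda>a. \<zero>\<^bsub>R\<^esub>) = \<zero>\<^bsub>M\<^esub>" using linear_map_zero[OF F M l] by simp
  have zF: "(\<lambda>a. \<zero>\<^bsub>R\<^esub>) \<in> carrier ?F" using F.M.zero_closed by simp
  show ?thesis
  proof
    assume inj: "inj_on (lincomb R M) (carrier ?F)"
    show "\<forall>e\<in>carrier ?F. lincomb R M e = \<zero>\<^bsub>M\<^esub> \<longrightarrow> e = (\<lambda>a. \<zero>\<^bsub>R\<^esub>)"
      using inj_onD[OF inj, of _ "\<lambda>a. \<zero>\<^bsub>R\<^esub>"] l0 zF by simp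
  next
    assume *: "\<forall>e\<in>carrier ?F. lincomb R M e = \<zero>\<^bsub>M\<^esub> \<longrightarrow> e = (\<lambda>a. \<zero>\<^bsub>R\<^esub>)"
    show "inj_on (lincomb R M) (carrier ?F)"
    proof (rule inj_onI)
      fix c d assume c: "c \<in> carrier ?F" "d \<in> carrier ?F" and eq: "lincomb R M c = lincomb R M d"
      have "lincomb R M (c \<ominus>\<^bsub>?F\<^esub> d) = \<zero>\<^bsub>M\<^esub>"
        using linear_map_minus(2)[OF F M l c] eq linear_mapD(1)[OF l c(2)] by (simp add: a_minus_def M.M.r_neg)
      then have 0: "c \<ominus>\<^bsub>?F\<^esub> d = \<zero>\<^bsub>?F\<^esub>" using * F.M.minus_closed[OF c] by simp
      have "c = (c \<ominus>\<^bsub>?F\<^esub> d) \<oplus>\<^bsub>?F\<^esub> d" using F.minus_add_cancel[OF c] by (simp only:)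
      also have "\<dots> = d" unfolding 0 using F.M.l_zero[OF c(2)] by (simp only:)
      finally show "c = d" .
    qed
  qed
qed

section \<open>Rigid modules over a one-dimensional hypersurface domain\<close>

text \<open>What \<open>relations_vanish\<close> asks for is found as follows. A generating set \<open>B\<close> of least cardinality
  has no relation with a unit coefficient. Its relations are finitely generated, since \<open>S\<close> is Noetherian.
  A largest independent set \<open>D\<close> of generators of the relations spans the free submodule \<open>N'\<close>. Every other
  generator \<open>t\<close> has a multiple \<open>r t\<close> in \<open>N'\<close> with \<open>r\<close> nonzero. As \<open>R\<close> has dimension one, \<open>r\<close> divides a power
  of each non-unit, so \<open>N'\<close> has finite colength.\<close>

lemma (in regular_pair) rigid_imp_free:
  fixes R :: "('r, 'c) ring_scheme" and M :: "('r, 'm) module" and pr :: "'a \<Rightarrow> 'r"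
  assumes dim: "krull_dim S = 2" and mx: "maximalideal nonunits S"
    and f: "f \<in> nonunits" "f \<noteq> \<zero>" and xf: "x \<notin> PIdl f"
    and Rdom: "domain R" and pr: "pr \<in> ring_hom S R" "pr ` carrier S = carrier R"
    and ker: "\<And>s. s \<in> carrier S \<Longrightarrow> pr s = \<zero>\<^bsub>R\<^esub> \<longleftrightarrow> s \<in> PIdl f"
    and fg: "fin_gen_module R M" and rig: "rigid R M"
  shows "free_module R M"
proof -
  interpret R: domain R by (rule Rdom)
  interpret pr: ring_surjection S R pr by unfold_locales (rule pr)+
  have dS: "domain S" by (rule dom.domain_axioms)
  have M: "module R M" using fg by (simp add: fin_gen_module_def)
  interpret M: module R M by (rule M)
  have maxS: "nonunits \<subseteq> carrier S" using ideal.Icarr[OF nonunits_ideal] by auto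
  have fS: "f \<in> carrier S" using f(1) maxS by auto
  have fR: "pr f = \<zero>\<^bsub>R\<^esub>" using ker[OF fS] cgenideal_self[OF fS] by simp
  have primef: "primeideal (PIdl f) S"
  proof (rule primeidealI[OF cgenideal_ideal[OF fS] is_cring])
    have "\<one> \<notin> PIdl f" using ker[of \<one>] by simp
    then show "carrier S \<noteq> PIdl f" by auto
    fix a b assume ab: "a \<in> carrier S" "b \<in> carrier S" "a \<otimes> b \<in> PIdl f"
    then have "pr a \<otimes>\<^bsub>R\<^esub> pr b = \<zero>\<^bsub>R\<^esub>" using ker[of "a \<otimes> b"] by simp
    then show "a \<in> PIdl f \<or> b \<in> PIdl f" using R.integral[of "pr a" "pr b"] ab ker by auto
  qed
  have fx: "f \<notin> PIdl x"
  proof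
    assume "f \<in> PIdl x"
    then obtain c where c: "c \<in> carrier S" "f = c \<otimes> x" by (auto simp: mem_PIdl)
    then have "c \<otimes> x \<in> PIdl f" using cgenideal_self[OF fS] by simp
    then have "c \<in> PIdl f" using primeideal.I_prime[OF primef c(1) x] xf by blast
    then obtain d where d: "d \<in> carrier S" "c = d \<otimes> f" by (auto simp: mem_PIdl)
    have "f \<otimes> \<one> = f \<otimes> (d \<otimes> x)" using c(2) d fS x by (simp add: m_ac)
    then have "\<one> = d \<otimes> x" using dom.m_lcancel[OF f(2) fS one_closed m_closed[OF d(1) x]] by simp
    moreover have "d \<otimes> x \<in> nonunits" by (rule ideal.I_l_closed[OF nonunits_ideal gens_in_nonunits(1) d(1)])
    ultimately have "\<one> \<in> nonunits" by (simp only:)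
    then show False using mem_nonunits_iff[OF one_closed] by simp
  qed
  have power: "\<exists>k::nat. \<exists>a\<in>carrier S. \<exists>b\<in>carrier S. s [^] k = a \<otimes> f \<oplus> b \<otimes> r"
    if r: "r \<in> carrier S" "pr r \<noteq> \<zero>\<^bsub>R\<^esub>" and s: "s \<in> nonunits" for r s
  proof -
    have un: "t \<in> Units S" if "t \<in> carrier S" "t \<notin> nonunits" for t using mem_nonunits_iff that by blast
    obtain k :: nat and a b where "a \<in> carrier S" "b \<in> carrier S" "s [^] k = a \<otimes> f \<oplus> b \<otimes> r"
      by (rule power_in_height_two_ideal[OF dS noeth dim mx un fS f(2) primef r(1) _ s])
        (use ker[OF r(1)] r(2) in auto)
    then show ?thesis by blast
  qed
  let ?gen = "\<lambda>B. B \<subseteq> carrier M \<and> finite B \<and> span R M B = carrier M"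
  obtain B1 where B1: "B1 \<subseteq> carrier M" "finite B1" "lincomb R M ` carrier (free_on R B1) = carrier M"
    using fg unfolding fin_gen_module_def by blast
  have "?gen B1" using B1 lincomb_image[OF M B1(1)] by simp
  from ex_has_least_nat[of ?gen, OF this, of card] obtain B
    where B': "?gen B \<and> (\<forall>B'. ?gen B' \<longrightarrow> card B \<le> card B')" by (rule exE)
  note B0 = conjunct1[OF B'] and Bmin = mp[OF spec[OF conjunct2[OF B']]]
  have B: "B \<subseteq> carrier M" "finite B" "span R M B = carrier M" using B0 by auto
  let ?p = "lincomb R M" and ?GR = "free_on R B" and ?N = "relations R M B"
  let ?G = "restrict_scalars pr ?GR" and ?MS = "restrict_scalars pr M"
  have GR: "module R ?GR" by (rule free_on_module[OF R.is_cring])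
  interpret GR: module R ?GR by (rule GR)
  have G: "module S ?G" by (rule pr.module_restrict_scalars[OF GR])
  have MS: "module S ?MS" by (rule pr.module_restrict_scalars[OF M])
  interpret G: module S ?G by (rule G)
  interpret MS: module S ?MS by (rule MS)
  have pR: "linear_map R ?GR M ?p" by (rule linear_lincomb[OF M B(1)])
  have p: "linear_map S ?G ?MS ?p" using pR by (simp only: pr.linear_map_restrict_scalars_iff)
  have p_surj: "?p ` carrier ?GR = carrier M" using lincomb_image[OF M B(1)] B(3) by simp
  have NR: "submodule ?N R ?GR" by (rule relations_submodule[OF M B(1)])
  have NS: "submodule ?N S ?G" using NR pr.submodule_restrict_scalars_iff[OF GR] by simp
  have NG: "?N \<subseteq> carrier ?GR" by (auto simp: relations_def)
  \<comment> \<open>a unit coefficient would make the generator \<open>b\<close> redundant\<close>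
  have coeff: "\<exists>m\<in>nonunits. v b = pr m" if v: "v \<in> ?N" and b: "b \<in> B" for v b
  proof -
    have vG: "v \<in> carrier ?GR" using v NG by auto
    obtain m where m: "m \<in> carrier S" "pr m = v b" using pr.pr_obtain[OF free_onD(1)[OF vG]] by metis
    have "m \<in> nonunits"
    proof (rule ccontr)
      assume "m \<notin> nonunits"
      then have u: "m \<in> Units S" using mem_nonunits_iff m(1) by blast
      have ui: "pr (inv m) \<otimes>\<^bsub>R\<^esub> v b = \<one>\<^bsub>R\<^esub>" using u m pr.pr_simps(2)[of "inv m" m] by simp
      let ?B = "B - {b}"
      have ins: "insert b ?B = B" using b by auto
      have bM: "b \<in> carrier M" using b B(1) by auto
      have sB: "submodule (span R M ?B) R M" using B(1) by (intro span_submodule[OF M]) auto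
      note s' = M.submoduleD[OF sB]
      have l: "v(b := \<zero>\<^bsub>R\<^esub>) \<in> carrier (free_on R ?B)" "?p v = v b \<odot>\<^bsub>M\<^esub> b \<oplus>\<^bsub>M\<^esub> ?p (v(b := \<zero>\<^bsub>R\<^esub>))"
        using lincomb_insert[OF M, of b ?B v] vG B(1) unfolding ins by auto
      have "?p (v(b := \<zero>\<^bsub>R\<^esub>)) \<in> span R M ?B" using lincomb_image[OF M, of ?B] B(1) l(1) by blast
      moreover have "v b \<odot>\<^bsub>M\<^esub> b \<oplus>\<^bsub>M\<^esub> ?p (v(b := \<zero>\<^bsub>R\<^esub>)) \<in> span R M ?B"
        using v l(2) s'(2) by (simp add: relations_def)
      ultimately have vb: "v b \<odot>\<^bsub>M\<^esub> b \<in> span R M ?B"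
        using M.submodule_add_cancel[OF sB] free_onD(1)[OF vG] bM by blast
      have "pr (inv m) \<odot>\<^bsub>M\<^esub> (v b \<odot>\<^bsub>M\<^esub> b) \<in> span R M ?B" by (rule s'(4)[OF _ vb]) (use u in simp)
      then have "b \<in> span R M ?B"
        using ui M.smult_assoc1[of "pr (inv m)" "v b" b] u free_onD(1)[OF vG] bM by simp
      then have "B \<subseteq> span R M ?B" using span_superset[of ?B R M] by auto
      then have "carrier M \<subseteq> span R M ?B" unfolding B(3)[symmetric] by (rule span_minimal[OF sB])
      then have "?gen ?B" using B s'(1) by auto
      then have "card B \<le> card ?B" by (rule Bmin)
      then show False using card_Diff1_less[OF B(2) b] by simp
    qed
    then show ?thesis using m(2) by (intro bexI[of _ m]) simp_all
  qed
  have minimal: "?N \<subseteq> ideal_smult S ?G nonunits (carrier ?G)"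
  proof
    fix v assume v: "v \<in> ?N"
    then have vG: "v \<in> carrier ?GR" using NG by auto
    have H: "submodule (ideal_smult S ?G nonunits (carrier ?G)) R ?GR"
      using ideal_smult_submodule[OF G maxS order_refl] pr.submodule_restrict_scalars_iff[OF GR] by simp
    have e: "basis_vec R b \<in> carrier ?GR" if "b \<in> B" for b by (rule basis_vec_closed[OF R.is_cring that])
    have "v = lin_ext R ?GR (\<lambda>b. basis_vec R b) v"
      using linear_map_eq_lin_ext[OF R.is_cring GR linear_map_id vG] by simp
    also have "\<dots> \<in> ideal_smult S ?G nonunits (carrier ?G)"
    proof (rule lin_ext_in_submodule[OF GR H _ vG])
      fix b assume b: "b \<in> B"
      obtain m where m: "m \<in> nonunits" "v b = pr m" using coeff[OF v b] by auto
      have "m \<odot>\<^bsub>?G\<^esub> basis_vec R b \<in> ideal_smult S ?G nonunits (carrier ?G)"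
        by (rule ideal_smultI[OF m(1)]) (use e[OF b] in simp)
      then show "v b \<odot>\<^bsub>?GR\<^esub> basis_vec R b \<in> ideal_smult S ?G nonunits (carrier ?G)" using m(2) by simp
    qed (use e in auto)
    finally show "v \<in> ideal_smult S ?G nonunits (carrier ?G)" .
  qed
  have "?N = {\<zero>\<^bsub>?G\<^esub>}"
  proof (cases "B = {}")
    case True
    then have "carrier ?GR \<subseteq> {\<zero>\<^bsub>?GR\<^esub>}" by (auto simp: free_on_carrier)
    then show ?thesis using NG GR.submoduleD(2)[OF NR] by auto
  next
    case False
    have "\<exists>g\<in>carrier M. g \<notin> ideal_smult S ?MS nonunits (carrier ?MS)"
    proof (rule ccontr)
      assume "\<not> ?thesis"
      then have sub: "v \<in> ideal_smult S ?MS nonunits (carrier ?MS)" if "v \<in> carrier ?MS" for v using that by auto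
      have "carrier ?MS \<subseteq> {\<zero>\<^bsub>?MS\<^esub>}"
      proof (rule nakayama_span[OF MS nonunits_ideal one_minus_nonunit MS.submodule_zero B(2)])
        show "B \<subseteq> carrier ?MS" "span S ?MS B = carrier ?MS" using B pr.span_restrict_scalars[OF M] by simp_all
        fix v assume v: "v \<in> carrier ?MS"
        have "v = \<zero>\<^bsub>?MS\<^esub> \<oplus>\<^bsub>?MS\<^esub> v" using v by simp
        then show "\<exists>l\<in>{\<zero>\<^bsub>?MS\<^esub>}. \<exists>w\<in>ideal_smult S ?MS nonunits (carrier ?MS). v = l \<oplus>\<^bsub>?MS\<^esub> w" using sub[OF v] by blast
      qed
      then have "carrier M \<subseteq> span R M {}" using M.submoduleD(2)[OF span_submodule[OF M, of "{}"]] by auto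
      then have "?gen {}" using M.submoduleD(1)[OF span_submodule[OF M, of "{}"]] by auto
      then have "card B \<le> card ({} :: 'm set)" by (rule Bmin)
      then show False using B(2) False by simp
    qed
    then obtain g where g: "g \<in> carrier ?MS" "g \<notin> ideal_smult S ?MS nonunits (carrier ?MS)" by auto
    \<comment> \<open>the preimage of the relations in the free \<open>S\<close>-module is finitely generated, hence so are the relations\<close>
    have kerS: "s \<in> PIdl f" if "s \<in> carrier S" "pr s = \<zero>\<^bsub>R\<^esub>" for s using ker that by blast
    let ?r = "\<lambda>v b. pr (v b)"
    have redG: "is_reduction_mod S f (free_on S B) ?G ?r" by (rule pr.free_on_reduction[OF B(2) dS fS f(2) kerS])
    have FB: "module S (free_on S B)" by (rule free_on_module[OF is_cring])
    interpret FB: module S "free_on S B" by (rule FB)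
    have r: "linear_map S (free_on S B) ?G ?r" "?r ` carrier (free_on S B) = carrier ?G"
      using redG by (simp_all add: is_reduction_mod_def)
    let ?L = "{v \<in> carrier (free_on S B). ?r v \<in> ?N}"
    have L: "submodule ?L S (free_on S B)" by (rule linear_map_preimage[OF FB G r(1) NS FB.carrier_is_submodule])
    obtain T where T: "T \<subseteq> ?L" "finite T" "span S (free_on S B) T = ?L"
      using submodule_of_free_finitely_generated[OF is_cring noeth B(2) L] by auto
    let ?I = "?r ` T"
    have "?r ` ?L = ?N"
    proof (intro equalityI subsetI)
      fix v assume v: "v \<in> ?N"
      then have "v \<in> ?r ` carrier (free_on S B)" using r(2) NG by auto
      then obtain w where "v = ?r w" "w \<in> carrier (free_on S B)" by (rule imageE)
      then show "v \<in> ?r ` ?L" using v by (intro image_eqI[of _ _ w]) auto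
    qed auto
    moreover have "?r ` span S (free_on S B) T = span S ?G ?I"
      by (rule linear_map_span_image[OF FB G r(1)]) (use T(1) in auto)
    ultimately have I: "finite ?I" "?I \<subseteq> ?N" "span S ?G ?I = ?N" using T by auto
    have IG: "?I \<subseteq> carrier ?GR" using I(2) NG by auto
    let ?q = "lincomb R ?GR"
    let ?ind = "\<lambda>D. D \<subseteq> ?I \<and> inj_on ?q (carrier (free_on R D))"
    have "?ind {}" by (auto simp: inj_on_def free_on_carrier fun_eq_iff)
    moreover have "card D < Suc (card ?I)" if "?ind D" for D using card_mono[OF I(1)] that by (simp add: less_Suc_eq_le)
    ultimately have "\<exists>D. ?ind D \<and> (\<forall>D'. ?ind D' \<longrightarrow> card D' \<le> card D)"
      by (intro ex_has_greatest_nat[of ?ind "{}" card "Suc (card ?I)"] allI impI) simp_all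
    then obtain D where D': "?ind D \<and> (\<forall>D'. ?ind D' \<longrightarrow> card D' \<le> card D)" by (rule exE)
    note D = conjunct1[OF D'] and Dmax = mp[OF spec[OF conjunct2[OF D']]]
    have DG: "D \<subseteq> carrier ?GR" using D IG by auto
    have fD: "finite D" using D I(1) finite_subset by blast
    have FD: "module R (free_on R D)" by (rule free_on_module[OF R.is_cring])
    let ?N' = "span R ?GR D"
    have qN': "?q ` carrier (free_on R D) = ?N'" by (rule lincomb_image[OF GR DG])
    have N'R: "submodule ?N' R ?GR" by (rule span_submodule[OF GR DG])
    have N'S: "submodule ?N' S ?G" using N'R pr.submodule_restrict_scalars_iff[OF GR] by simp
    have N'N: "?N' \<subseteq> ?N" by (rule span_minimal[OF NR]) (use D I(2) in auto)
    note N'' = GR.submoduleD[OF N'R]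
    have qD: "linear_map R (free_on R D) (?GR\<lparr>carrier := ?N'\<rparr>) ?q"
      by (rule linear_map_into[OF linear_lincomb[OF GR DG]]) (simp add: qN')
    have redN': "is_reduction_mod S f (free_on S D) (?G\<lparr>carrier := ?N'\<rparr>) (\<lambda>v. ?q (\<lambda>b. pr (v b)))"
    proof (rule is_reduction_mod_comp[OF pr.free_on_reduction[OF fD dS fS f(2) kerS]])
      show "module S (restrict_scalars pr (free_on R D))" by (rule pr.module_restrict_scalars[OF FD])
      show "module S (?G\<lparr>carrier := ?N'\<rparr>)" by (rule submodule.submodule_is_module[OF N'S G])
      show "linear_map S (restrict_scalars pr (free_on R D)) (?G\<lparr>carrier := ?N'\<rparr>) ?q"
        using qD unfolding restrict_scalars_simps(5)[symmetric] pr.linear_map_restrict_scalars_iff .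
      show "bij_betw ?q (carrier (restrict_scalars pr (free_on R D))) (carrier (?G\<lparr>carrier := ?N'\<rparr>))"
        using D qN' by (simp add: bij_betw_def)
    qed
    have tors: "\<exists>k::nat. s [^] k \<odot>\<^bsub>?G\<^esub> t \<in> ?N'" if t: "t \<in> ?I" and s: "s \<in> nonunits" for t s
    proof (cases "t \<in> D")
      case True
      then have "t \<in> ?N'" using span_superset[of D R ?GR] by auto
      moreover have "s [^] (0::nat) \<odot>\<^bsub>?G\<^esub> t = t" using t IG by (auto simp del: free_on_simps)
      ultimately show ?thesis by metis
    next
      case False
      have tG: "t \<in> carrier ?GR" using t IG by auto
      have iD: "insert t D \<subseteq> carrier ?GR" using tG DG by auto
      have "\<not> ?ind (insert t D)" using Dmax[of "insert t D"] False fD by auto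
      then have "\<not> inj_on ?q (carrier (free_on R (insert t D)))" using t D by blast
      then obtain e where e: "e \<in> carrier (free_on R (insert t D))" "?q e = \<zero>\<^bsub>?GR\<^esub>" "e \<noteq> (\<lambda>a. \<zero>\<^bsub>R\<^esub>)"
        unfolding inj_on_lincomb_iff[OF GR iD] by blast
      note l = lincomb_insert[OF GR iD e(1)]
      have etR: "e t \<in> carrier R" by (rule free_onD(1)[OF e(1)])
      have et: "e t \<noteq> \<zero>\<^bsub>R\<^esub>"
      proof
        assume "e t = \<zero>\<^bsub>R\<^esub>"
        then have "e(t := \<zero>\<^bsub>R\<^esub>) = e" by auto
        then show False using l(1) e(2,3) D inj_on_lincomb_iff[OF GR DG] by metis
      qed
      have "?q (e(t := \<zero>\<^bsub>R\<^esub>)) \<in> ?N'" using l(1) qN' by blast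
      moreover have "e t \<odot>\<^bsub>?GR\<^esub> t \<oplus>\<^bsub>?GR\<^esub> ?q (e(t := \<zero>\<^bsub>R\<^esub>)) \<in> ?N'"
        using l(2) e(2) N''(2) by (simp only:)
      ultimately have etN: "e t \<odot>\<^bsub>?GR\<^esub> t \<in> ?N'"
        using GR.submodule_add_cancel[OF N'R GR.smult_closed[OF etR tG]] by blast
      obtain r where r: "r \<in> carrier S" "pr r = e t" using pr.pr_obtain[OF etR] by metis
      obtain k :: nat and a b where ab: "a \<in> carrier S" "b \<in> carrier S" "s [^] k = a \<otimes> f \<oplus> b \<otimes> r"
        using power[OF r(1) _ s] r(2) et by metis
      have "pr (s [^] k) = pr b \<otimes>\<^bsub>R\<^esub> e t" using ab fS r fR etR by simp
      then have "s [^] k \<odot>\<^bsub>?G\<^esub> t = pr b \<odot>\<^bsub>?GR\<^esub> (e t \<odot>\<^bsub>?GR\<^esub> t)"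
        using GR.smult_assoc1[of "pr b" "e t" t] ab(2) etR tG by (simp del: free_on_simps)
      then have "s [^] k \<odot>\<^bsub>?G\<^esub> t \<in> ?N'" using N''(4)[OF pr.pr_simps(1)[OF ab(2)] etN] by (simp del: free_on_simps)
      then show ?thesis by blast
    qed
    have "\<exists>n. length_le S ?G ?N' (span S ?G (?I \<union> ?N')) n"
    proof (rule length_span_finite[OF G x y _ N'S I(1)])
      show "r \<in> Units S \<or> (\<exists>a\<in>carrier S. \<exists>b\<in>carrier S. r = a \<otimes> x \<oplus> b \<otimes> y)" if "r \<in> carrier S" for r
        by (rule unit_or[OF that])
      show "?I \<subseteq> carrier ?G" using IG by simp
      show "\<exists>i::nat. x [^] i \<odot>\<^bsub>?G\<^esub> t \<in> ?N'" "\<exists>j::nat. y [^] j \<odot>\<^bsub>?G\<^esub> t \<in> ?N'" if "t \<in> ?I" for t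
        using tors[OF that gens_in_nonunits(1)] tors[OF that gens_in_nonunits(2)] .
    qed
    then obtain n where n: "length_le S ?G ?N' (span S ?G (?I \<union> ?N')) n" by (rule exE)
    have fin: "length_le S ?G ?N' ?N n"
      by (rule length_le_mono[OF n order_refl]) (use I(3) span_mono[of ?I "?I \<union> ?N'" S ?G] in auto)
    show ?thesis
    proof (rule relations_vanish[OF G MS p _ fS fx _ _ _ I redG N'S N'N redN' fin _ minimal g])
      show "?p ` carrier ?G = carrier ?MS" using p_surj by simp
      show "?N = {v \<in> carrier ?G. ?p v = \<zero>\<^bsub>?MS\<^esub>}" by (simp add: relations_def)
    next
      fix v assume v: "v \<in> carrier ?G"
      show "f \<odot>\<^bsub>?G\<^esub> v = \<zero>\<^bsub>?G\<^esub>" using v fR free_onD(1)[of v R B] by simp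
      assume "x \<odot>\<^bsub>?G\<^esub> v = \<zero>\<^bsub>?G\<^esub>"
      then have "pr x \<otimes>\<^bsub>R\<^esub> v b = \<zero>\<^bsub>R\<^esub>" for b by (simp add: fun_eq_iff)
      moreover have "pr x \<noteq> \<zero>\<^bsub>R\<^esub>" using ker[OF x] xf by simp
      ultimately have "v b = \<zero>\<^bsub>R\<^esub>" for b using R.integral[of "pr x" "v b"] v free_onD(1)[of v R B] x by auto
      then show "v = \<zero>\<^bsub>?G\<^esub>" by (simp add: fun_eq_iff)
    next
      fix \<phi> assume "linear_map S (?G\<lparr>carrier := ?N\<rparr>) ?MS \<phi>"
      then have \<phi>: "linear_map R (?GR\<lparr>carrier := ?N\<rparr>) M \<phi>"
        unfolding restrict_scalars_simps(5)[symmetric] pr.linear_map_restrict_scalars_iff .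
      obtain k where k: "linear_map R ?GR M k" "\<And>v. v \<in> ?N \<Longrightarrow> k v = \<phi> v"
        using rig Ext1_trivial_iff[OF M M B(1,3)] \<phi> unfolding rigid_def by blast
      have "\<forall>b\<in>B. \<exists>t. t \<in> carrier ?GR \<and> ?p t = k (basis_vec R b)"
      proof
        fix b assume "b \<in> B"
        then have "k (basis_vec R b) \<in> ?p ` carrier ?GR"
          unfolding p_surj by (intro linear_mapD(1)[OF k(1)] basis_vec_closed[OF R.is_cring])
        then show "\<exists>t. t \<in> carrier ?GR \<and> ?p t = k (basis_vec R b)" by (auto elim: imageE)
      qed
      from bchoice[OF this] obtain t where t: "\<forall>b\<in>B. t b \<in> carrier ?GR \<and> ?p (t b) = k (basis_vec R b)" by (rule exE)
      let ?\<theta> = "lin_ext R ?GR t"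
      have \<theta>: "linear_map R ?GR ?GR ?\<theta>" by (rule linear_lin_ext[OF GR]) (use t in auto)
      have pk: "?p (?\<theta> v) = k v" if "v \<in> carrier ?GR" for v
      proof (rule free_linear_map_eq[OF R.is_cring M linear_map_comp[OF \<theta> pR] k(1) _ that])
        fix b assume b: "b \<in> B"
        have "?\<theta> (basis_vec R b) = t b" by (rule lin_ext_basis_vec[OF GR]) (use t b in auto)
        then show "?p (?\<theta> (basis_vec R b)) = k (basis_vec R b)" using t b by simp
      qed
      have "linear_map S ?G ?G ?\<theta>" using \<theta> unfolding pr.linear_map_restrict_scalars_iff .
      moreover have "\<forall>v\<in>?N. ?p (?\<theta> v) = \<phi> v"
      proof
        fix v assume v: "v \<in> ?N"
        then have "v \<in> carrier ?GR" using NG by blast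
        from pk[OF this] show "?p (?\<theta> v) = \<phi> v" unfolding k(2)[OF v] .
      qed
      ultimately show "\<exists>\<theta>. linear_map S ?G ?G \<theta> \<and> (\<forall>v\<in>?N. ?p (\<theta> v) = \<phi> v)"
        by (intro exI[of _ ?\<theta>] conjI)
    qed
  qed
  then have "inj_on ?p (carrier ?GR)"
    unfolding inj_on_lincomb_iff[OF M B(1)] by (auto simp: relations_def)
  then show ?thesis unfolding free_module_def using M B(1) p_surj by (auto simp: bij_betw_def)
qed

section \<open>Rings with zero divisors\<close>

text \<open>If \<open>a b = 0\<close>, the ideal \<open>M = R a\<close> is an example. Multiplication by \<open>a\<close> is injective on it: from
  \<open>a s a = 0\<close> follows \<open>(s a)^2 = 0\<close>, so \<open>s a = 0\<close>, as \<open>R\<close> is reduced. A relation on the generator \<open>a\<close>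
  is killed by \<open>a\<close>, so every homomorphism from the relations to \<open>M\<close> is zero and extends. But \<open>b\<close> kills
  \<open>M\<close>, so \<open>M\<close> is not free.\<close>

lemma rigid_not_free_if_not_domain:
  fixes R :: "('a, 'b) ring_scheme"
  assumes red: "reduced_ring R" and one: "\<one>\<^bsub>R\<^esub> \<noteq> \<zero>\<^bsub>R\<^esub>" and ndom: "\<not> domain R"
    and room: "lists (carrier R) \<lesssim> (UNIV :: 'm set)"
  shows "\<exists>M :: ('a, 'm) module. fin_gen_module R M \<and> rigid R M \<and> \<not> free_module R M"
proof -
  interpret R: cring R using red by (simp add: reduced_ring_def)
  have "\<exists>a\<in>carrier R. \<exists>b\<in>carrier R. a \<otimes>\<^bsub>R\<^esub> b = \<zero>\<^bsub>R\<^esub> \<and> a \<noteq> \<zero>\<^bsub>R\<^esub> \<and> b \<noteq> \<zero>\<^bsub>R\<^esub>"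
  proof (rule ccontr)
    assume "\<not> ?thesis"
    then have "domain R" using one by (intro domain.intro R.is_cring domain_axioms.intro) auto
    then show False using ndom by simp
  qed
  then obtain a b where a: "a \<in> carrier R" "a \<noteq> \<zero>\<^bsub>R\<^esub>" and b: "b \<in> carrier R" "b \<noteq> \<zero>\<^bsub>R\<^esub>"
    and ab: "a \<otimes>\<^bsub>R\<^esub> b = \<zero>\<^bsub>R\<^esub>" by blast
  let ?R = "ring_module R"
  have RM: "module R ?R" by (rule ring_module_module[OF R.is_cring])
  interpret RM: module R ?R by (rule RM)
  let ?J = "PIdl\<^bsub>R\<^esub> a"
  have J: "submodule ?J R ?R" using submodule_ring_module_iff[OF R.is_cring] R.cgenideal_ideal[OF a(1)] by simp
  let ?M0 = "?R\<lparr>carrier := ?J\<rparr>"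
  have M0: "module R ?M0" by (rule submodule.submodule_is_module[OF J RM])
  interpret M0: module R ?M0 by (rule M0)
  have aJ: "a \<in> ?J" by (rule R.cgenideal_self[OF a(1)])
  have Jmem: "r \<in> ?J \<longleftrightarrow> (\<exists>s\<in>carrier R. r = s \<otimes>\<^bsub>R\<^esub> a)" for r by (auto simp: cgenideal_def)
  have span0: "span R ?M0 {a} = ?J"
  proof
    have s: "submodule (span R ?M0 {a}) R ?M0" by (rule span_submodule[OF M0]) (use aJ in simp)
    have "a \<in> span R ?M0 {a}" using span_superset[of "{a}" R ?M0] by simp
    then have "s \<otimes>\<^bsub>R\<^esub> a \<in> span R ?M0 {a}" if "s \<in> carrier R" for s
      using M0.submoduleD(4)[OF s that] by simp
    then show "?J \<subseteq> span R ?M0 {a}" using Jmem by auto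
    show "span R ?M0 {a} \<subseteq> ?J" using M0.submoduleD(1)[OF s] by auto
  qed
  have "fin_gen_module R ?M0" unfolding fin_gen_module_def
    using M0 lincomb_image[OF M0, of "{a}"] span0 aJ by (intro conjI exI[of _ "{a}"]) auto
  from fin_gen_module_copy[OF this room] obtain M :: "('a, 'm) module" and h
    where M: "module R M" and h: "h \<in> module_hom R ?M0 M" and hb: "bij_betw h ?J (carrier M)" by auto
  interpret M: module R M by (rule M)
  have hl: "linear_map R ?M0 M h" by (rule module_homD(1)[OF h])
  note h' = linear_mapD[OF hl]
  have h0: "h \<zero>\<^bsub>R\<^esub> = \<zero>\<^bsub>M\<^esub>" using linear_map_zero[OF M0 M hl] by simp
  have hz: "r = \<zero>\<^bsub>R\<^esub>" if "r \<in> ?J" "h r = \<zero>\<^bsub>M\<^esub>" for r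
  proof -
    have "\<zero>\<^bsub>R\<^esub> \<in> ?J" using M0.M.zero_closed by simp
    moreover have "inj_on h ?J" using hb by (simp add: bij_betw_def)
    ultimately show ?thesis using inj_onD[of h ?J r "\<zero>\<^bsub>R\<^esub>"] that h0 by simp
  qed
  let ?m = "h a"
  have m: "?m \<in> carrier M" using h'(1)[of a] aJ by simp
  have m0: "?m \<noteq> \<zero>\<^bsub>M\<^esub>" using hz[OF aJ] a(2) by auto
  have hs: "h (s \<otimes>\<^bsub>R\<^esub> a) = s \<odot>\<^bsub>M\<^esub> ?m" if "s \<in> carrier R" for s using h'(3)[OF that, of a] aJ by simp
  have spanM: "span R M {?m} = carrier M"
    using linear_map_span_image[OF M0 M hl, of "{a}"] aJ span0 hb by (simp add: bij_betw_def)
  have fgM: "fin_gen_module R M" unfolding fin_gen_module_def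
    using M lincomb_image[OF M, of "{?m}"] spanM m by (intro conjI exI[of _ "{?m}"]) auto
  have elem: "\<exists>s\<in>carrier R. v = h (s \<otimes>\<^bsub>R\<^esub> a)" if "v \<in> carrier M" for v
  proof -
    have "v \<in> h ` ?J" using hb that by (simp add: bij_betw_def)
    then show ?thesis using Jmem by auto
  qed
  have a_inj: "v = \<zero>\<^bsub>M\<^esub>" if v: "v \<in> carrier M" and av: "a \<odot>\<^bsub>M\<^esub> v = \<zero>\<^bsub>M\<^esub>" for v
  proof -
    obtain s where s: "s \<in> carrier R" "v = h (s \<otimes>\<^bsub>R\<^esub> a)" using elem[OF v] by blast
    have sa: "s \<otimes>\<^bsub>R\<^esub> a \<in> carrier R" using s(1) a(1) by simp
    have "h (a \<otimes>\<^bsub>R\<^esub> (s \<otimes>\<^bsub>R\<^esub> a)) = \<zero>\<^bsub>M\<^esub>"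
      using h'(3)[OF a(1), of "s \<otimes>\<^bsub>R\<^esub> a"] s Jmem av by auto
    moreover have "a \<otimes>\<^bsub>R\<^esub> (s \<otimes>\<^bsub>R\<^esub> a) \<in> ?J" using a(1) s(1) by (auto simp: Jmem R.m_assoc[symmetric])
    ultimately have z: "a \<otimes>\<^bsub>R\<^esub> (s \<otimes>\<^bsub>R\<^esub> a) = \<zero>\<^bsub>R\<^esub>" using hz by blast
    have "(s \<otimes>\<^bsub>R\<^esub> a) [^]\<^bsub>R\<^esub> (2::nat) = s \<otimes>\<^bsub>R\<^esub> (a \<otimes>\<^bsub>R\<^esub> (s \<otimes>\<^bsub>R\<^esub> a))"
      using s(1) a(1) by (simp add: numeral_2_eq_2 R.m_assoc)
    then have "(s \<otimes>\<^bsub>R\<^esub> a) [^]\<^bsub>R\<^esub> (2::nat) = \<zero>\<^bsub>R\<^esub>" using z s(1) by simp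
    then have "s \<otimes>\<^bsub>R\<^esub> a = \<zero>\<^bsub>R\<^esub>" using red sa unfolding reduced_ring_def by blast
    then show ?thesis using s(2) h0 by simp
  qed
  have bM: "b \<odot>\<^bsub>M\<^esub> v = \<zero>\<^bsub>M\<^esub>" if v: "v \<in> carrier M" for v
  proof -
    obtain s where s: "s \<in> carrier R" "v = h (s \<otimes>\<^bsub>R\<^esub> a)" using elem[OF v] by blast
    have "s \<otimes>\<^bsub>R\<^esub> a \<in> ?J" using s(1) Jmem by blast
    then have "b \<odot>\<^bsub>M\<^esub> v = h (b \<otimes>\<^bsub>R\<^esub> (s \<otimes>\<^bsub>R\<^esub> a))" using h'(3)[OF b(1), of "s \<otimes>\<^bsub>R\<^esub> a"] s(2) by simp
    also have "b \<otimes>\<^bsub>R\<^esub> (s \<otimes>\<^bsub>R\<^esub> a) = s \<otimes>\<^bsub>R\<^esub> (a \<otimes>\<^bsub>R\<^esub> b)" using a(1) b(1) s(1) by (simp add: R.m_ac)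
    finally show ?thesis using ab s(1) h0 by simp
  qed
  have "rigid R M" unfolding rigid_def
  proof (subst Ext1_trivial_iff[OF M M _ spanM], safe)
    show "?m \<in> carrier M" by (rule m)
    fix \<phi> let ?N = "relations R M {?m}" and ?G = "free_on R {?m}"
    assume \<phi>: "linear_map R (?G\<lparr>carrier := ?N\<rparr>) M \<phi>"
    have G: "module R ?G" by (rule free_on_module[OF R.is_cring])
    interpret G: module R ?G by (rule G)
    have sub: "{?m} \<subseteq> carrier M" using m by simp
    have N: "module R (?G\<lparr>carrier := ?N\<rparr>)"
      by (rule submodule.submodule_is_module[OF relations_submodule[OF M sub] G])
    have "\<phi> v = \<zero>\<^bsub>M\<^esub>" if v: "v \<in> ?N" for v
    proof -
      have vG: "v \<in> carrier ?G" and pv: "lincomb R M v = \<zero>\<^bsub>M\<^esub>" using v by (auto simp: relations_def)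
      note vR = free_onD(1)[OF vG]
      have "lincomb R M v = (\<Oplus>\<^bsub>M\<^esub>y\<in>{?m}. v y \<odot>\<^bsub>M\<^esub> y)"
        by (rule lincomb_superset[OF M sub vG]) (use free_onD(2)[OF vG] m in auto)
      then have "v ?m \<odot>\<^bsub>M\<^esub> ?m = \<zero>\<^bsub>M\<^esub>" using pv vR m by simp
      then have "h (v ?m \<otimes>\<^bsub>R\<^esub> a) = \<zero>\<^bsub>M\<^esub>" using hs[OF vR] by simp
      then have va: "v ?m \<otimes>\<^bsub>R\<^esub> a = \<zero>\<^bsub>R\<^esub>" using hz[of "v ?m \<otimes>\<^bsub>R\<^esub> a"] Jmem vR by blast
      have "a \<otimes>\<^bsub>R\<^esub> v y = \<zero>\<^bsub>R\<^esub>" for y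
        using va vR a(1) free_onD(2)[OF vG, of y] by (cases "y = ?m") (simp_all add: R.m_comm)
      then have "a \<odot>\<^bsub>?G\<^esub> v = \<zero>\<^bsub>?G\<^esub>" by simp
      then have "\<phi> (a \<odot>\<^bsub>?G\<^esub> v) = \<zero>\<^bsub>M\<^esub>" using linear_map_zero[OF N M \<phi>] by simp
      then have "a \<odot>\<^bsub>M\<^esub> \<phi> v = \<zero>\<^bsub>M\<^esub>" using linear_mapD(3)[OF \<phi> a(1), of v] v by simp
      then show ?thesis using a_inj linear_mapD(1)[OF \<phi>, of v] v by simp
    qed
    then show "\<exists>k. linear_map R ?G M k \<and> (\<forall>v\<in>?N. k v = \<phi> v)"
      using linear_map_zero_map[OF G M] by (intro exI[of _ "\<lambda>v. \<zero>\<^bsub>M\<^esub>"]) simp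
  qed
  moreover have "\<not> free_module R M"
  proof
    assume "free_module R M"
    then obtain B where B: "B \<subseteq> carrier M" "bij_betw (lincomb R M) (carrier (free_on R B)) (carrier M)"
      by (auto simp: free_module_def)
    have inj: "\<forall>e\<in>carrier (free_on R B). lincomb R M e = \<zero>\<^bsub>M\<^esub> \<longrightarrow> e = (\<lambda>a. \<zero>\<^bsub>R\<^esub>)"
      using B inj_on_lincomb_iff[OF M B(1)] by (simp add: bij_betw_def)
    interpret F: module R "free_on R B" by (rule free_on_module[OF R.is_cring])
    note l = linear_mapD[OF linear_lincomb[OF M B(1)]]
    have "?m \<in> lincomb R M ` carrier (free_on R B)" using B(2) m by (simp add: bij_betw_def)
    then obtain v where v: "?m = lincomb R M v" "v \<in> carrier (free_on R B)" by (rule imageE)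
    have "B \<noteq> {}"
    proof
      assume "B = {}"
      then have "v = (\<lambda>a. \<zero>\<^bsub>R\<^esub>)" using v(2) by (auto simp: free_on_carrier)
      then have "?m = \<zero>\<^bsub>M\<^esub>" using v(1) by (simp add: lincomb_def)
      then show False using m0 by simp
    qed
    then obtain e where e: "e \<in> B" by auto
    have be: "basis_vec R e \<in> carrier (free_on R B)" by (rule basis_vec_closed[OF R.is_cring e])
    let ?v = "b \<odot>\<^bsub>free_on R B\<^esub> basis_vec R e"
    have "lincomb R M ?v = b \<odot>\<^bsub>M\<^esub> lincomb R M (basis_vec R e)" by (rule l(3)[OF b(1) be])
    then have "lincomb R M ?v = \<zero>\<^bsub>M\<^esub>" using bM[OF l(1)[OF be]] by simp
    then have "?v = (\<lambda>a. \<zero>\<^bsub>R\<^esub>)" using inj F.smult_closed[OF b(1) be] by blast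
    then have "b \<otimes>\<^bsub>R\<^esub> \<one>\<^bsub>R\<^esub> = \<zero>\<^bsub>R\<^esub>" by (auto simp: fun_eq_iff basis_vec_def dest: spec[of _ e])
    then show False using b by simp
  qed
  ultimately show ?thesis using fgM by blast
qed

section \<open>The characterization\<close>

lemma hypersurface_surjection:
  fixes R :: "('a, 'b) ring_scheme" and S :: "('s, 't) ring_scheme"
  assumes S: "cring S" and R: "cring R" and f: "f \<in> carrier S" and iso: "R \<simeq> S Quot (PIdl\<^bsub>S\<^esub> f)"
  obtains pr where "pr \<in> ring_hom S R" "pr ` carrier S = carrier R"
    "\<And>s. s \<in> carrier S \<Longrightarrow> pr s = \<zero>\<^bsub>R\<^esub> \<longleftrightarrow> s \<in> PIdl\<^bsub>S\<^esub> f"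
proof -
  interpret S: cring S by (rule S)
  interpret R: cring R by (rule R)
  let ?I = "PIdl\<^bsub>S\<^esub> f"
  interpret I: ideal ?I S by (rule S.cgenideal_ideal[OF f])
  let ?Q = "S Quot ?I" and ?c = "(+>\<^bsub>S\<^esub>) ?I"
  interpret Q: ring ?Q by (rule I.quotient_is_ring)
  have "?Q \<simeq> R" using ring_iso_sym[OF R.ring_axioms iso] .
  then obtain g where g: "g \<in> ring_iso ?Q R" by (auto simp: is_ring_iso_def)
  then have gh: "g \<in> ring_hom ?Q R" and gb: "bij_betw g (carrier ?Q) (carrier R)" by (auto simp: ring_iso_def)
  have c: "?c \<in> ring_hom S ?Q" by (rule I.rcos_ring_hom)
  have cs: "?c ` carrier S = carrier ?Q" by (auto simp: FactRing_def A_RCOSETS_def' )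
  have 1: "(\<lambda>s. g (?c s)) \<in> ring_hom S R" using ring_hom_trans[OF c gh] by (simp add: comp_def)
  have 2: "(\<lambda>s. g (?c s)) ` carrier S = carrier R" using cs gb by (simp add: image_image[symmetric, of g ?c] bij_betw_def)
  have 3: "g (?c s) = \<zero>\<^bsub>R\<^esub> \<longleftrightarrow> s \<in> ?I" if s: "s \<in> carrier S" for s
  proof -
    have cQ: "?c s \<in> carrier ?Q" using cs s by blast
    have "g \<zero>\<^bsub>?Q\<^esub> = \<zero>\<^bsub>R\<^esub>" by (rule ring_hom_zero[OF gh Q.ring_axioms R.ring_axioms])
    then have "g (?c s) = \<zero>\<^bsub>R\<^esub> \<longleftrightarrow> ?c s = \<zero>\<^bsub>?Q\<^esub>" 
      using gb cQ Q.zero_closed inj_on_eq_iff[of g "carrier ?Q" "?c s" "\<zero>\<^bsub>?Q\<^esub>"] by (auto simp: bij_betw_def)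
    also have "\<zero>\<^bsub>?Q\<^esub> = ?I" by (simp add: FactRing_def)
    also have "?c s = ?I \<longleftrightarrow> s \<in> ?I" using I.a_rcos_self[OF s] I.a_rcos_const[of s] by auto
    finally show ?thesis .
  qed
  show ?thesis by (rule that[OF 1 2 3])
qed

theorem proposition1p1:
  fixes R :: "('a, 'b) ring_scheme" and S :: "('s, 't) ring_scheme" and f :: 's
  assumes "complete_hypersurface_1 R S f"
    and "reduced_ring R"
    and "lists (carrier R) \<lesssim> (UNIV :: 'm set)"
      \<comment> \<open>every finitely generated module has a copy with elements in \<open>'m\<close>; see \<open>fin_gen_module_copy\<close>\<close>
  shows "domain R \<longleftrightarrow>
    (\<forall>M :: ('a, 'm) module. fin_gen_module R M \<and> rigid R M \<longrightarrow> free_module R M)"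
proof -
  have reg: "regular_local_ring S" and dim: "krull_dim S = 2" and fm: "f \<in> max_ideal S" and f0: "f \<noteq> \<zero>\<^bsub>S\<^esub>"
    and R: "cring R" and iso: "R \<simeq> S Quot (PIdl\<^bsub>S\<^esub> f)"
    using assms(1) by (simp_all add: complete_hypersurface_1_def)
  have S: "noetherian_ring S" "local_ring S" using reg by (auto simp: regular_local_ring_def)
  interpret R: cring R by (rule R)
  interpret S: cring S using S(2) by (simp add: local_ring_def)
  have mx: "maximalideal (max_ideal S) S" by (rule local_ring_units(1)[OF S])
  interpret mx: maximalideal "max_ideal S" S by (rule mx)
  have fS: "f \<in> carrier S" using fm by auto
  obtain pr where pr: "pr \<in> ring_hom S R" "pr ` carrier S = carrier R"
    and ker: "\<And>s. s \<in> carrier S \<Longrightarrow> pr s = \<zero>\<^bsub>R\<^esub> \<longleftrightarrow> s \<in> PIdl\<^bsub>S\<^esub> f"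
    using hypersurface_surjection[OF S.is_cring R fS iso] by metis
  have "PIdl\<^bsub>S\<^esub> f \<subseteq> max_ideal S" by (rule S.cgenideal_minimal[OF mx.is_ideal fm])
  then have "\<one>\<^bsub>S\<^esub> \<notin> PIdl\<^bsub>S\<^esub> f" using mx.one_imp_carrier mx.I_notcarr by auto
  then have one: "\<one>\<^bsub>R\<^esub> \<noteq> \<zero>\<^bsub>R\<^esub>" using ker[OF S.one_closed] ring_hom_one[OF pr(1)] by simp
  obtain x y where tg: "two_generated_local S x y" and dom: "domain S"
    and mm: "two_generated_local.nonunits S x y = max_ideal S"
    and yx: "\<And>i::nat. y [^]\<^bsub>S\<^esub> i \<notin> PIdl\<^bsub>S\<^esub> x" and xy: "\<And>i::nat. x [^]\<^bsub>S\<^esub> i \<notin> PIdl\<^bsub>S\<^esub> y"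
    using regular_local_ring_dim_2[OF reg dim] by metis
  interpret tg: two_generated_local S x y by (rule tg)
  interpret tg': two_generated_local S y x by (rule tg.swap)
  interpret dom: domain S by (rule dom)
  have mm': "tg'.nonunits = max_ideal S"
    unfolding mm[symmetric] tg'.nonunits_eq tg.nonunits_eq by (rule S.set_add_comm) (auto simp: cgenideal_def tg.x tg.y)
  have nz: "x \<noteq> \<zero>\<^bsub>S\<^esub>" "y \<noteq> \<zero>\<^bsub>S\<^esub>"
  proof -
    have "\<zero>\<^bsub>S\<^esub> \<in> PIdl\<^bsub>S\<^esub> r" if "r \<in> carrier S" for r
      using additive_subgroup.zero_closed[OF ideal.axioms(1)[OF S.cgenideal_ideal[OF that]]] .
    then show "x \<noteq> \<zero>\<^bsub>S\<^esub>" "y \<noteq> \<zero>\<^bsub>S\<^esub>" using yx[of 1] xy[of 1] tg.x tg.y by auto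
  qed
  \<comment> \<open>if \<open>f\<close> generated the maximal ideal, one of \<open>x\<close> and \<open>y\<close> would divide the other\<close>
  have notboth: "x \<notin> PIdl\<^bsub>S\<^esub> f \<or> y \<notin> PIdl\<^bsub>S\<^esub> f"
  proof (rule ccontr)
    assume "\<not> ?thesis"
    then obtain a b where a: "a \<in> carrier S" "x = a \<otimes>\<^bsub>S\<^esub> f" and b: "b \<in> carrier S" "y = b \<otimes>\<^bsub>S\<^esub> f"
      by (auto simp: cgenideal_def)
    have "f \<in> tg.nonunits" using fm mm by simp
    then obtain c d where cd: "c \<in> carrier S" "d \<in> carrier S" "f = c \<otimes>\<^bsub>S\<^esub> x \<oplus>\<^bsub>S\<^esub> d \<otimes>\<^bsub>S\<^esub> y"
      unfolding tg.nonunits_def by blast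
    have "f \<otimes>\<^bsub>S\<^esub> \<one>\<^bsub>S\<^esub> = c \<otimes>\<^bsub>S\<^esub> x \<oplus>\<^bsub>S\<^esub> d \<otimes>\<^bsub>S\<^esub> y" using cd(3) fS by simp
    also have "\<dots> = f \<otimes>\<^bsub>S\<^esub> (c \<otimes>\<^bsub>S\<^esub> a \<oplus>\<^bsub>S\<^esub> d \<otimes>\<^bsub>S\<^esub> b)"
      unfolding a(2) b(2) using a(1) b(1) cd(1,2) fS by algebra
    finally have e: "\<one>\<^bsub>S\<^esub> = c \<otimes>\<^bsub>S\<^esub> a \<oplus>\<^bsub>S\<^esub> d \<otimes>\<^bsub>S\<^esub> b"
      using dom.m_lcancel[OF f0 fS] a(1) b(1) cd(1,2) by simp
    interpret m: ideal tg.nonunits S by (rule tg.nonunits_ideal)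
    have "a \<in> Units S \<or> b \<in> Units S"
    proof (rule ccontr)
      assume "\<not> ?thesis"
      then have "a \<in> tg.nonunits" "b \<in> tg.nonunits" using tg.mem_nonunits_iff a(1) b(1) by auto
      then have "c \<otimes>\<^bsub>S\<^esub> a \<oplus>\<^bsub>S\<^esub> d \<otimes>\<^bsub>S\<^esub> b \<in> tg.nonunits" using cd by (intro m.a_closed m.I_l_closed)
      then have "\<one>\<^bsub>S\<^esub> \<in> tg.nonunits" using e by simp
      then show False using tg.mem_nonunits_iff[OF S.one_closed] by simp
    qed
    then show False
    proof
      assume u: "a \<in> Units S"
      have "y = (b \<otimes>\<^bsub>S\<^esub> inv\<^bsub>S\<^esub> a) \<otimes>\<^bsub>S\<^esub> x"
      proof -
        have "inv\<^bsub>S\<^esub> a \<otimes>\<^bsub>S\<^esub> x = f" unfolding a(2) using u a(1) fS by (simp add: S.m_assoc[symmetric])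
        then show ?thesis using u b fS tg.x by (simp add: S.m_assoc)
      qed
      then have "y \<in> PIdl\<^bsub>S\<^esub> x" unfolding cgenideal_def using u b(1) by blast
      then show False using yx[of 1] tg.y by simp
    next
      assume u: "b \<in> Units S"
      have "x = (a \<otimes>\<^bsub>S\<^esub> inv\<^bsub>S\<^esub> b) \<otimes>\<^bsub>S\<^esub> y"
      proof -
        have "inv\<^bsub>S\<^esub> b \<otimes>\<^bsub>S\<^esub> y = f" unfolding b(2) using u b(1) fS by (simp add: S.m_assoc[symmetric])
        then show ?thesis using u a fS tg.y by (simp add: S.m_assoc)
      qed
      then have "x \<in> PIdl\<^bsub>S\<^esub> y" unfolding cgenideal_def using u a(1) by blast
      then show False using xy[of 1] tg.x by simp
    qed
  qed
  have rp: "regular_pair S x y" "regular_pair S y x"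
    using tg tg.swap dom nz yx xy by (auto intro!: regular_pair.intro regular_pair_axioms.intro)
  show ?thesis
  proof
    assume Rdom: "domain R"
    show "\<forall>M :: ('a, 'm) module. fin_gen_module R M \<and> rigid R M \<longrightarrow> free_module R M"
    proof (intro allI impI)
      fix M :: "('a, 'm) module" assume M: "fin_gen_module R M \<and> rigid R M"
      from notboth show "free_module R M"
      proof
        assume xf: "x \<notin> PIdl\<^bsub>S\<^esub> f"
        show ?thesis
          by (rule regular_pair.rigid_imp_free[OF rp(1) dim _ _ f0 xf Rdom pr ker]) (use M mm mx fm in auto)
      next
        assume yf: "y \<notin> PIdl\<^bsub>S\<^esub> f"
        show ?thesis
          by (rule regular_pair.rigid_imp_free[OF rp(2) dim _ _ f0 yf Rdom pr ker]) (use M mm' mx fm in auto)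
      qed
    qed
  next
    assume all: "\<forall>M :: ('a, 'm) module. fin_gen_module R M \<and> rigid R M \<longrightarrow> free_module R M"
    show "domain R"
    proof (rule ccontr)
      assume "\<not> domain R"
      from rigid_not_free_if_not_domain[OF assms(2) one this assms(3)] show False using all by blast
    qed
  qed
qed

end
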